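(* Let $m\ge 2$ be an integer, let $\delta\in(-m,0)$, and put $\tau=3+\delta/m\in(2,3)$. For each of the preferential attachment models (a), (b), (c) and for every $\sigma>1/(3-\tau)$, with $$C_G=\frac{4}{|\log(\tau-2)|}+\frac{4\sigma}{\log m},$$ the diameter of $G_{m,\delta}(t)$ is, with high probability as $t\to\infty$, bounded above by $C_G\log\log t$.
   Context: Preferential attachment models. For an integer $m\ge1$ and a real $\delta\ge -m$, $G_{m,\delta}(t)$ is a random multigraph with vertex set $[t]=\{1,\dots,t\}$ and $mt$ edges. $D_i(t)$ denotes the degree of vertex $i$ at time $t$ (a self-loop adds 2 to the degree). Model (a), $m=1$: $G_{1,\delta}(1)$ is one vertex with one self-loop. Given $G_{1,\delta}(t)$, a vertex $t+1$ with a single edge is added; the other end point of the edge is $t+1$ itself with probability $\frac{1+\delta}{t(2+\delta)+(1+\delta)}$, and is $i\in[t]$ with probability $\frac{D_i(t)+\delta}{t(2+\delta)+(1+\delta)}$. For $m>1$: put $\delta'=\delta/m$, take $G_{1,\delta'}(mt)$, and for each $1\le j\le t$ merge its vertices $(j-1)m+1,\dots,jm$ into the single vertex $j$ of $G_{m,\delta}(t)$ (keeping all edges). Model (b), $m=1$: start from $G_{1,\delta}(2)$, consisting of vertices $1,2$ joined by 2 edges. For $t\ge2$, given $G_{1,\delta}(t)$, vertex $t+1$ with a single edge is added, attached to $i\in[t]$ with probability $\frac{D_i(t)+\delta}{t(2+\delta)}$. For $m>1$, $G_{m,\delta}(t)$ is obtained from $G_{1,\delta/m}(mt)$ by the same merging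 as in model (a). Model (c), $m\ge1$: start from $G_{m,\delta}(2)$, consisting of vertices $1,2$ joined by $2m$ edges. For $t\ge2$, given $G_{m,\delta}(t)$, vertex $t+1$ is added with $m$ edges whose other end points are chosen independently, each equal to $i\in[t]$ with probability $\frac{D_i(t)+\delta}{t(2m+\delta)}$. Diameter: $\mathrm{diam}(G)=\max\{\mathrm{dist}_G(i,j): i,j\in G,\ \mathrm{dist}_G(i,j)<\infty\}$, with $\mathrm{dist}_G$ the graph distance. A sequence of events $A_t$ occurs with high probability if $\mathbb P(A_t)\to1$ as $t\to\infty$. *)

theory Defs
  imports "HOL-Probability.Probability" "HOL-Library.Extended_Nat" "HOL-Library.Multiset"
begin

section \<open>Finite undirected multigraphs\<close>

text \<open>
  An edge is the two-element multiset of its end points; a self-loop at \<open>v\<close> is \<open>{#v, v#}\<close>.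
  With this encoding a self-loop contributes 2 to the degree.
\<close>

datatype mgraph = MGraph (verts: "nat set") (edges: "nat multiset multiset")

definition deg :: "mgraph \<Rightarrow> nat \<Rightarrow> nat" where
  "deg G v = count (\<Sum>\<^sub># (edges G)) v"

definition adj :: "mgraph \<Rightarrow> (nat \<times> nat) set" where
  "adj G = {(u, v). {#u, v#} \<in># edges G}"

text \<open>The distance is the least length of a walk, and \<open>\<infinity>\<close> if there is no walk.\<close>

definition gdist :: "mgraph \<Rightarrow> nat \<Rightarrow> nat \<Rightarrow> enat" where
  "gdist G i j = (INF n\<in>{n. (i, j) \<in> adj G ^^ n}. enat n)"

definition diam :: "mgraph \<Rightarrow> nat" where
  "diam G = Max {d. \<exists>i\<in>verts G. \<exists>j\<in>verts G. gdist G i j = enat d}"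

definition add_vertex :: "nat \<Rightarrow> nat multiset \<Rightarrow> mgraph \<Rightarrow> mgraph" where
  "add_vertex v us G =
     MGraph (insert v (verts G)) (edges G + image_mset (\<lambda>u. {#v, u#}) us)"

text \<open>\<open>block m\<close> maps the vertices \<open>(j - 1) * m + 1, \<dots>, j * m\<close> to \<open>j\<close>; see \<open>block_eq_iff\<close>.\<close>

definition block :: "nat \<Rightarrow> nat \<Rightarrow> nat" where
  "block m v = (v - 1) div m + 1"

definition merge :: "nat \<Rightarrow> mgraph \<Rightarrow> mgraph" where
  "merge m G = MGraph (block m ` verts G) (image_mset (image_mset (block m)) (edges G))"


section \<open>Preferential attachment models\<close>

text \<open>
  Each model is given by the law of the graph at time \<open>t\<close>. \<open>evolve step t0 G0 k\<close> is the law at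
  time \<open>t0 + k\<close> of the Markov chain that starts from \<open>G0\<close> at time \<open>t0\<close> and moves from time \<open>t\<close> to
  time \<open>t + 1\<close> according to the kernel \<open>step t\<close>. The laws below are meaningful for
  \<open>t \<ge> t0\<close>; for smaller \<open>t\<close> truncated subtraction returns the initial graph.

  The weights passed to \<open>embed_pmf\<close> are probability mass functions on all graphs that can occur;
  see \<open>pmf_attach_a\<close>, \<open>pmf_attach_b\<close>, \<open>pmf_attach_c\<close> and the invariants that follow them.
\<close>

primrec evolve :: "(nat \<Rightarrow> mgraph \<Rightarrow> mgraph pmf) \<Rightarrow> nat \<Rightarrow> mgraph \<Rightarrow> nat \<Rightarrow> mgraph pmf" where
  "evolve step t0 G0 0 = return_pmf G0"
| "evolve step t0 G0 (Suc k) = bind_pmf (evolve step t0 G0 k) (step (t0 + k))"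

definition attach_a :: "real \<Rightarrow> nat \<Rightarrow> mgraph \<Rightarrow> nat pmf" where
  "attach_a \<delta> t G = embed_pmf (\<lambda>i.
     if i = t + 1 then (1 + \<delta>) / (real t * (2 + \<delta>) + (1 + \<delta>))
     else if i \<in> {1..t} then (real (deg G i) + \<delta>) / (real t * (2 + \<delta>) + (1 + \<delta>))
     else 0)"

definition attach_b :: "real \<Rightarrow> nat \<Rightarrow> mgraph \<Rightarrow> nat pmf" where
  "attach_b \<delta> t G = embed_pmf (\<lambda>i.
     if i \<in> {1..t} then (real (deg G i) + \<delta>) / (real t * (2 + \<delta>)) else 0)"

definition attach_c :: "nat \<Rightarrow> real \<Rightarrow> nat \<Rightarrow> mgraph \<Rightarrow> nat pmf" where
  "attach_c m \<delta> t G = embed_pmf (\<lambda>i.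
     if i \<in> {1..t} then (real (deg G i) + \<delta>) / (real t * (2 * real m + \<delta>)) else 0)"

definition step_a :: "real \<Rightarrow> nat \<Rightarrow> mgraph \<Rightarrow> mgraph pmf" where
  "step_a \<delta> t G = map_pmf (\<lambda>i. add_vertex (t + 1) {#i#} G) (attach_a \<delta> t G)"

definition step_b :: "real \<Rightarrow> nat \<Rightarrow> mgraph \<Rightarrow> mgraph pmf" where
  "step_b \<delta> t G = map_pmf (\<lambda>i. add_vertex (t + 1) {#i#} G) (attach_b \<delta> t G)"

definition step_c :: "nat \<Rightarrow> real \<Rightarrow> nat \<Rightarrow> mgraph \<Rightarrow> mgraph pmf" where
  "step_c m \<delta> t G =
     map_pmf (\<lambda>is. add_vertex (t + 1) (mset is) G) (replicate_pmf m (attach_c m \<delta> t G))"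

definition pa1_a :: "real \<Rightarrow> nat \<Rightarrow> mgraph pmf" where
  "pa1_a \<delta> t = evolve (step_a \<delta>) 1 (MGraph {1} {#{#1, 1#}#}) (t - 1)"

definition pa1_b :: "real \<Rightarrow> nat \<Rightarrow> mgraph pmf" where
  "pa1_b \<delta> t = evolve (step_b \<delta>) 2 (MGraph {1, 2} (replicate_mset 2 {#1, 2#})) (t - 2)"

text \<open>For \<open>m = 1\<close> merging is the identity on graphs with positive vertices; see \<open>merge_1\<close>.\<close>

definition pa_a :: "nat \<Rightarrow> real \<Rightarrow> nat \<Rightarrow> mgraph pmf" where
  "pa_a m \<delta> t = map_pmf (merge m) (pa1_a (\<delta> / real m) (m * t))"

definition pa_b :: "nat \<Rightarrow> real \<Rightarrow> nat \<Rightarrow> mgraph pmf" where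
  "pa_b m \<delta> t = map_pmf (merge m) (pa1_b (\<delta> / real m) (m * t))"

definition pa_c :: "nat \<Rightarrow> real \<Rightarrow> nat \<Rightarrow> mgraph pmf" where
  "pa_c m \<delta> t =
     evolve (step_c m \<delta>) 2 (MGraph {1, 2} (replicate_mset (2 * m) {#1, 2#})) (t - 2)"

text \<open>
  An event about the graph at time \<open>t\<close> only involves the law \<open>P t\<close> of that graph,
  so no joint law is needed.
\<close>

definition whp :: "(nat \<Rightarrow> mgraph pmf) \<Rightarrow> (nat \<Rightarrow> mgraph \<Rightarrow> bool) \<Rightarrow> bool" where
  "whp P A \<longleftrightarrow> (\<lambda>t. measure_pmf.prob (P t) {G. A t G}) \<longlonglongrightarrow> 1"


section \<open>Well-definedness\<close>

lemma block_eq_iff: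
  assumes "m > 0" "v > 0" "j > 0"
  shows "block m v = j \<longleftrightarrow> v \<in> {(j - 1) * m + 1..j * m}"
proof -
  obtain v' j' where v: "v = Suc v'" and j: "j = Suc j'"
    using assms by (metis gr0_implies_Suc)
  have "v' div m = j' \<longleftrightarrow> j' * m \<le> v' \<and> v' < (j' + 1) * m"
    using assms(1) by (metis Suc_eq_plus1 div_nat_eqI dividend_less_times_div
        div_times_less_eq_dividend mult.commute mult_Suc_right add.commute mult_Suc)
  then show ?thesis
    by (auto simp: block_def v j)
qed

lemma merge_1:
  assumes "0 \<notin> verts G" "\<forall>e\<in>#edges G. set_mset e \<subseteq> verts G"
  shows "merge 1 G = G"
proof -
  have b: "block 1 v = v" if "v \<in> verts G" for v
    using that assms(1) by (cases v) (auto simp: block_def)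
  have "image_mset (block 1) e = e" if "e \<in># edges G" for e
  proof -
    have "image_mset (block 1) e = image_mset (\<lambda>x. x) e"
      using assms(2) that b by (intro image_mset_cong) auto
    then show ?thesis by simp
  qed
  then have "image_mset (image_mset (block 1)) (edges G) = image_mset (\<lambda>x. x) (edges G)"
    by (intro image_mset_cong) auto
  moreover have "block 1 ` verts G = verts G"
    using b by force
  ultimately show ?thesis
    by (simp add: merge_def)
qed

definition pa_inv :: "nat \<Rightarrow> nat \<Rightarrow> mgraph \<Rightarrow> bool" where
  "pa_inv m t G \<longleftrightarrow> verts G = {1..t} \<and> size (edges G) = m * t \<and>
     (\<forall>e\<in>#edges G. size e = 2 \<and> set_mset e \<subseteq> {1..t}) \<and> (\<forall>i\<in>{1..t}. m \<le> deg G i)"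

lemma size_sum_mset_edges:
  fixes E :: "nat multiset multiset"
  assumes "\<forall>e\<in>#E. size e = 2"
  shows "size (\<Sum>\<^sub># E) = 2 * size E"
  using assms by (induction E) auto

lemma sum_deg:
  assumes "pa_inv m t G"
  shows "(\<Sum>i\<in>{1..t}. deg G i) = 2 * m * t"
proof -
  have sub: "set_mset (\<Sum>\<^sub># (edges G)) \<subseteq> {1..t}"
    using assms by (auto simp: pa_inv_def)
  have "(\<Sum>i\<in>{1..t}. deg G i) = size (\<Sum>\<^sub># (edges G))"
    unfolding deg_def size_multiset_overloaded_eq using sub
    by (intro sum.mono_neutral_right) (auto simp: count_eq_zero_iff)
  also have "\<dots> = 2 * m * t"
    using assms by (subst size_sum_mset_edges) (auto simp: pa_inv_def)
  finally show ?thesis .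
qed

lemma pmf_embed_finite:
  fixes f :: "nat \<Rightarrow> real"
  assumes "finite A" "\<And>i. i \<in> A \<Longrightarrow> f i \<ge> 0" "\<And>i. i \<notin> A \<Longrightarrow> f i = 0" "sum f A = 1"
  shows "pmf (embed_pmf f) i = f i"
proof (rule pmf_embed_pmf)
  show nn: "0 \<le> f x" for x
    using assms(2,3) by (cases "x \<in> A") auto
  have "(\<integral>\<^sup>+x. ennreal (f x) \<partial>count_space UNIV) = (\<Sum>x\<in>A. ennreal (f x))"
    using assms(1,3) by (intro nn_integral_count_space') auto
  also have "\<dots> = 1"
    using assms(4) nn by simp
  finally show "(\<integral>\<^sup>+x. ennreal (f x) \<partial>count_space UNIV) = 1" .
qed

lemma pmf_attach_c:
  assumes "pa_inv m t G" "m \<ge> 1" "\<delta> \<ge> - real m" "t \<ge> 1"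
  shows "pmf (attach_c m \<delta> t G) i =
    (if i \<in> {1..t} then (real (deg G i) + \<delta>) / (real t * (2 * real m + \<delta>)) else 0)"
proof -
  let ?c = "real t * (2 * real m + \<delta>)"
  have c: "?c > 0" using assms by (intro mult_pos_pos) auto
  have "(\<Sum>i\<in>{1..t}. real (deg G i) + \<delta>) = real (2 * m * t) + real t * \<delta>"
    by (subst sum.distrib) (simp flip: sum_deg[OF assms(1)])
  also have "\<dots> = ?c"
    by (simp add: algebra_simps)
  finally have "(\<Sum>i\<in>{1..t}. (real (deg G i) + \<delta>) / ?c) = 1"
    using c by (metis divide_self less_irrefl sum_divide_distrib)
  moreover have "real (deg G i) + \<delta> \<ge> 0" if "i \<in> {1..t}" for i
  proof -
    have "m \<le> deg G i" using assms(1) that by (auto simp: pa_inv_def)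
    then show ?thesis using assms(3) by linarith
  qed
  ultimately show ?thesis
    unfolding attach_c_def using c
    by (subst pmf_embed_finite[where A = "{1..t}"]) (auto intro!: divide_nonneg_pos)
qed

lemma attach_b_eq: "attach_b \<delta> t G = attach_c 1 \<delta> t G"
  by (simp only: attach_b_def attach_c_def of_nat_1 mult_1_right)

lemma pmf_attach_b:
  assumes "pa_inv 1 t G" "\<delta> \<ge> -1" "t \<ge> 1"
  shows "pmf (attach_b \<delta> t G) i =
    (if i \<in> {1..t} then (real (deg G i) + \<delta>) / (real t * (2 + \<delta>)) else 0)"
  using pmf_attach_c[of 1 t G \<delta> i] assms by (simp add: attach_b_eq)

lemma pmf_attach_a:
  assumes "pa_inv 1 t G" "\<delta> \<ge> -1" "t \<ge> 1"
  shows "pmf (attach_a \<delta> t G) i =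
    (if i = t + 1 then (1 + \<delta>) / (real t * (2 + \<delta>) + (1 + \<delta>))
     else if i \<in> {1..t} then (real (deg G i) + \<delta>) / (real t * (2 + \<delta>) + (1 + \<delta>))
     else 0)"
proof -
  let ?c = "real t * (2 + \<delta>) + (1 + \<delta>)"
  let ?f = "\<lambda>i. if i = t + 1 then (1 + \<delta>) / ?c
     else if i \<in> {1..t} then (real (deg G i) + \<delta>) / ?c else 0"
  have "real t * (2 + \<delta>) > 0"
    using assms by (intro mult_pos_pos) auto
  then have c: "?c > 0" using assms(2) by linarith
  have "(\<Sum>i\<in>{1..t}. real (deg G i) + \<delta>) = real (2 * t) + real t * \<delta>"
    using sum_deg[OF assms(1)] by (subst sum.distrib) (simp flip: of_nat_sum)
  then have s: "(\<Sum>i\<in>{1..t}. (real (deg G i) + \<delta>) / ?c) = (real (2 * t) + real t * \<delta>) / ?c"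
    by (simp flip: sum_divide_distrib)
  have "sum ?f {1..t + 1} = ?f (t + 1) + sum ?f {1..t}"
    by simp
  also have "sum ?f {1..t} = (\<Sum>i\<in>{1..t}. (real (deg G i) + \<delta>) / ?c)"
    by (intro sum.cong) auto
  also have "?f (t + 1) + \<dots> = ((1 + \<delta>) + (real (2 * t) + real t * \<delta>)) / ?c"
    unfolding s by (simp add: add_divide_distrib)
  also have "(1 + \<delta>) + (real (2 * t) + real t * \<delta>) = ?c"
    by (simp add: algebra_simps)
  also have "?c / ?c = 1"
    using c by (metis divide_self less_irrefl)
  finally have "sum ?f {1..t + 1} = 1" .
  moreover have "real (deg G i) + \<delta> \<ge> 0" if "i \<in> {1..t}" for i
  proof -
    have "1 \<le> deg G i" using assms(1) that by (auto simp: pa_inv_def)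
    then show ?thesis using assms(2) by linarith
  qed
  ultimately show ?thesis
    unfolding attach_a_def using c assms(2)
    by (subst pmf_embed_finite[where A = "{1..t + 1}"]) (auto intro!: divide_nonneg_pos)
qed

lemma deg_add_vertex:
  "deg (add_vertex v us G) i = deg G i + (if i = v then size us else 0) + count us i"
proof -
  have "count (\<Sum>\<^sub># (image_mset (\<lambda>u. {#v, u#}) us)) i = (if i = v then size us else 0) + count us i"
    by (induction us) auto
  then show ?thesis
    by (simp add: deg_def add_vertex_def)
qed

lemma pa_inv_add_vertex:
  assumes "pa_inv m t G" "size us = m" "set_mset us \<subseteq> {1..t + 1}"
  shows "pa_inv m (t + 1) (add_vertex (t + 1) us G)"
  unfolding pa_inv_def
proof (intro conjI ballI)
  show "verts (add_vertex (t + 1) us G) = {1..t + 1}"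
    using assms by (auto simp: pa_inv_def add_vertex_def)
  show "size (edges (add_vertex (t + 1) us G)) = m * (t + 1)"
    using assms by (auto simp: pa_inv_def add_vertex_def)
  show "size e = 2" "set_mset e \<subseteq> {1..t + 1}" if "e \<in># edges (add_vertex (t + 1) us G)" for e
    using assms that by (force simp: pa_inv_def add_vertex_def)+
  show "m \<le> deg (add_vertex (t + 1) us G) i" if "i \<in> {1..t + 1}" for i
    using assms that unfolding deg_add_vertex
    by (cases "i = t + 1") (auto simp: pa_inv_def intro: trans_le_add1)
qed

lemma evolve_inv:
  assumes "Q t0 G0"
    and "\<And>t G H. t \<ge> t0 \<Longrightarrow> Q t G \<Longrightarrow> H \<in> set_pmf (step t G) \<Longrightarrow> Q (t + 1) H"
    and "H \<in> set_pmf (evolve step t0 G0 k)"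
  shows "Q (t0 + k) H"
  using assms(3)
proof (induction k arbitrary: H)
  case 0
  then show ?case using assms(1) by simp
next
  case (Suc k)
  then obtain G where "G \<in> set_pmf (evolve step t0 G0 k)" "H \<in> set_pmf (step (t0 + k) G)"
    by auto
  then show ?case using Suc.IH assms(2)[of "t0 + k" G H] by simp
qed

lemma pa1_a_inv:
  assumes "\<delta> \<ge> -1" "t \<ge> 1" "G \<in> set_pmf (pa1_a \<delta> t)"
  shows "pa_inv 1 t G"
proof -
  have "pa_inv 1 (1 + (t - 1)) G"
  proof (rule evolve_inv[where Q = "pa_inv 1"])
    show "G \<in> set_pmf (evolve (step_a \<delta>) 1 (MGraph {1} {#{#1, 1#}#}) (t - 1))"
      using assms(3) by (simp add: pa1_a_def)
    show "pa_inv 1 1 (MGraph {1} {#{#1, 1#}#})"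
      by (simp add: pa_inv_def deg_def)
    fix s G H assume *: "s \<ge> (1::nat)" "pa_inv 1 s G" "H \<in> set_pmf (step_a \<delta> s G)"
    then obtain i where "i \<in> set_pmf (attach_a \<delta> s G)" and H: "H = add_vertex (s + 1) {#i#} G"
      by (auto simp: step_a_def)
    then have "i \<in> {1..s + 1}"
      using pmf_attach_a[OF *(2) assms(1) *(1), of i] by (auto simp: set_pmf_iff split: if_splits)
    then show "pa_inv 1 (s + 1) H"
      unfolding H by (intro pa_inv_add_vertex * ) auto
  qed
  then show ?thesis using assms(2) by simp
qed

lemma pa_inv_start: "pa_inv m 2 (MGraph {1, 2} (replicate_mset (2 * m) {#1, 2#}))"
proof -
  have s: "\<Sum>\<^sub># (replicate_mset k {#1, 2#}) = replicate_mset k 1 + replicate_mset k (2::nat)" for k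
    by (induction k) auto
  have "{1..2} = {1, 2::nat}" by auto
  then show ?thesis
    unfolding pa_inv_def deg_def mgraph.sel s by auto
qed

lemma pa_c_inv:
  assumes "m \<ge> 1" "\<delta> \<ge> - real m" "t \<ge> 2" "G \<in> set_pmf (pa_c m \<delta> t)"
  shows "pa_inv m t G"
proof -
  have "pa_inv m (2 + (t - 2)) G"
  proof (rule evolve_inv[where Q = "pa_inv m"])
    show "G \<in> set_pmf (evolve (step_c m \<delta>) 2
        (MGraph {1, 2} (replicate_mset (2 * m) {#1, 2#})) (t - 2))"
      using assms(4) by (simp add: pa_c_def)
    show "pa_inv m 2 (MGraph {1, 2} (replicate_mset (2 * m) {#1, 2#}))"
      by (rule pa_inv_start)
    fix s G H assume *: "s \<ge> (2::nat)" "pa_inv m s G" "H \<in> set_pmf (step_c m \<delta> s G)"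
    then obtain js where js: "js \<in> set_pmf (replicate_pmf m (attach_c m \<delta> s G))"
      and H: "H = add_vertex (s + 1) (mset js) G"
      by (auto simp: step_c_def)
    have "j \<in> {1..s}" if "j \<in> set_pmf (attach_c m \<delta> s G)" for j
      using pmf_attach_c[OF *(2) assms(1,2), of j] *(1) that
      by (auto simp: set_pmf_iff split: if_splits)
    then have "set js \<subseteq> {1..s + 1}" "length js = m"
      using js by (fastforce simp: set_replicate_pmf)+
    then show "pa_inv m (s + 1) H"
      unfolding H by (intro pa_inv_add_vertex * ) auto
  qed
  moreover have "2 + (t - 2) = t" using assms(3) by simp
  ultimately show ?thesis by (simp only:)
qed

lemma pa1_b_eq: "pa1_b \<delta> t = pa_c 1 \<delta> t"
proof -
  have "step_b \<delta> = step_c 1 \<delta>"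
    unfolding step_b_def step_c_def attach_b_eq replicate_pmf_1
    by (intro ext) (simp add: map_pmf_comp)
  then show ?thesis by (simp add: pa1_b_def pa_c_def)
qed

lemma pa1_b_inv:
  assumes "\<delta> \<ge> -1" "t \<ge> 2" "G \<in> set_pmf (pa1_b \<delta> t)"
  shows "pa_inv 1 t G"
  using pa_c_inv[of 1 \<delta> t G] assms by (simp add: pa1_b_eq)

end

theory Submission
  imports Defs "HOL-Real_Asymp.Real_Asymp"
begin

text \<open>
  Put \<open>g = \<tau> - 2\<close>. Vertices of degree at least \<open>(log t)\<^sup>s\<close> with \<open>s > 1 / (3 - \<tau>)\<close> form the core. The total degree
  of the oldest \<open>n\<close> vertices is concentrated, so the vertices of degree at least \<open>u\<close> carry a fraction of at
  least about \<open>u\<close> to the power \<open>-g\<close> of the total degree. Hence a vertex of degree \<open>u\<close> at time \<open>t / 2\<close> is joined by a vertex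
  born in \<open>(t / 2, t]\<close> to a vertex of degree \<open>(u / log t)\<close> to the power \<open>1 / g\<close>, and iterating this
  \<open>log log t / |log g|\<close> times reaches vertices of degree more than \<open>t\<close> to the power \<open>1 / 2\<close>, any two of which have a
  common neighbour. For the periphery, a vertex is at distance more than \<open>k + 1\<close> from the core only if all
  its \<open>m\<close> edges lead to vertices at distance more than \<open>k\<close>; so the fraction \<open>\<beta>\<close> of the total degree carried by such
  vertices satisfies \<open>\<beta>(k + 1) \<le> \<beta>(k)\<^sup>m\<close> up to a polynomially small error, and becomes
  polynomially small after \<open>\<sigma> log log t / log m\<close> steps. Since vertices outside the core have small degree,
  boundedly many further steps leave no such vertex at all. The gap between \<open>4\<sigma>\<close> and \<open>2\<sigma>\<close> in the constant absorbs
  all losses. Every probability estimate is an instance of Ville's inequality for an explicit superharmonic function.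
\<close>

text \<open>Nothing here is independent: the bad vertices of level \<open>k + 1\<close> are built
  from those of level \<open>k\<close> at all earlier times, and their weight keeps growing. So each
  level is bounded at all times from \<open>N T\<close> on simultaneously, and the bound for one
  level is the guard under which the next is estimated. The growth of old bad vertices does no harm
  because preferential attachment preserves proportions: the equilibrium fraction fed by newcomers
  that are bad with probability \<open>\<beta> ^ m\<close> is \<open>\<beta> ^ m\<close> itself.
  Concentration leaves an additive error of about \<open>N T\<close> to the power -1/4, so this
  works only down to a small negative power of \<open>T\<close>; from there on bad vertices are
  counted by a first moment. Layers are frozen at time \<open>t / 2\<close>, so that the later
  connectors are drawn with fixed targets. The constant: two climbs with two edges per layer give 4
  / |log g|. To absorb additive errors the exponent \<open>m\<close> is lowered to its power 2/3,
  which turns the 2\<sigma> of two periphery paths into 3\<sigma>; the last \<sigma> / log m pays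
  for replacing \<open>g\<close> by a slightly larger \<open>\<mu>\<close>.\<close>

abbreviation E :: "'a pmf \<Rightarrow> ('a \<Rightarrow> real) \<Rightarrow> real" where
  "E p f \<equiv> measure_pmf.expectation p f"

abbreviation prob :: "'a pmf \<Rightarrow> 'a set \<Rightarrow> real" where
  "prob p A \<equiv> measure_pmf.prob p A"

lemma E_bind:
  assumes "finite (set_pmf p)" "\<And>x. x \<in> set_pmf p \<Longrightarrow> finite (set_pmf (f x))"
  shows "E (bind_pmf p f) h = E p (\<lambda>x. E (f x) h)"
  using assms
  by (subst pmf_expectation_bind[of "set_pmf p"]) (auto simp: integral_measure_pmf[of "set_pmf p"])

lemma E_mono:
  assumes "finite (set_pmf p)" "\<And>x. x \<in> set_pmf p \<Longrightarrow> f x \<le> h x"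
  shows "E p f \<le> E p h"
  using assms by (intro integral_mono_AE integrable_measure_pmf_finite AE_pmfI) auto

lemma E_le_const:
  assumes "finite (set_pmf p)" "\<And>x. x \<in> set_pmf p \<Longrightarrow> f x \<le> b"
  shows "E p f \<le> b"
  using E_mono[of p f "\<lambda>_. b"] assms by simp

lemma E_nonneg:
  assumes "\<And>x. x \<in> set_pmf p \<Longrightarrow> 0 \<le> f x"
  shows "0 \<le> E p f"
  using assms by (intro integral_nonneg_AE AE_pmfI) auto

lemma E_cong:
  assumes "\<And>x. x \<in> set_pmf p \<Longrightarrow> f x = h x"
  shows "E p f = E p h"
  using assms by (intro integral_cong_AE AE_pmfI) auto

lemma E_add: "finite (set_pmf p) \<Longrightarrow> E p (\<lambda>x. f x + h x) = E p f + E p h"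
  by (intro Bochner_Integration.integral_add integrable_measure_pmf_finite)

lemma prob_eq_E: "prob p {x. P x} = E p (\<lambda>x. of_bool (P x))"
proof -
  have "(\<lambda>x. of_bool (P x) :: real) = indicator {x. P x}" by (auto simp: indicator_def)
  then show ?thesis by simp
qed

lemma E_affine_bool:
  assumes "finite (set_pmf p)"
  shows "E p (\<lambda>x. a + b * of_bool (P x)) = a + b * prob p {x. P x}"
  using assms by (simp add: E_add prob_eq_E)

section \<open>Sequential draws\<close>

text \<open>The newest draw is the head, and \<open>q\<close> sees all earlier draws. Models (a) and
  (b) need this, since there the degrees change between the edges of one merged vertex.\<close>

primrec seqp :: "('a list \<Rightarrow> 'a pmf) \<Rightarrow> nat \<Rightarrow> 'a list pmf" where
  "seqp q 0 = return_pmf []"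
| "seqp q (Suc n) = bind_pmf (seqp q n) (\<lambda>p. map_pmf (\<lambda>x. x # p) (q p))"

lemma set_seqp:
  assumes "p \<in> set_pmf (seqp q n)"
    and "\<And>p. set p \<subseteq> S \<Longrightarrow> length p < n \<Longrightarrow> set_pmf (q p) \<subseteq> S"
  shows "set p \<subseteq> S \<and> length p = n"
  using assms
proof (induction n arbitrary: p)
  case (Suc n)
  then obtain p' x where "p' \<in> set_pmf (seqp q n)" "x \<in> set_pmf (q p')" "p = x # p'" by auto
  moreover have "set p' \<subseteq> S \<and> length p' = n" using Suc calculation by auto
  ultimately show ?case using Suc.prems(2)[of p'] by auto
qed auto

lemma finite_seqp:
  assumes "finite S" "\<And>p. set p \<subseteq> S \<Longrightarrow> length p < n \<Longrightarrow> set_pmf (q p) \<subseteq> S"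
  shows "finite (set_pmf (seqp q n))"
proof (rule finite_subset)
  show "set_pmf (seqp q n) \<subseteq> {p. set p \<subseteq> S \<and> length p = n}"
    using set_seqp[of _ q n S] assms(2) by (intro subsetI CollectI) blast
  show "finite {p. set p \<subseteq> S \<and> length p = n}" using assms(1) by (rule finite_lists_length_eq)
qed

abbreviation cnt :: "'a set \<Rightarrow> 'a list \<Rightarrow> nat" where
  "cnt A p \<equiv> length (filter (\<lambda>x. x \<in> A) p)"

context
  fixes q :: "'a list \<Rightarrow> 'a pmf" and S :: "'a set"
  assumes fS: "finite S"
begin

lemma E_seqp_Suc:
  assumes "\<And>p. set p \<subseteq> S \<Longrightarrow> length p < Suc n \<Longrightarrow> set_pmf (q p) \<subseteq> S"
  shows "E (seqp q (Suc n)) f = E (seqp q n) (\<lambda>p. E (q p) (\<lambda>x. f (x # p)))"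
proof -
  have fin: "finite (set_pmf (q p))" if "p \<in> set_pmf (seqp q n)" for p
  proof -
    have "set p \<subseteq> S" "length p = n" using set_seqp[OF that, of S] assms by auto
    then show ?thesis using assms[of p] fS by (simp add: finite_subset)
  qed
  show ?thesis
    using finite_seqp[of S n q] assms fS fin by (simp add: E_bind)
qed

lemma E_seqp_Suc_le:
  assumes q: "\<And>p. set p \<subseteq> S \<Longrightarrow> length p < Suc n \<Longrightarrow> set_pmf (q p) \<subseteq> S"
    and step: "\<And>p. set p \<subseteq> S \<Longrightarrow> length p < Suc n \<Longrightarrow> finite (set_pmf (q p)) \<Longrightarrow> E (q p) (\<lambda>x. f (x # p)) \<le> f' p"
  shows "E (seqp q (Suc n)) f \<le> E (seqp q n) f'"
proof -
  have "E (seqp q n) (\<lambda>p. E (q p) (\<lambda>x. f (x # p))) \<le> E (seqp q n) f'"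
  proof (rule E_mono)
    show "finite (set_pmf (seqp q n))" using finite_seqp[of S n q] fS q by auto
    fix p assume "p \<in> set_pmf (seqp q n)"
    then have p: "set p \<subseteq> S" "length p < Suc n" using set_seqp[of p q n S] q by auto
    then show "E (q p) (\<lambda>x. f (x # p)) \<le> f' p" using q[OF p] fS by (intro step) (auto intro: finite_subset)
  qed
  then show ?thesis using q by (subst E_seqp_Suc) auto
qed

text \<open>The bound applies with \<open>z \<le> 1\<close> and a lower bound \<open>a\<close> on the probability of \<open>A\<close>, and
  with \<open>z \<ge> 1\<close> and an upper bound.\<close>

lemma E_power_cnt:
  assumes "\<And>p. set p \<subseteq> S \<Longrightarrow> length p < n \<Longrightarrow> set_pmf (q p) \<subseteq> S"
    and "\<And>p. set p \<subseteq> S \<Longrightarrow> length p < n \<Longrightarrow>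
          (z - 1) * prob (q p) A \<le> (z - 1) * a"
    and "0 \<le> z" "0 \<le> 1 + (z - 1) * a"
  shows "E (seqp q n) (\<lambda>p. z ^ cnt A p) \<le> (1 + (z - 1) * a) ^ n"
  using assms(1,2)
proof (induction n)
  case (Suc n)
  have "E (seqp q (Suc n)) (\<lambda>p. z ^ cnt A p) \<le> E (seqp q n) (\<lambda>p. z ^ cnt A p * (1 + (z - 1) * a))"
  proof (rule E_seqp_Suc_le)
    fix p assume p: "set p \<subseteq> S" "length p < Suc n" and fq: "finite (set_pmf (q p))"
    have "E (q p) (\<lambda>x. z ^ cnt A (x # p))
        = E (q p) (\<lambda>x. z ^ cnt A p + (z ^ cnt A p * (z - 1)) * of_bool (x \<in> A))"
      by (rule E_cong) (auto simp: algebra_simps)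
    also have "\<dots> = z ^ cnt A p * (1 + (z - 1) * prob (q p) A)"
      unfolding E_affine_bool[OF fq, of _ _ "\<lambda>x. x \<in> A"] by (simp add: algebra_simps)
    also have "\<dots> \<le> z ^ cnt A p * (1 + (z - 1) * a)"
      using Suc.prems(2)[OF p] assms(3) by (intro mult_left_mono) auto
    finally show "E (q p) (\<lambda>x. z ^ cnt A (x # p)) \<le> z ^ cnt A p * (1 + (z - 1) * a)" .
  qed (use Suc.prems(1) in auto)
  also have "\<dots> = E (seqp q n) (\<lambda>p. z ^ cnt A p) * (1 + (z - 1) * a)" by simp
  also have "\<dots> \<le> (1 + (z - 1) * a) ^ n * (1 + (z - 1) * a)"
    using Suc assms(4) by (intro mult_right_mono Suc.IH) auto
  finally show ?case by (simp add: mult.commute)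
qed simp

lemma E_cnt_le:
  assumes "\<And>p. set p \<subseteq> S \<Longrightarrow> length p < n \<Longrightarrow> set_pmf (q p) \<subseteq> S"
    and "\<And>p. set p \<subseteq> S \<Longrightarrow> length p < n \<Longrightarrow> prob (q p) A \<le> a"
  shows "E (seqp q n) (\<lambda>p. real (cnt A p)) \<le> n * a"
  using assms
proof (induction n)
  case (Suc n)
  have "E (seqp q (Suc n)) (\<lambda>p. real (cnt A p)) \<le> E (seqp q n) (\<lambda>p. real (cnt A p) + a)"
  proof (rule E_seqp_Suc_le)
    fix p assume p: "set p \<subseteq> S" "length p < Suc n" and fq: "finite (set_pmf (q p))"
    have "E (q p) (\<lambda>x. real (cnt A (x # p))) = E (q p) (\<lambda>x. real (cnt A p) + 1 * of_bool (x \<in> A))"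
      by (rule E_cong) (auto simp: algebra_simps)
    also have "\<dots> = real (cnt A p) + prob (q p) A"
      using E_affine_bool[OF fq, of "real (cnt A p)" 1 "\<lambda>x. x \<in> A"] by (simp add: algebra_simps)
    finally show "E (q p) (\<lambda>x. real (cnt A (x # p))) \<le> real (cnt A p) + a"
      using Suc.prems(2)[OF p] by simp
  qed (use Suc.prems(1) in auto)
  also have "\<dots> = E (seqp q n) (\<lambda>p. real (cnt A p)) + a"
    using finite_seqp[of S n q] fS Suc.prems(1) by (simp add: E_add)
  also have "\<dots> \<le> n * a + a" using Suc by auto
  finally show ?case by (simp add: algebra_simps)
qed simp

lemma prob_all_le:
  assumes "\<And>p. set p \<subseteq> S \<Longrightarrow> length p < n \<Longrightarrow> set_pmf (q p) \<subseteq> S"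
    and "\<And>p. set p \<subseteq> S \<Longrightarrow> length p < n \<Longrightarrow> prob (q p) A \<le> a" and "0 \<le> a"
  shows "prob (seqp q n) {p. set p \<subseteq> A} \<le> a ^ n"
  using assms(1,2)
proof (induction n)
  case (Suc n)
  have "E (seqp q (Suc n)) (\<lambda>p. of_bool (set p \<subseteq> A)) \<le> E (seqp q n) (\<lambda>p. of_bool (set p \<subseteq> A) * a)"
  proof (rule E_seqp_Suc_le)
    fix p assume p: "set p \<subseteq> S" "length p < Suc n" and fq: "finite (set_pmf (q p))"
    have "E (q p) (\<lambda>x. of_bool (set (x # p) \<subseteq> A))
       = E (q p) (\<lambda>x. 0 + of_bool (set p \<subseteq> A) * of_bool (x \<in> A))"
      by (rule E_cong) auto
    also have "\<dots> = of_bool (set p \<subseteq> A) * prob (q p) A"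
      by (subst E_affine_bool[OF fq, of 0 _ "\<lambda>x. x \<in> A"]) simp
    finally show "E (q p) (\<lambda>x. of_bool (set (x # p) \<subseteq> A)) \<le> of_bool (set p \<subseteq> A) * a"
      using Suc.prems(2)[OF p] by auto
  qed (use Suc.prems(1) in auto)
  also have "\<dots> = E (seqp q n) (\<lambda>p. of_bool (set p \<subseteq> A)) * a" by simp
  also have "\<dots> \<le> a ^ n * a" using Suc assms(3) by (intro mult_right_mono) (auto simp: prob_eq_E)
  finally show ?case by (simp add: mult.commute prob_eq_E)
qed simp

text \<open>Only the last two draws are used: the last but one is asked to hit \<open>B\<close>, the
  last to hit \<open>A\<close>, and successive conditioning multiplies the two lower bounds. Later
  \<open>Suc (Suc n)\<close> is \<open>m\<close>, so this is one place where
  \<open>m \<ge> 2\<close> enters.\<close>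

lemma prob_two_ge:
  assumes "\<And>p. set p \<subseteq> S \<Longrightarrow> length p < Suc (Suc n) \<Longrightarrow> set_pmf (q p) \<subseteq> S"
    and "\<And>p. set p \<subseteq> S \<Longrightarrow> length p < Suc (Suc n) \<Longrightarrow> a \<le> prob (q p) A"
    and "\<And>p. set p \<subseteq> S \<Longrightarrow> length p < Suc (Suc n) \<Longrightarrow> b \<le> prob (q p) B"
    and "0 \<le> a" "0 \<le> b"
  shows "a * b \<le> prob (seqp q (Suc (Suc n))) {p. set p \<inter> A \<noteq> {} \<and> set p \<inter> B \<noteq> {}}"
proof -
  have S: "set p \<subseteq> S \<and> length p = n" if "p \<in> set_pmf (seqp q n)" for p
    using set_seqp[OF that, of S] assms(1) by auto
  have fn: "finite (set_pmf (seqp q n))" using finite_seqp[of S n q] fS assms(1) by auto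
  have "a * b = E (seqp q n) (\<lambda>p. b * a)" by simp
  also have "\<dots> \<le> E (seqp q n) (\<lambda>p. E (q p) (\<lambda>y. E (q (y # p)) (\<lambda>x. of_bool (y \<in> B) * of_bool (x \<in> A))))"
  proof (rule E_mono[OF fn])
    fix p assume p: "p \<in> set_pmf (seqp q n)"
    have fq: "finite (set_pmf (q p))" using S[OF p] assms(1)[of p] fS finite_subset by fastforce
    have "b * a \<le> prob (q p) B * a" using assms S[OF p] by (intro mult_right_mono) auto
    also have "\<dots> = E (q p) (\<lambda>y. 0 + a * of_bool (y \<in> B))"
      unfolding E_affine_bool[OF fq, of 0 a "\<lambda>x. x \<in> B"] by simp
    also have "\<dots> \<le> E (q p) (\<lambda>y. E (q (y # p)) (\<lambda>x. of_bool (y \<in> B) * of_bool (x \<in> A)))"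
    proof (rule E_mono[OF fq])
      fix y assume y: "y \<in> set_pmf (q p)"
      have yp: "set (y # p) \<subseteq> S" "length (y # p) < Suc (Suc n)" using y S[OF p] assms(1)[of p] by auto
      have fy: "finite (set_pmf (q (y # p)))" using assms(1)[OF yp] fS finite_subset by fastforce
      have "E (q (y # p)) (\<lambda>x. of_bool (y \<in> B) * of_bool (x \<in> A))
         = of_bool (y \<in> B) * prob (q (y # p)) A"
        using E_affine_bool[OF fy, of 0 "of_bool (y \<in> B)" "\<lambda>x. x \<in> A"] by simp
      then show "0 + a * of_bool (y \<in> B) \<le> E (q (y # p)) (\<lambda>x. of_bool (y \<in> B) * of_bool (x \<in> A))"
        using assms(2)[OF yp] by (auto intro: mult_left_mono)
    qed
    finally show "b * a \<le> E (q p) (\<lambda>y. E (q (y # p)) (\<lambda>x. of_bool (y \<in> B) * of_bool (x \<in> A)))" .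
  qed
  also have "\<dots> \<le> E (seqp q n) (\<lambda>p. E (q p) (\<lambda>y. E (q (y # p))
        (\<lambda>x. of_bool (set (x # y # p) \<inter> A \<noteq> {} \<and> set (x # y # p) \<inter> B \<noteq> {}))))"
  proof (intro E_mono fn)
    fix p assume p: "p \<in> set_pmf (seqp q n)"
    show fq: "finite (set_pmf (q p))" using S[OF p] assms(1)[of p] fS finite_subset by fastforce
    fix y assume y: "y \<in> set_pmf (q p)"
    have yp: "set (y # p) \<subseteq> S" "length (y # p) < Suc (Suc n)" using y S[OF p] assms(1)[of p] by auto
    show "finite (set_pmf (q (y # p)))" using assms(1)[OF yp] fS finite_subset by fastforce
  qed auto
  also have "\<dots> = E (seqp q (Suc n)) (\<lambda>p. E (q p)
        (\<lambda>x. of_bool (set (x # p) \<inter> A \<noteq> {} \<and> set (x # p) \<inter> B \<noteq> {})))"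
    by (rule E_seqp_Suc[symmetric]) (use assms(1) in auto)
  also have "\<dots> = E (seqp q (Suc (Suc n))) (\<lambda>p. of_bool (set p \<inter> A \<noteq> {} \<and> set p \<inter> B \<noteq> {}))"
    by (rule E_seqp_Suc[symmetric]) (use assms(1) in auto)
  finally show ?thesis by (simp add: prob_eq_E)
qed

end

section \<open>Histories\<close>

text \<open>Histories grow at the head, so this is the state at the earlier time
  \<open>s\<close>.\<close>

definition suf :: "nat \<Rightarrow> 'a list \<Rightarrow> 'a list" where
  "suf s h = drop (length h - s) h"

lemma length_suf [simp]: "length (suf s h) = min s (length h)"
  by (simp add: suf_def)

lemma suf_all [simp]: "length h \<le> s \<Longrightarrow> suf s h = h"
  by (simp add: suf_def)

lemma suf_append: "s \<le> length h \<Longrightarrow> suf s (xs @ h) = suf s h"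
  by (simp add: suf_def)

lemma suf_Cons: "s \<le> length h \<Longrightarrow> suf s (x # h) = suf s h"
  using suf_append[of s h "[x]"] by simp

lemma suf_suf: "r \<le> s \<Longrightarrow> suf r (suf s h) = suf r h"
proof -
  assume rs: "r \<le> s"
  show ?thesis
  proof (cases "s \<le> length h")
    case True
    then have "s - r + (length h - s) = length h - r" using rs by simp
    then show ?thesis using True by (simp add: suf_def)
  qed simp
qed

lemma sum_count_list:
  "finite A \<Longrightarrow> (\<Sum>v\<in>A. count_list x v) = cnt A x"
proof (induction x)
  case (Cons a x)
  have "(\<Sum>v\<in>A. count_list (a # x) v) = (\<Sum>v\<in>A. (if a = v then 1 else 0) + count_list x v)"
    by (intro sum.cong) auto
  also have "\<dots> = cnt A (a # x)" using Cons by (simp add: sum.distrib)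
  finally show ?case .
qed simp

text \<open>A graph is encoded by its history: entry number \<open>v\<close>, counted from the end of the list, lists
  the other end points of the \<open>m\<close> edges of vertex \<open>v\<close>; the length of the list is the time.
  \<open>wt h v\<close> is \<open>D\<^sub>v + \<delta>\<close>, and \<open>g\<close> stands for \<open>\<tau> - 2 = 1 + \<delta> / m\<close>.\<close>

locale pa_weights =
  fixes m :: nat and g :: real
  assumes m2: "2 \<le> m" and g01: "0 < g" "g < 1"
begin

definition wt :: "nat list list \<Rightarrow> nat \<Rightarrow> real" where
  "wt h v = real m * g + real (count_list (concat h) v)"

definition W :: "nat list list \<Rightarrow> nat set \<Rightarrow> real" where
  "W h A = (\<Sum>v\<in>A. wt h v)"

text \<open>This is \<open>2 * m + \<delta>\<close> from the attachment probabilities, the total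
  weight per vertex.\<close>

definition c :: real where "c = real m * (1 + g)"

text \<open>End points are bounded by the current time and not by the number of the vertex that owns
  the edge: in the initial graph of model (c), the entry of vertex 1 consists of copies of
  2.\<close>

definition valid :: "nat list list \<Rightarrow> bool" where
  "valid h \<longleftrightarrow> (\<forall>x\<in>set h. length x = m \<and> set x \<subseteq> {1..length h})"

lemma mg_pos: "0 < real m * g"
  using m2 g01 by simp

lemma c_gt: "2 < c" "c < 2 * m" "0 < c"
proof -
  have "2 * (1 + g) \<le> real m * (1 + g)" "real m * (1 + g) < real m * 2"
    using m2 g01 by (intro mult_strict_left_mono mult_right_mono; simp)+
  moreover have "2 < 2 * (1 + g)" using g01 by simp
  ultimately show "2 < c" "c < 2 * m" by (auto simp: c_def mult.commute)
  then show "0 < c" by simp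
qed

lemma wt_ge: "real m * g \<le> wt h v" and wt_pos: "0 < wt h v"
  using mg_pos by (auto simp: wt_def intro: add_pos_nonneg)

lemma wt_Cons: "wt (x # h) v = wt h v + count_list x v"
  by (simp add: wt_def count_list_append)

lemma wt_append_mono: "wt h v \<le> wt (xs @ h) v"
  by (simp add: wt_def count_list_append)

lemma wt_suf_mono: "wt (suf s h) v \<le> wt h v"
  using wt_append_mono[of "suf s h" v "take (length h - s) h"] by (simp add: suf_def)

lemma W_nonneg: "0 \<le> W h A"
  unfolding W_def using wt_pos by (meson less_imp_le sum_nonneg)

lemma W_mono: "finite B \<Longrightarrow> A \<subseteq> B \<Longrightarrow> W h A \<le> W h B"
  unfolding W_def using wt_pos by (intro sum_mono2) (auto intro: less_imp_le)

lemma W_Un: "finite A \<Longrightarrow> finite B \<Longrightarrow> A \<inter> B = {} \<Longrightarrow> W h (A \<union> B) = W h A + W h B"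
  unfolding W_def by (rule sum.union_disjoint)

lemma W_Cons: "finite A \<Longrightarrow> W (x # h) A = W h A + cnt A x"
  by (simp add: W_def wt_Cons sum.distrib sum_count_list flip: of_nat_sum)

lemma valid_Cons:
  "valid h \<Longrightarrow> length x = m \<Longrightarrow> set x \<subseteq> {1..length h + 1} \<Longrightarrow> valid (x # h)"
  unfolding valid_def by fastforce

lemma W_total:
  assumes "valid h"
  shows "W h {1..length h} = c * length h"
proof -
  have "set (concat h) \<subseteq> {1..length h}" using assms by (auto simp: valid_def)
  then have "filter (\<lambda>v. v \<in> {1..length h}) (concat h) = concat h"
    by (intro filter_True) auto
  moreover have "length (concat h) = m * length h"
  proof -
    have "\<forall>x\<in>set h. length x = m" using assms by (auto simp: valid_def)
    then show ?thesis by (induction h) auto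
  qed
  ultimately have "(\<Sum>v\<in>{1..length h}. count_list (concat h) v) = m * length h"
    by (simp only: sum_count_list finite_atLeastAtMost)
  then have "W h {1..length h} = length h * (real m * g) + real (m * length h)"
    by (simp add: W_def wt_def sum.distrib flip: of_nat_sum)
  then show ?thesis by (simp add: c_def algebra_simps)
qed

lemma W_le_total: "valid h \<Longrightarrow> A \<subseteq> {1..length h} \<Longrightarrow> W h A \<le> c * length h"
  using W_mono[of "{1..length h}" A h] W_total by simp

end

text \<open>\<open>\<kappa> h p\<close> is the law of the next end point when the history is \<open>h\<close> and the current vertex has already drawn
  the end points \<open>p\<close>. The slack \<open>3 * m\<close> and the two different times in the denominators make the
  bounds hold in all three models, whether or not degrees are updated between these draws.\<close>

locale pa = pa_weights +
  fixes \<kappa> :: "nat list list \<Rightarrow> nat list \<Rightarrow> nat pmf" and h0 :: "nat list list"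
  assumes h0: "h0 \<noteq> []" "length h0 \<le> 2" "valid h0"
    and kap_set: "\<lbrakk>valid h; h \<noteq> []; set p \<subseteq> {1..length h + 1}; length p < m\<rbrakk>
          \<Longrightarrow> set_pmf (\<kappa> h p) \<subseteq> {1..length h + 1}"
    and kap_L: "\<lbrakk>valid h; h \<noteq> []; set p \<subseteq> {1..length h + 1}; length p < m; i \<in> {1..length h}\<rbrakk>
          \<Longrightarrow> wt h i / (c * (length h + 1)) \<le> pmf (\<kappa> h p) i"
    and kap_U: "\<lbrakk>valid h; h \<noteq> []; set p \<subseteq> {1..length h + 1}; length p < m; A \<subseteq> {1..length h}\<rbrakk>
          \<Longrightarrow> prob (\<kappa> h p) (A \<union> {length h + 1}) \<le> (W h A + 3 * m) / (c * length h)"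
begin

definition K :: "nat list list \<Rightarrow> nat list pmf" where
  "K h = seqp (\<kappa> h) m"

inductive reach :: "nat list list \<Rightarrow> bool" where
  reach_h0: "reach h0"
| reach_Cons: "reach h \<Longrightarrow> x \<in> set_pmf (K h) \<Longrightarrow> reach (x # h)"

text \<open>The first step is split off, unlike in \<open>evolve\<close>, so that an induction on
  the number of remaining steps conditions on the next draw; \<open>hist_Suc_end\<close> recovers
  the other form.\<close>

primrec hist :: "nat list list \<Rightarrow> nat \<Rightarrow> nat list list pmf" where
  "hist h 0 = return_pmf h"
| "hist h (Suc n) = bind_pmf (K h) (\<lambda>x. hist (x # h) n)"

definition law :: "nat \<Rightarrow> nat list list pmf" where
  "law T = hist h0 (T - length h0)"

lemma set_K:
  assumes "valid h" "h \<noteq> []" "x \<in> set_pmf (K h)"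
  shows "length x = m" "set x \<subseteq> {1..length h + 1}"
  using set_seqp[of x "\<kappa> h" m "{1..length h + 1}"] kap_set[OF assms(1,2)] assms(3)
  by (auto simp: K_def)

lemma reach_valid: "reach h \<Longrightarrow> valid h \<and> h \<noteq> [] \<and> length h0 \<le> length h"
proof (induction rule: reach.induct)
  case (reach_Cons h x)
  then have "length x = m" "set x \<subseteq> {1..length h + 1}" using set_K[of h x] by blast+
  then show ?case using reach_Cons.IH by (simp add: valid_Cons)
qed (use h0 in auto)

lemma reach_set_K:
  assumes "reach h" "x \<in> set_pmf (K h)"
  shows "length x = m" "set x \<subseteq> {1..length h + 1}"
  using set_K[OF _ _ assms(2)] reach_valid[OF assms(1)] by auto

lemma finite_K: "reach h \<Longrightarrow> finite (set_pmf (K h))"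
  using finite_seqp[of "{1..length h + 1}" m "\<kappa> h"] kap_set reach_valid by (simp add: K_def)

lemma set_hist:
  assumes "reach h" "h' \<in> set_pmf (hist h n)"
  shows "reach h' \<and> length h' = length h + n \<and> suf (length h) h' = h"
  using assms
proof (induction n arbitrary: h)
  case (Suc n)
  then obtain x where x: "x \<in> set_pmf (K h)" "h' \<in> set_pmf (hist (x # h) n)" by auto
  have "reach h' \<and> length h' = length (x # h) + n \<and> suf (length (x # h)) h' = x # h"
    using Suc.IH[OF reach_Cons[OF Suc.prems(1) x(1)] x(2)] .
  moreover have "suf (length h) (suf (length (x # h)) h') = suf (length h) (x # h)"
    using calculation by simp
  then have "suf (length h) h' = h" by (subst (asm) suf_suf) (simp_all add: suf_Cons)
  ultimately show ?case by simp
qed simp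

lemma finite_hist: "reach h \<Longrightarrow> finite (set_pmf (hist h n))"
  by (induction n arbitrary: h) (auto intro!: finite_K reach_Cons)

lemma hist_add: "hist h (a + b) = bind_pmf (hist h a) (\<lambda>h'. hist h' b)"
  by (induction a arbitrary: h) (auto simp: bind_return_pmf bind_assoc_pmf)

lemma hist_Suc_end: "hist h (Suc n) = bind_pmf (hist h n) (\<lambda>h'. map_pmf (\<lambda>x. x # h') (K h'))"
  using hist_add[of h n 1] by (simp add: map_pmf_def)

section \<open>Restarting at a later time and Ville's inequality\<close>

lemma prob_restart:
  assumes "length h0 \<le> s" "s \<le> T"
    and "\<And>h. reach h \<Longrightarrow> length h = s \<Longrightarrow> prob (hist h (T - s)) {h. Ev h} \<le> b"
  shows "prob (law T) {h. Ev h} \<le> b"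
proof -
  have "T - length h0 = (s - length h0) + (T - s)" using assms by simp
  then have "law T = bind_pmf (hist h0 (s - length h0)) (\<lambda>h. hist h (T - s))"
    by (simp add: law_def hist_add)
  moreover have "E (bind_pmf (hist h0 (s - length h0)) (\<lambda>h. hist h (T - s))) (\<lambda>h. of_bool (Ev h))
     = E (hist h0 (s - length h0)) (\<lambda>h. E (hist h (T - s)) (\<lambda>h. of_bool (Ev h)))"
    by (intro E_bind finite_hist reach_h0) (use set_hist[OF reach_h0] in blast)
  moreover have "\<dots> \<le> b"
  proof (rule E_le_const[OF finite_hist[OF reach_h0]])
    fix h assume "h \<in> set_pmf (hist h0 (s - length h0))"
    then have "reach h" "length h = s" using set_hist[OF reach_h0] assms(1) by auto
    then show "E (hist h (T - s)) (\<lambda>h. of_bool (Ev h)) \<le> b" using assms(3) by (simp add: prob_eq_E)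
  qed
  ultimately show ?thesis by (simp add: prob_eq_E)
qed

text \<open>Induction on the remaining steps: if \<open>Q\<close> holds now, the bound is at least
  1; if the guard \<open>G\<close> fails now, the event is impossible; otherwise one step is
  averaged. The base history \<open>hb\<close> is carried along because \<open>\<Phi>\<close> may be
  superharmonic only on extensions of \<open>hb\<close>.\<close>

lemma ville:
  assumes "reach h" "length h + n = N" "suf (length hb) h = hb" "length hb \<le> length h"
    and nn: "\<And>h. 0 \<le> \<Phi> h"
    and step: "\<And>h. \<lbrakk>reach h; suf (length hb) h = hb; length hb \<le> length h; length h < N; G h; \<not> Q h\<rbrakk>
        \<Longrightarrow> E (K h) (\<lambda>x. \<Phi> (x # h)) \<le> \<Phi> h"
    and Q: "\<And>h. \<lbrakk>reach h; suf (length hb) h = hb; length hb \<le> length h; length h \<le> N; Q h\<rbrakk>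
        \<Longrightarrow> 1 \<le> \<Phi> h"
  shows "prob (hist h n)
     {h'. \<exists>s\<in>{length h..N}. Q (suf s h') \<and> (\<forall>r\<in>{length h..<s}. G (suf r h'))} \<le> \<Phi> h"
    (is "prob _ {h'. ?Ev h h'} \<le> _")
  using assms(1-4)
proof (induction n arbitrary: h)
  case 0
  have "?Ev h h' \<Longrightarrow> Q h" if "h' = h" for h' using 0 that by auto
  then show ?case using Q[of h] 0 nn[of h] by (auto simp: prob_eq_E)
next
  case (Suc n)
  consider "Q h" | "\<not> Q h" "\<not> G h" | "\<not> Q h" "G h" by blast
  then show ?case
  proof cases
    case 1
    then show ?thesis using Q[of h] Suc.prems
      by (meson measure_pmf.prob_le_1 le_add1 order_trans)
  next
    case 2
    have "\<not> ?Ev h h'" if "h' \<in> set_pmf (hist h (Suc n))" for h'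
    proof
      assume "?Ev h h'"
      then obtain s where s: "s \<in> {length h..N}" "Q (suf s h')" "\<forall>r\<in>{length h..<s}. G (suf r h')" by blast
      have h: "suf (length h) h' = h" using set_hist[OF Suc.prems(1) that] by simp
      show False
      proof (cases "s = length h")
        case False
        then have "length h \<in> {length h..<s}" using s(1) by simp
        then show False using s(3) h 2 by metis
      qed (use s(2) h 2 in simp)
    qed
    then have "prob (hist h (Suc n)) {h'. ?Ev h h'} = 0"
      unfolding measure_pmf_zero_iff by blast
    then show ?thesis using nn[of h] by simp
  next
    case 3
    have "E (hist h (Suc n)) (\<lambda>h'. of_bool (?Ev h h')) = E (K h) (\<lambda>x. E (hist (x # h) n) (\<lambda>h'. of_bool (?Ev h h')))"
      unfolding hist.simps using Suc.prems(1)
      by (intro E_bind finite_K finite_hist) (auto intro: reach_Cons)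
    also have "\<dots> \<le> E (K h) (\<lambda>x. \<Phi> (x # h))"
    proof (rule E_mono[OF finite_K[OF Suc.prems(1)]])
      fix x assume x: "x \<in> set_pmf (K h)"
      have r: "reach (x # h)" using Suc.prems(1) x by (rule reach_Cons)
      have "E (hist (x # h) n) (\<lambda>h'. of_bool (?Ev h h')) \<le> E (hist (x # h) n) (\<lambda>h'. of_bool (?Ev (x # h) h'))"
      proof (rule E_mono[OF finite_hist[OF r]])
        fix h' assume h': "h' \<in> set_pmf (hist (x # h) n)"
        have "suf (length h) (suf (length (x # h)) h') = h"
          using set_hist[OF r h'] by (simp add: suf_Cons)
        then have h: "suf (length h) h' = h" by (subst (asm) suf_suf) simp_all
        have "?Ev (x # h) h'" if ev: "?Ev h h'"
        proof -
          obtain s where s: "s \<in> {length h..N}" "Q (suf s h')" "\<forall>r\<in>{length h..<s}. G (suf r h')"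
            using ev by blast
          then have "s \<noteq> length h" using 3 h by metis
          then have "s \<in> {length (x # h)..N}" "\<forall>r\<in>{length (x # h)..<s}. G (suf r h')"
            using s by auto
          then show ?thesis using s(2) by blast
        qed
        then show "of_bool (?Ev h h') \<le> (of_bool (?Ev (x # h) h') :: real)" by simp
      qed
      also have "\<dots> \<le> \<Phi> (x # h)"
        using Suc.IH[OF r] Suc.prems by (simp add: suf_Cons prob_eq_E)
      finally show "E (hist (x # h) n) (\<lambda>h'. of_bool (?Ev h h')) \<le> \<Phi> (x # h)" .
    qed
    also have "\<dots> \<le> \<Phi> h" using step[of h] Suc.prems 3 by simp
    finally show ?thesis by (simp add: prob_eq_E)
  qed
qed

lemma law_reach:
  assumes "h \<in> set_pmf (law T)" "2 \<le> T"
  shows "reach h" "length h = T"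
  using set_hist[OF reach_h0, of h "T - length h0"] assms h0(2) by (auto simp: law_def)

lemma reach_suf:
  assumes "reach h" "length h0 \<le> s"
  shows "reach (suf s h)"
  using assms
proof (induction rule: reach.induct)
  case (reach_Cons h x)
  then show ?case by (cases "s \<le> length h") (auto simp: suf_Cons intro: reach.intros)
qed (auto intro: reach_h0)

section \<open>One-step estimates for the end points drawn by a new vertex\<close>

context
  fixes h assumes rh: "reach h"
begin

lemma kap_LA:
  assumes "A \<subseteq> {1..length h}" "set p \<subseteq> {1..length h + 1}" "length p < m"
  shows "W h A / (c * (length h + 1)) \<le> prob (\<kappa> h p) A"
proof -
  have "prob (\<kappa> h p) A = (\<Sum>i\<in>A. pmf (\<kappa> h p) i)"
    using assms(1) by (intro measure_measure_pmf_finite) (auto intro: finite_subset)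
  also have "\<dots> \<ge> (\<Sum>i\<in>A. wt h i / (c * (length h + 1)))"
    using assms reach_valid[OF rh] by (intro sum_mono kap_L) auto
  finally show ?thesis by (simp add: W_def sum_divide_distrib)
qed

lemma K_lower:
  fixes z :: real
  assumes "A \<subseteq> {1..length h}" "0 \<le> z" "z \<le> 1"
  shows "E (K h) (\<lambda>x. z ^ cnt A x) \<le> (1 + (z - 1) * (W h A / (c * (length h + 1)))) ^ m"
    and "0 \<le> 1 + (z - 1) * (W h A / (c * (length h + 1)))"
proof -
  have v: "valid h" "h \<noteq> []" using reach_valid[OF rh] by auto
  let ?a = "W h A / (c * (length h + 1))"
  have "W h A \<le> c * (length h + 1)" using W_le_total[OF v(1) assms(1)] c_gt by (simp add: algebra_simps)
  then have "?a \<le> 1" using c_gt by (simp add: divide_le_eq)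
  moreover have "0 \<le> ?a" using W_nonneg c_gt by simp
  ultimately have "(1 - z) * ?a \<le> 1" using assms(2,3) by (intro mult_le_one) auto
  then show nn: "0 \<le> 1 + (z - 1) * ?a" by (simp add: algebra_simps diff_divide_distrib)
  show "E (K h) (\<lambda>x. z ^ cnt A x) \<le> (1 + (z - 1) * ?a) ^ m"
    unfolding K_def
  proof (rule E_power_cnt[of "{1..length h + 1}"])
    fix p assume p: "set p \<subseteq> {1..length h + 1}" "length p < m"
    show "(z - 1) * prob (\<kappa> h p) A \<le> (z - 1) * ?a"
      using kap_LA[OF assms(1) p] assms(3) by (intro mult_left_mono_neg) auto
  qed (use assms nn kap_set[OF v] in auto)
qed

lemma K_lower_exp:
  fixes z :: real
  assumes "A \<subseteq> {1..length h}" "0 \<le> z" "z \<le> 1"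
  shows "E (K h) (\<lambda>x. z ^ cnt A x) \<le> exp (- (m * (1 - z) * W h A / (c * (length h + 1))))"
proof -
  let ?a = "(z - 1) * (W h A / (c * (length h + 1)))"
  have "(1 + ?a) ^ m \<le> exp ?a ^ m" using K_lower(2)[OF assms] by (intro power_mono) auto
  also have "\<dots> = exp (m * ?a)" by (rule exp_of_nat_mult[symmetric])
  also have "m * ?a = - (m * (1 - z) * W h A / (c * (length h + 1)))"
    by (simp add: algebra_simps diff_divide_distrib)
  finally show ?thesis using K_lower(1)[OF assms] by linarith
qed

text \<open>The vertex being born is counted together with \<open>A\<close>, as in
  \<open>kap_U\<close>, because in models (a) and (b) it can receive its own edges.\<close>

lemma K_upper_exp:
  fixes z :: real
  assumes "A \<subseteq> {1..length h}" "1 \<le> z"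
  shows "E (K h) (\<lambda>x. z ^ cnt (A \<union> {length h + 1}) x) \<le> exp (m * (z - 1) * (W h A + 3 * m) / (c * length h))"
proof -
  have v: "valid h" "h \<noteq> []" using reach_valid[OF rh] by auto
  let ?a = "(W h A + 3 * m) / (c * length h)"
  have a: "0 \<le> ?a" using W_nonneg[of h A] c_gt by simp
  then have a': "0 \<le> (z - 1) * ?a" using assms(2) by (intro mult_nonneg_nonneg) auto
  have "E (K h) (\<lambda>x. z ^ cnt (A \<union> {length h + 1}) x) \<le> (1 + (z - 1) * ?a) ^ m"
    unfolding K_def
  proof (rule E_power_cnt[of "{1..length h + 1}"])
    fix p assume p: "set p \<subseteq> {1..length h + 1}" "length p < m"
    show "(z - 1) * prob (\<kappa> h p) (A \<union> {length h + 1}) \<le> (z - 1) * ?a"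
      using kap_U[OF v p assms(1)] assms(2) by (intro mult_left_mono) auto
  qed (use assms a' kap_set[OF v] in auto)
  also have "\<dots> \<le> exp ((z - 1) * ?a) ^ m" using a' by (intro power_mono) auto
  also have "\<dots> = exp (m * ((z - 1) * ?a))" by (rule exp_of_nat_mult[symmetric])
  finally show ?thesis by (simp add: mult.assoc)
qed

lemma K_cnt:
  assumes "A \<subseteq> {1..length h}"
  shows "E (K h) (\<lambda>x. real (cnt (A \<union> {length h + 1}) x)) \<le> m * ((W h A + 3 * m) / (c * length h))"
  unfolding K_def using reach_valid[OF rh] assms
  by (intro E_cnt_le[of "{1..length h + 1}"] kap_set kap_U) auto

lemma K_all:
  assumes "A \<subseteq> {1..length h}"
  shows "prob (K h) {x. set x \<subseteq> A \<union> {length h + 1}} \<le> ((W h A + 3 * m) / (c * length h)) ^ m"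
  unfolding K_def using reach_valid[OF rh] assms W_nonneg c_gt
  by (intro prob_all_le[of "{1..length h + 1}"] kap_set kap_U) auto

lemma K_two:
  assumes "A \<subseteq> {1..length h}" "B \<subseteq> {1..length h}"
  shows "W h A * W h B / (c * (length h + 1))\<^sup>2
    \<le> prob (K h) {x. set x \<inter> A \<noteq> {} \<and> set x \<inter> B \<noteq> {}}"
proof -
  have v: "valid h" "h \<noteq> []" using reach_valid[OF rh] by auto
  obtain n where n: "m = Suc (Suc n)" using m2 by (metis Suc_le_D add_2_eq_Suc le_Suc_ex)
  have "W h A / (c * (length h + 1)) * (W h B / (c * (length h + 1)))
    \<le> prob (seqp (\<kappa> h) (Suc (Suc n))) {x. set x \<inter> A \<noteq> {} \<and> set x \<inter> B \<noteq> {}}"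
  proof (rule prob_two_ge[of "{1..length h + 1}"])
    fix p assume p: "set p \<subseteq> {1..length h + 1}" "length p < Suc (Suc n)"
    show "set_pmf (\<kappa> h p) \<subseteq> {1..length h + 1}" using kap_set[OF v] p n by auto
    show "W h A / (c * (length h + 1)) \<le> prob (\<kappa> h p) A"
      "W h B / (c * (length h + 1)) \<le> prob (\<kappa> h p) B"
      using p n assms by (intro kap_LA; simp only: n)+
  qed (use W_nonneg c_gt in auto)
  then show ?thesis by (simp add: power2_eq_square K_def flip: n)
qed

end

end

section \<open>Growth of degrees\<close>

text \<open>Bernoulli's inequality for exponents in [0, 1], as the weighted AM-GM inequality with
  second factor 1.\<close>

lemma powr_le_affine:
  fixes a x :: real
  assumes "0 \<le> a" "a \<le> 1" "-1 < x"
  shows "(1 + x) powr a \<le> 1 + a * x"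
proof -
  have "(1 + x) powr a * 1 powr (1 - a) \<le> a * (1 + x) + (1 - a) * 1"
    using assms by (intro Youngs_inequality_0) auto
  then show ?thesis by (simp add: algebra_simps)
qed

context pa
begin

text \<open>The form in which \<open>ville\<close> is applied. The history at time \<open>st\<close>
  is conditioned on, so that \<open>Q\<close> and \<open>\<Phi>\<close> may be built from it, and
  \<open>pre\<close> collects what may be assumed about it; a history violating \<open>pre\<close>
  contributes nothing, as the event implies \<open>pre\<close>.\<close>

lemma ville_event:
  assumes "length h0 \<le> st" "st \<le> T" "0 \<le> b"
    and "2 \<le> T" "\<And>h. \<lbrakk>reach h; length h = T; R h\<rbrakk> \<Longrightarrow> pre (suf st h) \<and>
          (\<exists>s\<in>{st..T}. Q (suf st h) (suf s h) \<and> (\<forall>r\<in>{st..<s}. G (suf r h)))"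
    and "\<And>hb h. 0 \<le> \<Phi> hb h"
    and "\<And>hb h. \<lbrakk>reach h; suf st h = hb; pre hb; st \<le> length h; length h < T; G h; \<not> Q hb h\<rbrakk>
        \<Longrightarrow> E (K h) (\<lambda>x. \<Phi> hb (x # h)) \<le> \<Phi> hb h"
    and "\<And>hb h. \<lbrakk>reach h; suf st h = hb; pre hb; st \<le> length h; length h \<le> T; Q hb h\<rbrakk> \<Longrightarrow> 1 \<le> \<Phi> hb h"
    and "\<And>h. \<lbrakk>reach h; length h = st; pre h\<rbrakk> \<Longrightarrow> \<Phi> h h \<le> b"
  shows "prob (law T) {h. R h} \<le> b"
proof (rule prob_restart[OF assms(1,2)])
  fix h assume h: "reach h" "length h = st"
  let ?Ev = "\<lambda>h'. \<exists>s\<in>{st..T}. Q h (suf s h') \<and> (\<forall>r\<in>{st..<s}. G (suf r h'))"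
  have R: "pre h \<and> ?Ev h'" if h': "h' \<in> set_pmf (hist h (T - st))" "R h'" for h'
    using assms(5)[of h'] set_hist[OF h(1) h'(1)] h(2) h'(2) assms(2) by simp
  show "prob (hist h (T - st)) {h. R h} \<le> b"
  proof (cases "pre h")
    case True
    have "prob (hist h (T - st)) {h. R h} \<le> prob (hist h (T - st)) {h'. ?Ev h'}"
      unfolding prob_eq_E using R by (intro E_mono finite_hist[OF h(1)]) auto
    also have "\<dots> \<le> \<Phi> h h"
      using ville[of h "T - st" T h "\<Phi> h" G "Q h"] h assms True by auto
    finally show ?thesis using assms(9)[OF h True] by simp
  next
    case False
    then have "prob (hist h (T - st)) {h. R h} = 0" unfolding measure_pmf_zero_iff using R by blast
    then show ?thesis using assms(3) by simp
  qed
qed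

text \<open>The expected relative growth of this weight per step is at least
  \<open>1 / ((1 + g) * (s + 1))\<close>, which suggests the growth exponent
  \<open>1 / (1 + g)\<close>; a smaller \<open>a\<close> leaves room for an exponential tilt
  \<open>\<theta>\<close>. The weight starts at \<open>c * n\<close>, twice the barrier, and this
  gap is the exponent of the bound.\<close>

lemma old_weight:
  assumes a: "0 < a" "0 < \<theta>" "a * (1 + \<theta>) * (1 + g) * (n + 1) \<le> n" and n: "2 \<le> n" "n \<le> T"
  shows "prob (law T)
      {h. \<exists>s\<in>{n..T}. W (suf s h) {1..n} < c * n / 2 * (s / n) powr a} \<le> exp (- (\<theta> * c * n / 2))"
proof -
  define l where "l s = c * n / 2 * (real s / n) powr a" for s :: nat
  define \<Phi> where "\<Phi> hb h = exp (\<theta> * (l (length h) - W h {1..n}))" for hb h :: "nat list list"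
  define d where "d = a * (1 + \<theta>) * (1 + g)"
  have a3: "d * (real n + 1) \<le> n" using a(3) unfolding d_def .
  have d1: "d \<le> 1"
  proof -
    note a3
    also have "\<dots> \<le> 1 * (real n + 1)" by simp
    finally show ?thesis by (rule mult_right_le_imp_le) simp
  qed
  have "a * 1 \<le> a * ((1 + \<theta>) * (1 + g))"
    using a g01 mult_mono[of 1 "1 + \<theta>" 1 "1 + g"] by (intro mult_left_mono) auto
  then have a1: "a \<le> 1" using d1 by (simp add: d_def mult.assoc)
  show ?thesis
  proof (rule ville_event[where st = n and T = T and pre = "\<lambda>_. True" and G = "\<lambda>_. True"
        and Q = "\<lambda>_ h. W h {1..n} < l (length h)" and \<Phi> = \<Phi>])
    fix hb h assume h: "reach h" "n \<le> length h" "\<not> W h {1..n} < l (length h)"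
    let ?s = "length h" and ?W = "W h {1..n}"
    define z where "z = exp (- \<theta>)"
    have z: "0 \<le> z" "z \<le> 1" "\<theta> / (1 + \<theta>) \<le> 1 - z"
    proof -
      have "1 + \<theta> \<le> exp \<theta>" by (rule exp_ge_add_one_self)
      then have "z \<le> 1 / (1 + \<theta>)" unfolding z_def exp_minus using a(2) by (simp add: field_simps)
      then show "\<theta> / (1 + \<theta>) \<le> 1 - z" using a(2) by (simp add: field_simps)
    qed (use a(2) in \<open>auto simp: z_def\<close>)
    have s: "0 < ?s" "0 < n" using n h by auto
    have ds: "d * (?s + 1) \<le> ?s"
    proof -
      have "d * (?s + 1) = d * (real n + 1) + d * (real ?s - n)" by (simp add: algebra_simps)
      also have "\<dots> \<le> n + 1 * (real ?s - n)"
        by (rule add_mono[OF a3 mult_right_mono[OF d1]]) (use h(2) in simp)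
      finally show ?thesis by simp
    qed
    have l0: "0 \<le> l ?s" using c_gt by (simp add: l_def)
    have "l (?s + 1) = l ?s * (1 + 1 / ?s) powr a"
    proof -
      have "real (?s + 1) / n = (?s / n) * (1 + 1 / ?s)" using s by (simp add: field_simps)
      then show ?thesis unfolding l_def by (simp only: powr_mult mult.assoc)
    qed
    also have "\<dots> \<le> l ?s * (1 + a * (1 / ?s))"
      using l0 a a1 by (intro mult_left_mono powr_le_affine) (auto intro: less_le_trans[of _ 0])
    finally have l1: "l (?s + 1) - l ?s \<le> l ?s * a / ?s" by (simp add: algebra_simps)
    \<comment> \<open>Since \<open>m / c = 1 / (1 + g)\<close>, the drift is exactly what the
      barrier needs, except that tilting by \<open>\<theta>\<close> costs a factor
      \<open>1 + \<theta>\<close>; the hypothesis on \<open>a\<close> pays for it.\<close>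
    have "\<theta> * (l ?s * a / ?s) \<le> m * (1 - z) * ?W / (c * (?s + 1))"
    proof -
      have "\<theta> * (l ?s * a / ?s) = \<theta> * l ?s * (a / ?s)" by simp
      also have "a / ?s \<le> 1 / ((1 + \<theta>) * (1 + g) * (?s + 1))"
      proof -
        define M where "M = (1 + \<theta>) * (1 + g) * (?s + 1)"
        have "0 < M" using a g01 by (simp add: M_def)
        moreover have "a * M \<le> ?s" using ds by (simp add: d_def M_def mult.assoc)
        ultimately have "a / ?s \<le> 1 / M" using s by (simp add: divide_simps mult.commute)
        then show ?thesis unfolding M_def .
      qed
      also have "\<theta> * l ?s * (1 / ((1 + \<theta>) * (1 + g) * (?s + 1))) = (\<theta> / (1 + \<theta>)) * l ?s / ((1 + g) * (?s + 1))"
        by simp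
      also have "\<dots> \<le> (1 - z) * ?W / ((1 + g) * (?s + 1))"
        using z h(3) l0 g01 by (intro divide_right_mono mult_mono) auto
      also have "\<dots> = m * (1 - z) * ?W / (c * (?s + 1))"
        using m2 by (simp add: c_def)
      finally show ?thesis using a l0 by (simp add: mult_left_mono)
    qed
    moreover have "\<theta> * (l (?s + 1) - l ?s) \<le> \<theta> * (l ?s * a / ?s)" using l1 a by (intro mult_left_mono) auto
    ultimately have key: "\<theta> * (l (?s + 1) - l ?s) \<le> m * (1 - z) * ?W / (c * (?s + 1))" by linarith
    have "E (K h) (\<lambda>x. \<Phi> hb (x # h)) = E (K h) (\<lambda>x. exp (\<theta> * (l (?s + 1) - ?W)) * z ^ cnt {1..n} x)"
      unfolding \<Phi>_def z_def
      by (intro E_cong) (simp add: W_Cons exp_of_nat_mult[symmetric] algebra_simps flip: exp_add)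
    also have "\<dots> = exp (\<theta> * (l (?s + 1) - ?W)) * E (K h) (\<lambda>x. z ^ cnt {1..n} x)" by simp
    also have "\<dots> \<le> exp (\<theta> * (l (?s + 1) - ?W)) * exp (- (m * (1 - z) * ?W / (c * (?s + 1))))"
      using h z by (intro mult_left_mono K_lower_exp) auto
    also have "\<dots> \<le> \<Phi> hb h"
      using key by (simp add: \<Phi>_def algebra_simps flip: exp_add)
    finally show "E (K h) (\<lambda>x. \<Phi> hb (x # h)) \<le> \<Phi> hb h" .
  next
    fix h assume h: "reach h" "length h = n"
    then have "W h {1..n} = c * n" using W_total[of h] reach_valid by auto
    moreover have "l n = c * n / 2" using n by (simp add: l_def)
    ultimately have "l n - W h {1..n} = - (c * n / 2)" by linarith
    then show "\<Phi> h h \<le> exp (- (\<theta> * c * n / 2))" unfolding \<Phi>_def h(2) by simp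
  next
    fix hb h assume "W h {1..n} < l (length h)"
    then have "0 \<le> \<theta> * (l (length h) - W h {1..n})" using a by simp
    then show "1 \<le> \<Phi> hb h" by (simp add: \<Phi>_def)
  qed (use n h0 in \<open>auto simp: l_def \<Phi>_def\<close>)
qed

text \<open>A Markov bound for \<open>1 / wt\<close>: with probability at least
  \<open>w / (c * (s + 1))\<close> the weight \<open>w\<close> rises to at least
  \<open>w + 1\<close>. This multiplies the mean of \<open>1 / w\<close> by at most
  \<open>1 - k / (s + 1)\<close>, where \<open>k\<close> comes from
  \<open>w \<ge> m * g\<close>.\<close>

lemma old_vertex:
  fixes n t T :: nat
  assumes v: "v \<in> {1..n}" and n: "2 \<le> n" "n \<le> t" "t \<le> T" and U: "0 < U"
    and k: "k = (m * g / (m * g + 1)) / c"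
  shows "prob (law T) {h. wt (suf t h) v < U} \<le> U / (m * g) * ((n + 1) / (t + 1)) powr k"
proof -
  define \<Phi> where "\<Phi> hb h = U / wt h v * ((real (length h) + 1) / (t + 1)) powr k" for hb h :: "nat list list"
  have k0: "0 < k" using k mg_pos c_gt by simp
  show ?thesis
  \<comment> \<open>The law lives at time \<open>T\<close>, but only time \<open>t\<close> matters;
    the guard switches the process off there.\<close>
  proof (rule ville_event[where st = n and T = T and pre = "\<lambda>_. True" and G = "\<lambda>h. length h < t"
        and Q = "\<lambda>_ h. length h = t \<and> wt h v < U" and \<Phi> = \<Phi>])
    fix hb h assume h: "reach h" "n \<le> length h" "length h < t"
    let ?s = "length h" and ?w = "wt h v"
    define p where "p = ?w / (c * (?s + 1))"
    have w: "0 < ?w" "m * g \<le> ?w" by (rule wt_pos wt_ge)+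
    have v': "{v} \<subseteq> {1..?s}" using v h by auto
    have p1: "p \<le> 1" "0 \<le> p"
      using K_lower(2)[OF h(1) v', of 0] w c_gt by (auto simp: p_def W_def)
    have "E (K h) (\<lambda>x. 0 ^ cnt {v} x) \<le> (1 - p) ^ m"
      using K_lower(1)[OF h(1) v', of 0] by (simp add: p_def W_def)
    \<comment> \<open>One of the \<open>m\<close> edges is enough, since any positive exponent
      \<open>k\<close> serves.\<close>
    also have "\<dots> \<le> (1 - p) ^ 1" using p1 m2 by (intro power_decreasing) auto
    finally have z: "E (K h) (\<lambda>x. 0 ^ cnt {v} x) \<le> 1 - p" by simp
    have "E (K h) (\<lambda>x. 1 / wt (x # h) v) \<le> E (K h) (\<lambda>x. 1 / (?w + 1) + (1 / ?w - 1 / (?w + 1)) * 0 ^ cnt {v} x)"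
    proof (rule E_mono[OF finite_K[OF h(1)]])
      fix x
      have "count_list x v = cnt {v} x" using sum_count_list[of "{v}" x] by simp
      then show "1 / wt (x # h) v \<le> 1 / (?w + 1) + (1 / ?w - 1 / (?w + 1)) * 0 ^ cnt {v} x"
        using w by (cases "cnt {v} x") (auto simp: wt_Cons divide_simps)
    qed
    also have "\<dots> = 1 / (?w + 1) + (1 / ?w - 1 / (?w + 1)) * E (K h) (\<lambda>x. 0 ^ cnt {v} x)"
      using finite_K[OF h(1)] by (simp add: E_add)
    also have "\<dots> \<le> 1 / (?w + 1) + (1 / ?w - 1 / (?w + 1)) * (1 - p)"
      using z w by (intro add_left_mono mult_left_mono) (auto simp: field_simps)
    also have "\<dots> = 1 / ?w * (1 - (?w / (?w + 1)) / c / (?s + 1))"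
    proof -
      have "(1 / ?w - 1 / (?w + 1)) * p = 1 / ?w * ((?w / (?w + 1)) / c / (?s + 1))"
      proof -
        have "1 / ?w - 1 / (?w + 1) = 1 / ?w * (1 / (?w + 1))" using w by (simp add: field_simps)
        then show ?thesis by (simp add: p_def)
      qed
      moreover have "x + (y - x) * (1 - p) = y - (y - x) * p" for x y :: real by algebra
      ultimately show ?thesis by (simp only: right_diff_distrib mult_1_right)
    qed
    also have "\<dots> \<le> 1 / ?w * (1 - k / (?s + 1))"
    proof -
      have "m * g / (m * g + 1) \<le> ?w / (?w + 1)" using w mg_pos by (simp add: field_simps)
      then show ?thesis unfolding k using w c_gt by (intro mult_left_mono diff_left_mono divide_right_mono) auto
    qed
    also have "\<dots> \<le> 1 / ?w * exp (- k / (?s + 1))"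
      using w exp_ge_add_one_self[of "- k / (?s + 1)"] by (intro mult_left_mono) auto
    finally have e1: "E (K h) (\<lambda>x. 1 / wt (x # h) v) \<le> 1 / ?w * exp (- k / (?s + 1))" .
    have "((real ?s + 2) / (t + 1)) powr k = ((?s + 1) / (t + 1)) powr k * (1 + 1 / (?s + 1)) powr k"
    proof -
      have "(real ?s + 2) = (?s + 1) * (1 + 1 / (?s + 1))" by (simp add: field_simps)
      then have "(real ?s + 2) / (t + 1) = ((?s + 1) / (t + 1)) * (1 + 1 / (?s + 1))" by simp
      then show ?thesis by (simp only: powr_mult)
    qed
    also have "\<dots> \<le> ((?s + 1) / (t + 1)) powr k * exp (k / (?s + 1))"
    proof -
      have "(1 + 1 / (?s + 1)) powr k = exp (k * ln (1 + 1 / (?s + 1)))" 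
      proof -
        have "0 < 1 + 1 / (1 + real ?s)" by (intro add_pos_nonneg) auto
        then show ?thesis by (simp add: powr_def)
      qed
      also have "\<dots> \<le> exp (k * (1 / (?s + 1)))"
        using k0 ln_add_one_self_le_self[of "1 / (1 + real ?s)"] by (intro exp_le_cancel_iff[THEN iffD2] mult_left_mono) auto
      finally show ?thesis by (intro mult_left_mono) auto
    qed
    finally have e2: "((real ?s + 2) / (t + 1)) powr k \<le> ((?s + 1) / (t + 1)) powr k * exp (k / (?s + 1))" .
    have "E (K h) (\<lambda>x. \<Phi> hb (x # h)) = U * ((real ?s + 2) / (t + 1)) powr k * E (K h) (\<lambda>x. 1 / wt (x # h) v)"
      by (subst integral_mult_right_zero[symmetric]) (auto simp: \<Phi>_def algebra_simps)
    also have "\<dots> \<le> U * (((?s + 1) / (t + 1)) powr k * exp (k / (?s + 1))) * (1 / ?w * exp (- k / (?s + 1)))"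
      using U w e1 e2 by (intro mult_mono) (auto intro!: E_nonneg less_imp_le[OF wt_pos])
    also have "\<dots> = \<Phi> hb h * (exp (k / (?s + 1)) * exp (- k / (?s + 1)))" by (simp add: \<Phi>_def add.commute)
    also have "\<dots> = \<Phi> hb h" by (simp flip: exp_add)
    finally show "E (K h) (\<lambda>x. \<Phi> hb (x # h)) \<le> \<Phi> hb h" .
  next
    fix h assume h: "reach h" "length h = n"
    show "\<Phi> h h \<le> U / (m * g) * ((n + 1) / (t + 1)) powr k"
      unfolding \<Phi>_def h(2) using U m2 g01 mg_pos wt_ge[of h v]
      by (intro mult_mono divide_left_mono mult_pos_pos wt_pos) (auto simp: add.commute)
  next
    fix h assume h: "reach h" "length h = T" "wt (suf t h) v < U"
    then show "True \<and> (\<exists>s\<in>{n..T}. (length (suf s h) = t \<and> wt (suf s h) v < U) \<and> (\<forall>r\<in>{n..<s}. length (suf r h) < t))"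
      using n by (intro conjI TrueI bexI[of _ t]) auto
  next
    fix hb h assume "length h = t \<and> wt h v < U"
    moreover have "(real t + 1) / (t + 1) = 1" by simp
    ultimately show "1 \<le> \<Phi> hb h" using wt_pos[of h v] by (simp only: \<Phi>_def) simp
  next
    show "0 \<le> \<Phi> hb h" for hb h using U wt_pos[of h v] by (simp add: \<Phi>_def)
  qed (use n h0 U mg_pos in auto)
qed

text \<open>From time \<open>T / 3\<close> on a weight grows by at most a bounded factor in the
  mean, so the tilt \<open>\<theta>\<close> decreases in time by the factor
  \<open>exp (- k / T)\<close> per step to compensate. In \<open>k = 6 * (1 + 3 / g)\<close> the 6
  is 2 from \<open>exp q - 1 \<le> 2 * q\<close> times 3 from \<open>s \<ge> T / 3\<close>, and the
  rest comes from \<open>w + 3 * m \<le> w * (1 + 3 / g)\<close>.\<close>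

lemma young_vertex:
  assumes t: "2 \<le> t" "t \<le> s0" "s0 \<le> T" "T \<le> 3 * t" and v: "v \<in> {1..s0}"
  shows "prob (law T) {h. wt (suf s0 h) v < U' \<and> U \<le> wt h v}
    \<le> exp (U' - exp (- (6 * (1 + 3 / g))) * U)"
proof -
  define k where "k = 6 * (1 + 3 / g)"
  define \<theta> where "\<theta> s = exp (- k * real s / T)" for s :: nat
  define \<Phi> where "\<Phi> hb h = exp (\<theta> (length h) * wt h v - \<theta> T * U)" for hb h :: "nat list list"
  have k0: "0 < k" using g01 by (simp add: k_def add_pos_pos)
  show ?thesis
  proof (rule ville_event[where st = s0 and T = T and pre = "\<lambda>h. wt h v < U'" and G = "\<lambda>_. True"
        and Q = "\<lambda>_ h. length h = T \<and> U \<le> wt h v" and \<Phi> = \<Phi>])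
    fix hb h assume h: "reach h" "s0 \<le> length h" "length h < T"
    let ?s = "length h" and ?w = "wt h v" and ?q = "\<theta> (length h + 1)"
    have s: "0 < ?s" "T / 3 \<le> ?s" using h t by auto
    have w: "0 < ?w" "m * g \<le> ?w" by (rule wt_pos wt_ge)+
    have v': "{v} \<subseteq> {1..?s}" using v h by auto
    have q: "0 < ?q" "?q \<le> 1" using k0 by (auto simp: \<theta>_def)
    have eq: "1 \<le> exp ?q" "exp ?q - 1 \<le> 2 * ?q"
    proof -
      have "exp ?q \<le> 1 + ?q + ?q\<^sup>2" using q by (intro exp_bound) auto
      also have "?q\<^sup>2 \<le> ?q" using q by (simp add: power2_eq_square mult_left_le)
      finally show "exp ?q - 1 \<le> 2 * ?q" by simp
    qed (use q in auto)
    have w3: "?w + 3 * m \<le> ?w * (1 + 3 / g)"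
      using w g01 by (simp add: field_simps)
    have "E (K h) (\<lambda>x. exp ?q ^ cnt {v} x) \<le> E (K h) (\<lambda>x. exp ?q ^ cnt ({v} \<union> {?s + 1}) x)"
    proof (intro E_mono finite_K h power_increasing eq)
      fix x show "cnt {v} x \<le> cnt ({v} \<union> {?s + 1}) x" by (induction x) auto
    qed
    also have "\<dots> \<le> exp (m * (exp ?q - 1) * (?w + 3 * m) / (c * ?s))"
      using K_upper_exp[OF h(1) v' eq(1)] by (simp add: W_def)
    also have "\<dots> \<le> exp (?q * ?w * (k / T))"
    proof -
      have "m * (exp ?q - 1) * (?w + 3 * m) / (c * ?s) \<le> m * (2 * ?q) * (?w * (1 + 3 / g)) / (c * ?s)"
        using eq q w w3 c_gt by (intro divide_right_mono mult_mono) auto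
      also have "\<dots> = (?q * ?w) * (2 * (1 + 3 / g)) * (m / c) / ?s" by (simp add: field_simps)
      also have "\<dots> \<le> (?q * ?w) * (2 * (1 + 3 / g)) * 1 / (T / 3)"
        using q w g01 c_gt s m2 t by (intro frac_le mult_mono mult_nonneg_nonneg) (auto simp: c_def field_simps)
      also have "\<dots> = ?q * ?w * (k / T)" by (simp add: k_def field_simps)
      finally show ?thesis by simp
    qed
    finally have e: "E (K h) (\<lambda>x. exp ?q ^ cnt {v} x) \<le> exp (?q * ?w * (k / T))" .
    have "count_list x v = cnt {v} x" for x :: "nat list" using sum_count_list[of "{v}" x] by simp
    then have "E (K h) (\<lambda>x. \<Phi> hb (x # h)) = E (K h) (\<lambda>x. exp (?q * ?w - \<theta> T * U) * exp ?q ^ cnt {v} x)"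
      unfolding \<Phi>_def
      by (intro E_cong) (simp add: wt_Cons exp_of_nat_mult[symmetric] algebra_simps flip: exp_add)
    also have "\<dots> \<le> exp (?q * ?w - \<theta> T * U) * exp (?q * ?w * (k / T))" using e by simp
    also have "\<dots> = exp (?w * (?q * (1 + k / T)) - \<theta> T * U)"
      by (simp add: algebra_simps flip: exp_add)
    also have "\<dots> \<le> \<Phi> hb h"
    proof -
      have "?q * (1 + k / T) \<le> ?q * exp (k / T)" using q exp_ge_add_one_self[of "k / T"] by (intro mult_left_mono) auto
      also have "\<dots> = \<theta> ?s" using t by (simp add: \<theta>_def field_simps flip: exp_add)
      finally have "?w * (?q * (1 + k / T)) \<le> ?w * \<theta> ?s" using w by (intro mult_left_mono) auto
      then show ?thesis by (simp add: \<Phi>_def mult.commute)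
    qed
    finally show "E (K h) (\<lambda>x. \<Phi> hb (x # h)) \<le> \<Phi> hb h" .
  next
    fix h assume h: "reach h" "length h = s0" "wt h v < U'"
    have "\<theta> s0 * wt h v \<le> 1 * wt h v" using k0 wt_pos[of h v] by (intro mult_right_mono) (auto simp: \<theta>_def)
    moreover have "\<theta> T = exp (- k)" using t by (simp add: \<theta>_def)
    ultimately show "\<Phi> h h \<le> exp (U' - exp (- (6 * (1 + 3 / g))) * U)"
      using h by (simp add: \<Phi>_def k_def)
  next
    fix h assume h: "reach h" "length h = T" "wt (suf s0 h) v < U' \<and> U \<le> wt h v"
    then show "wt (suf s0 h) v < U' \<and>
        (\<exists>s\<in>{s0..T}. (length (suf s h) = T \<and> U \<le> wt (suf s h) v) \<and> (\<forall>r\<in>{s0..<s}. True))"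
      using t by (intro conjI bexI[of _ T]) auto
  next
    fix hb h assume "length h = T \<and> U \<le> wt h v"
    then show "1 \<le> \<Phi> hb h" by (simp add: \<Phi>_def \<theta>_def mult_left_mono)
  qed (use t h0 in \<open>auto simp: \<Phi>_def\<close>)
qed

text \<open>The entry at position \<open>s + 1\<close> belongs to vertex \<open>s + 1\<close>, so
  the common neighbours range over the vertices born after time \<open>t\<close>. Such a vertex has
  edges to \<open>i\<close> and into \<open>A\<close>.\<close>

definition joined :: "nat \<Rightarrow> nat list list \<Rightarrow> nat \<Rightarrow> nat set \<Rightarrow> bool" where
  "joined t h i A \<longleftrightarrow> (\<exists>s\<in>{t..<length h}. set (hd (suf (s + 1) h)) \<inter> {i} \<noteq> {} \<and> set (hd (suf (s + 1) h)) \<inter> A \<noteq> {})"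

lemma joined_Cons:
  "t \<le> length h \<Longrightarrow> joined t (x # h) i A \<longleftrightarrow> joined t h i A \<or> (set x \<inter> {i} \<noteq> {} \<and> set x \<inter> A \<noteq> {})"
  unfolding joined_def by (auto simp: suf_Cons atLeastLessThanSuc)

text \<open>Weights only grow, so every vertex born after \<open>t\<close> joins \<open>i\<close> to
  the target with probability at least \<open>p\<close>, independently of the luck before;
  \<open>\<Phi>\<close> gains a factor \<open>exp (- p)\<close> per remaining step. The target is a
  function \<open>F\<close> of the history at time \<open>t\<close>, as the layers are.\<close>

lemma connector:
  assumes t: "2 \<le> t" "t \<le> T" and i: "i \<in> {1..t}" and w0: "0 \<le> w0"
  shows "prob (law T) {h. F (suf t h) \<subseteq> {1..t} \<and>
      w0 \<le> wt (suf t h) i * W (suf t h) (F (suf t h)) \<and> \<not> joined t h i (F (suf t h))}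
    \<le> exp (- (w0 * (T - t) / (c * T)\<^sup>2))"
proof -
  define p where "p = w0 / (c * T)\<^sup>2"
  define \<Phi> where "\<Phi> hb h = of_bool (\<not> joined t h i (F hb)) * exp (- (p * (real T - length h)))" for hb h
  show ?thesis
  proof (rule ville_event[where st = t and T = T and G = "\<lambda>_. True"
        and pre = "\<lambda>h. F h \<subseteq> {1..t} \<and> w0 \<le> wt h i * W h (F h)"
        and Q = "\<lambda>hb h. length h = T \<and> \<not> joined t h i (F hb)" and \<Phi> = \<Phi>])
    fix hb h assume h: "reach h" "suf t h = hb" "t \<le> length h" "length h < T"
      and pre: "F hb \<subseteq> {1..t} \<and> w0 \<le> wt hb i * W hb (F hb)"
    let ?s = "length h" and ?J = "\<lambda>x. set x \<inter> {i} \<noteq> {} \<and> set x \<inter> F hb \<noteq> {}"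
    have "w0 \<le> W h {i} * W h (F hb)"
    proof -
      have "w0 \<le> wt hb i * W hb (F hb)" using pre by simp
      also have "\<dots> \<le> wt h i * W h (F hb)"
        unfolding W_def using h(2) wt_suf_mono[of t h] wt_pos
        by (intro mult_mono sum_mono sum_nonneg) (auto intro: less_imp_le)
      finally show ?thesis by (simp add: W_def)
    qed
    then have "p \<le> W h {i} * W h (F hb) / (c * (?s + 1))\<^sup>2"
      unfolding p_def using h w0 c_gt by (intro frac_le power_mono mult_left_mono) auto
    also have "\<dots> \<le> prob (K h) {x. ?J x}"
      using pre i h by (intro K_two) auto
    finally have p: "p \<le> prob (K h) {x. ?J x}" .
    let ?e = "exp (- (p * (real T - ?s - 1)))"
    have "E (K h) (\<lambda>x. \<Phi> hb (x # h)) = E (K h) (\<lambda>x. of_bool (\<not> joined t h i (F hb)) * ?e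
        + (- (of_bool (\<not> joined t h i (F hb)) * ?e)) * of_bool (?J x))"
      unfolding \<Phi>_def by (intro E_cong) (auto simp: joined_Cons[OF h(3)] algebra_simps)
    also have "\<dots> = of_bool (\<not> joined t h i (F hb)) * ?e * (1 - prob (K h) {x. ?J x})"
      unfolding E_affine_bool[OF finite_K[OF h(1)], of _ _ ?J] by (simp add: algebra_simps)
    also have "\<dots> \<le> of_bool (\<not> joined t h i (F hb)) * ?e * exp (- p)"
      using p exp_ge_add_one_self[of "- p"] by (intro mult_left_mono) auto
    also have "\<dots> = \<Phi> hb h" by (simp add: \<Phi>_def algebra_simps flip: exp_add)
    finally show "E (K h) (\<lambda>x. \<Phi> hb (x # h)) \<le> \<Phi> hb h" .
  next
    fix h assume h: "reach h" "length h = T" "F (suf t h) \<subseteq> {1..t} \<and>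
      w0 \<le> wt (suf t h) i * W (suf t h) (F (suf t h)) \<and> \<not> joined t h i (F (suf t h))"
    then show "(F (suf t h) \<subseteq> {1..t} \<and> w0 \<le> wt (suf t h) i * W (suf t h) (F (suf t h))) \<and>
        (\<exists>s\<in>{t..T}. (length (suf s h) = T \<and> \<not> joined t (suf s h) i (F (suf t h))) \<and> (\<forall>r\<in>{t..<s}. True))"
      using t by (intro conjI bexI[of _ T]) auto
  qed (use t h0 in \<open>auto simp: \<Phi>_def p_def of_nat_diff\<close>)
qed

end

section \<open>Vertices far from the core\<close>

context pa
begin

text \<open>Loops are allowed, so that the isolated vertices of model (a) are bad.\<close>

primrec newbad :: "nat \<Rightarrow> (nat list list \<Rightarrow> nat set) \<Rightarrow> nat list list \<Rightarrow> nat set" where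
  "newbad N F [] = {}"
| "newbad N F (x # h) = newbad N F h \<union>
     (if N \<le> length h \<and> set x \<subseteq> F h \<union> {length h + 1} then {length h + 1} else {})"

lemma newbad_subset: "newbad N F h \<subseteq> {N + 1..length h}"
  by (induction h) auto

lemma newbad_subset1: "newbad N F h \<subseteq> {1..length h}"
  by (rule order_trans[OF newbad_subset]) auto

lemma finite_newbad [simp]: "finite (newbad N F h)"
  by (rule finite_subset[OF newbad_subset]) simp

lemma newbad_start: "length h \<le> N \<Longrightarrow> newbad N F h = {}"
  using newbad_subset[of N F h] by auto

text \<open>\<open>c * \<beta> ^ m\<close> solves the balance equation
  \<open>b = b / (1 + g) + m * g * \<beta> ^ m\<close>: old bad vertices at level \<open>b\<close>
  attract weight \<open>b / (1 + g)\<close> per step, and a newcomer, bad with probability at most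
  \<open>\<beta> ^ m\<close>, brings \<open>m * g\<close>. The excess \<open>\<epsilon>\<close>
  yields a restoring drift \<open>\<epsilon> * g / (1 + g) = 2 * \<epsilon> * k\<close>; half of it
  pays for the slack \<open>3 * m\<close>, half for concentration.\<close>

lemma phase_A:
  fixes N T :: nat and k \<epsilon> \<beta> :: real
  assumes F: "\<And>h. reach h \<Longrightarrow> F h \<subseteq> {1..length h}"
    and \<beta>: "0 \<le> \<beta>" "\<beta> \<le> 1" and \<epsilon>: "0 < \<epsilon>" "\<epsilon> \<le> 1" and N: "2 \<le> N" "N \<le> T"
    and k: "k = g / (2 * (1 + g))" "3 * m \<le> \<epsilon> * k * N"
  shows "prob (law T) {h.
      (\<exists>s\<in>{N..T}. (c * \<beta> ^ m + \<epsilon>) * s < W (suf s h) (newbad N F (suf s h))) \<and>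
      (\<forall>s\<in>{N..T}. W (suf s h) (F (suf s h)) + 3 * m \<le> \<beta> * c * s)}
    \<le> exp (- (\<epsilon> * k / (2 * m * (c + 1)) * (\<epsilon> * N)))"
proof -
  \<comment> \<open>Chosen so that the second-order term of the exponential, at most
    \<open>2 * m * \<theta> * b\<close> with \<open>b \<le> c + 1\<close>, does not exceed the drift
    \<open>\<epsilon> * k\<close>.\<close>
  define \<theta> where "\<theta> = \<epsilon> * k / (2 * m * (c + 1))"
  define b where "b = c * \<beta> ^ m + \<epsilon>"
  define \<Phi> where "\<Phi> hb h = exp (\<theta> * (W h (newbad N F h) - b * length h))" for hb h :: "nat list list"
  have k0: "0 < k" "k \<le> 1" using g01 k by (auto simp: divide_le_eq)
  have m0: "0 < real m" using m2 by simp
  have \<theta>0: "0 < \<theta>" using \<epsilon> k0 m0 c_gt by (simp add: \<theta>_def)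
  have \<theta>c: "2 * m * \<theta> * (c + 1) = \<epsilon> * k"
  proof -
    have "2 * m * (c + 1) \<noteq> 0" using m0 c_gt by simp
    then show ?thesis by (simp add: \<theta>_def)
  qed
  have \<theta>m: "\<theta> * (2 * m) \<le> 1"
  proof -
    have "\<theta> * (2 * m) * 1 \<le> \<theta> * (2 * m) * (c + 1)" using \<theta>0 m0 c_gt by (intro mult_left_mono) auto
    also have "\<dots> = \<epsilon> * k" using \<theta>c by (simp add: mult_ac)
    also have "\<dots> \<le> 1" using \<epsilon> k0 by (intro mult_le_one) auto
    finally show ?thesis by simp
  qed
  have bp: "\<epsilon> \<le> b" "b \<le> c + 1" "0 < b"
  proof -
    have "\<beta> ^ m \<le> 1" using \<beta> by (simp add: power_le_one)
    then have "c * \<beta> ^ m \<le> c * 1" using c_gt(3) by (intro mult_left_mono) auto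
    then show "b \<le> c + 1" using \<epsilon> by (simp add: b_def)
    show "\<epsilon> \<le> b" using \<beta> c_gt by (simp add: b_def)
    then show "0 < b" using \<epsilon> by simp
  qed
  have "prob (law T) {h.
      (\<exists>s\<in>{N..T}. b * s < W (suf s h) (newbad N F (suf s h))) \<and>
      (\<forall>s\<in>{N..T}. W (suf s h) (F (suf s h)) + 3 * m \<le> \<beta> * c * s)} \<le> exp (- (\<theta> * (\<epsilon> * N)))"
  proof (rule ville_event[where st = N and T = T and pre = "\<lambda>_. True" and
        G = "\<lambda>h. W h (F h) + 3 * m \<le> \<beta> * c * length h" and
        Q = "\<lambda>_ h. b * length h < W h (newbad N F h)" and \<Phi> = \<Phi>])
    fix hb h assume h: "reach h" "N \<le> length h"
      and G: "W h (F h) + 3 * m \<le> \<beta> * c * length h" and nQ: "\<not> b * length h < W h (newbad N F h)"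
    let ?s = "length h" and ?B = "newbad N F h"
    let ?P = "\<lambda>x. set x \<subseteq> F h \<union> {?s + 1}"
    define X where "X = W h ?B"
    \<comment> \<open>An upper bound for the increase of the bad weight: edges into bad vertices or
      into the newcomer, plus the initial weight of the newcomer if it is bad.\<close>
    define D where "D x = cnt (?B \<union> {?s + 1}) x + m * g * of_bool (?P x)" for x :: "nat list"
    have s0: "0 < ?s" using h(2) N by linarith
    have v: "valid h" using reach_valid[OF h(1)] by simp
    have Dm: "D x \<le> 2 * m" if "length x = m" for x
    proof -
      have "cnt (?B \<union> {?s + 1}) x \<le> m" unfolding that[symmetric] by (rule length_filter_le)
      moreover have "m * g * of_bool (?P x) \<le> m" using g01 m0 by (auto simp: mult_left_le)
      ultimately show ?thesis unfolding D_def by linarith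
    qed
    have D0: "0 \<le> D x" for x using mg_pos by (simp add: D_def)
    have new: "W (x # h) (newbad N F (x # h)) \<le> X + D x" for x
    proof -
      have n: "?s + 1 \<notin> ?B" using newbad_subset[of N F h] by auto
      have "count_list (concat h) (?s + 1) = 0"
      proof -
        have "set (concat h) \<subseteq> {1..?s}" using v unfolding valid_def by auto
        then have "?s + 1 \<notin> set (concat h)" by auto
        then show ?thesis by (rule count_list_0_iff[THEN iffD2])
      qed
      then have "wt h (?s + 1) = m * g" by (simp add: wt_def)
      then have "W h {?s + 1} = m * g" by (simp add: W_def)
      then have "W h (?B \<union> {?s + 1}) = X + m * g" using n unfolding X_def by (subst W_Un) auto
      then have W1: "W (x # h) (?B \<union> {?s + 1}) = X + m * g + cnt (?B \<union> {?s + 1}) x"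
        by (subst W_Cons) auto
      show ?thesis
      proof (cases "?P x")
        case True
        then have "newbad N F (x # h) = ?B \<union> {?s + 1}" using h(2) by simp
        then show ?thesis using W1 True by (simp add: D_def)
      next
        case False
        then have "newbad N F (x # h) = ?B" by simp
        then have "W (x # h) (newbad N F (x # h)) = X + real (cnt ?B x)"
          by (simp only: W_Cons finite_newbad X_def)
        moreover have "cnt ?B x \<le> cnt (?B \<union> {?s + 1}) x" by (induction x) auto
        then have "real (cnt ?B x) \<le> cnt (?B \<union> {?s + 1}) x" by (simp only: of_nat_le_iff)
        ultimately show ?thesis using False by (simp add: D_def)
      qed
    qed
    have ED: "E (K h) D \<le> b - \<epsilon> * k"
    proof -
      have "E (K h) D = E (K h) (\<lambda>x. real (cnt (?B \<union> {?s + 1}) x)) + E (K h) (\<lambda>x. 0 + m * g * of_bool (?P x))"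
        unfolding D_def using finite_K[OF h(1)] by (simp add: E_add)
      also have "E (K h) (\<lambda>x. 0 + m * g * of_bool (?P x)) = m * g * prob (K h) {x. ?P x}"
        unfolding E_affine_bool[OF finite_K[OF h(1)], of 0 "m * g" ?P] by simp
      finally have E1: "E (K h) D = E (K h) (\<lambda>x. real (cnt (?B \<union> {?s + 1}) x)) + m * g * prob (K h) {x. ?P x}" .
      have "prob (K h) {x. ?P x} \<le> ((W h (F h) + 3 * m) / (c * ?s)) ^ m"
        by (rule K_all[OF h(1) F[OF h(1)]])
      also have "\<dots> \<le> \<beta> ^ m"
        using G s0 c_gt W_nonneg[of h "F h"] by (intro power_mono) (auto simp: divide_le_eq mult_ac)
      finally have E2: "m * g * prob (K h) {x. ?P x} \<le> m * g * \<beta> ^ m"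
        using mg_pos by (intro mult_left_mono) auto
      have "E (K h) (\<lambda>x. real (cnt (?B \<union> {?s + 1}) x)) \<le> m * ((X + 3 * m) / (c * ?s))"
        unfolding X_def by (rule K_cnt[OF h(1) newbad_subset1])
      also have "\<dots> \<le> m * ((b * ?s + 3 * m) / (c * ?s))"
        using nQ c_gt m0 by (intro mult_left_mono divide_right_mono) (auto simp: X_def)
      also have "\<dots> = (b * ?s + 3 * m) / ((1 + g) * ?s)"
        using m0 by (simp add: c_def mult.assoc)
      also have "\<dots> = b / (1 + g) + 3 * m / ((1 + g) * ?s)"
        using s0 by (simp add: add_divide_distrib)
      also have "\<dots> \<le> b / (1 + g) + \<epsilon> * k"
      proof -
        have "\<epsilon> * k * N \<le> \<epsilon> * k * ?s" using \<epsilon> k0 h(2) by (intro mult_left_mono) auto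
        then have a: "3 * m \<le> \<epsilon> * k * ?s" using k by linarith
        have "3 * m / ((1 + g) * ?s) \<le> 3 * m / (1 * ?s)"
          using s0 g01 m0 by (intro divide_left_mono mult_right_mono) auto
        also have "\<dots> \<le> \<epsilon> * k" using a s0 by (simp add: divide_le_eq)
        finally show ?thesis by simp
      qed
      finally have "E (K h) D \<le> b / (1 + g) + \<epsilon> * k + m * g * \<beta> ^ m"
        using E1 E2 by linarith
      also have "m * g * \<beta> ^ m = (b - \<epsilon>) * (g / (1 + g))"
        using g01 by (simp add: b_def c_def)
      also have "b / (1 + g) + \<epsilon> * k + (b - \<epsilon>) * (g / (1 + g)) = b - \<epsilon> * k"
      proof -
        have e: "b / (1 + g) + b * g / (1 + g) = b"
        proof -
          have "b / (1 + g) + b * g / (1 + g) = b * (1 + g) / (1 + g)"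
            by (simp only: distrib_left add_divide_distrib mult_1_right)
          then show ?thesis using g01 by simp
        qed
        have "g / (1 + g) = 2 * k" using g01 k by (simp add: field_simps)
        moreover have "(b - \<epsilon>) * (g / (1 + g)) = b * g / (1 + g) - \<epsilon> * (g / (1 + g))"
          by (simp add: left_diff_distrib diff_divide_distrib)
        ultimately have "(b - \<epsilon>) * (g / (1 + g)) = b * g / (1 + g) - \<epsilon> * (2 * k)" by simp
        then show ?thesis using e by simp
      qed
      finally show ?thesis .
    qed
    have drift: "(1 + 2 * m * \<theta>) * E (K h) D \<le> b"
    proof -
      have "(1 + 2 * m * \<theta>) * E (K h) D \<le> (1 + 2 * m * \<theta>) * (b - \<epsilon> * k)"
        using ED \<theta>0 by (intro mult_left_mono) auto
      also have "\<dots> = b + (2 * m * \<theta> * b - \<epsilon> * k) - 2 * m * \<theta> * (\<epsilon> * k)" by (simp add: algebra_simps)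
      finally have 1: "(1 + 2 * m * \<theta>) * E (K h) D \<le> b + (2 * m * \<theta> * b - \<epsilon> * k) - 2 * m * \<theta> * (\<epsilon> * k)" .
      have 2: "2 * m * \<theta> * b \<le> 2 * m * \<theta> * (c + 1)" using \<theta>0 bp by (intro mult_left_mono) auto
      have 3: "0 \<le> 2 * m * \<theta> * (\<epsilon> * k)" using \<theta>0 \<epsilon> k0 by (intro mult_nonneg_nonneg) auto
      show ?thesis using 1 2 3 \<theta>c by linarith
    qed
    have "E (K h) (\<lambda>x. \<Phi> hb (x # h)) \<le> E (K h) (\<lambda>x. exp (\<theta> * (X - b * (?s + 1))) * (1 + (\<theta> * (1 + 2 * m * \<theta>)) * D x))"
    proof (rule E_mono[OF finite_K[OF h(1)]])
      fix x assume "x \<in> set_pmf (K h)"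
      then have len: "length x = m" using reach_set_K[OF h(1)] by simp
      have "\<theta> * (W (x # h) (newbad N F (x # h)) - b * (?s + 1)) \<le> \<theta> * (X + D x - b * (?s + 1))"
        using new[of x] \<theta>0 by (intro mult_left_mono) auto
      also have "\<dots> = \<theta> * (X - b * (?s + 1)) + \<theta> * D x" by (simp add: algebra_simps)
      finally have "\<Phi> hb (x # h) \<le> exp (\<theta> * (X - b * (?s + 1)) + \<theta> * D x)"
        by (simp add: \<Phi>_def add.commute)
      also have "\<dots> = exp (\<theta> * (X - b * (?s + 1))) * exp (\<theta> * D x)" by (rule exp_add)
      also have "\<dots> \<le> exp (\<theta> * (X - b * (?s + 1))) * (1 + (\<theta> * (1 + 2 * m * \<theta>)) * D x)"
      proof (rule mult_left_mono)
        have "\<theta> * D x \<le> \<theta> * (2 * m)" using Dm[OF len] \<theta>0 by (intro mult_left_mono) auto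
        then have "exp (\<theta> * D x) \<le> 1 + \<theta> * D x + (\<theta> * D x)\<^sup>2"
          using D0[of x] \<theta>0 \<theta>m by (intro exp_bound mult_nonneg_nonneg) linarith+
        moreover have "(\<theta> * D x)\<^sup>2 \<le> \<theta> * D x * (\<theta> * (2 * m))"
          unfolding power2_eq_square using Dm[OF len] D0[of x] \<theta>0 by (intro mult_left_mono) auto
        moreover have "\<theta> * (1 + 2 * m * \<theta>) * D x = \<theta> * D x + \<theta> * D x * (\<theta> * (2 * m))"
          by (simp add: algebra_simps)
        ultimately show "exp (\<theta> * D x) \<le> 1 + \<theta> * (1 + 2 * m * \<theta>) * D x" by linarith
      qed simp
      finally show "\<Phi> hb (x # h) \<le> exp (\<theta> * (X - b * (?s + 1))) * (1 + (\<theta> * (1 + 2 * m * \<theta>)) * D x)" .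
    qed
    also have "\<dots> = exp (\<theta> * (X - b * (?s + 1))) * (1 + (\<theta> * (1 + 2 * m * \<theta>)) * E (K h) D)"
      using finite_K[OF h(1)] by (simp add: E_add)
    also have "\<dots> \<le> exp (\<theta> * (X - b * (?s + 1))) * exp (\<theta> * b)"
    proof (intro mult_left_mono)
      have "\<theta> * (1 + 2 * m * \<theta>) * E (K h) D \<le> \<theta> * b"
        using mult_left_mono[OF drift, of \<theta>] \<theta>0 by (simp add: mult.assoc)
      then show "1 + (\<theta> * (1 + 2 * m * \<theta>)) * E (K h) D \<le> exp (\<theta> * b)"
        using exp_ge_add_one_self[of "\<theta> * b"] by linarith
    qed auto
    also have "\<dots> = \<Phi> hb h" by (simp add: \<Phi>_def X_def algebra_simps flip: exp_add)
    finally show "E (K h) (\<lambda>x. \<Phi> hb (x # h)) \<le> \<Phi> hb h" .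
  next
    fix h assume h: "reach h" "length h = N"
    have "\<theta> * (\<epsilon> * N) \<le> \<theta> * (b * N)" using bp \<theta>0 by (intro mult_left_mono mult_right_mono) auto
    then show "\<Phi> h h \<le> exp (- (\<theta> * (\<epsilon> * N)))"
      using h by (simp add: \<Phi>_def newbad_start W_def)
  next
    fix hb h assume "b * length h < W h (newbad N F h)"
    then show "1 \<le> \<Phi> hb h" using \<theta>0 by (simp add: \<Phi>_def)
  next
    fix h assume h: "length h = T" "(\<exists>s\<in>{N..T}. b * s < W (suf s h) (newbad N F (suf s h))) \<and>
      (\<forall>s\<in>{N..T}. W (suf s h) (F (suf s h)) + 3 * m \<le> \<beta> * c * s)"
    then obtain s where s: "s \<in> {N..T}" "b * s < W (suf s h) (newbad N F (suf s h))" by blast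
    have "\<forall>r\<in>{N..<s}. W (suf r h) (F (suf r h)) + 3 * m \<le> \<beta> * c * length (suf r h)"
      using h s(1) by auto
    then show "True \<and> (\<exists>s\<in>{N..T}. b * length (suf s h) < W (suf s h) (newbad N F (suf s h)) \<and>
        (\<forall>r\<in>{N..<s}. W (suf r h) (F (suf r h)) + 3 * m \<le> \<beta> * c * length (suf r h)))"
      using s h(1) by (intro conjI TrueI bexI[of _ s]) auto
  qed (use N h0 in \<open>auto simp: \<Phi>_def\<close>)
  then show ?thesis by (simp only: b_def \<theta>_def)
qed

text \<open>A first moment: the vertex born at time \<open>r\<close> is bad with probability at most
  \<open>r powr (- 2 * \<gamma>)\<close>, because at least two edges must lead into a set of
  relative weight \<open>r powr (- \<gamma>)\<close>. \<open>\<Phi>\<close> adds the expected future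
  contributions to the present sum, and the factor 2 is Markov's inequality at level
  \<open>1 / 2\<close>.\<close>

lemma phase_B:
  fixes N T :: nat and \<gamma> \<gamma>' :: real
  assumes F: "\<And>h. reach h \<Longrightarrow> F h \<subseteq> {1..length h}"
    and \<gamma>: "0 < \<gamma>" "\<gamma>' \<le> 1" and N: "2 \<le> N" "N \<le> T"
  shows "prob (law T) {h.
      (\<exists>s\<in>{N..T}. 1 / 2 \<le> (\<Sum>v\<in>newbad N F (suf s h). real v powr (\<gamma>' - 1))) \<and>
      (\<forall>s\<in>{N..T}. W (suf s h) (F (suf s h)) + 3 * m \<le> c * real s powr (1 - \<gamma>))}
    \<le> 2 * (\<Sum>r\<in>{N..<T}. real r powr (\<gamma>' - 1 - 2 * \<gamma>))"
proof -
  define \<Phi> where "\<Phi> hb h = 2 * (\<Sum>v\<in>newbad N F h. real v powr (\<gamma>' - 1)) +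
    2 * (\<Sum>r\<in>{length h..<T}. real r powr (\<gamma>' - 1 - 2 * \<gamma>))" for hb h :: "nat list list"
  show ?thesis
  proof (rule ville_event[where st = N and T = T and pre = "\<lambda>_. True" and
        G = "\<lambda>h. W h (F h) + 3 * m \<le> c * real (length h) powr (1 - \<gamma>)" and
        Q = "\<lambda>_ h. 1 / 2 \<le> (\<Sum>v\<in>newbad N F h. real v powr (\<gamma>' - 1))" and \<Phi> = \<Phi>])
    fix hb h assume h: "reach h" "N \<le> length h" "length h < T"
      and G: "W h (F h) + 3 * m \<le> c * real (length h) powr (1 - \<gamma>)"
    let ?s = "length h" and ?B = "newbad N F h"
    let ?P = "\<lambda>x. set x \<subseteq> F h \<union> {?s + 1}"
    let ?S = "\<Sum>v\<in>?B. real v powr (\<gamma>' - 1)" and ?R = "\<Sum>r\<in>{?s + 1..<T}. real r powr (\<gamma>' - 1 - 2 * \<gamma>)"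
    have s0: "0 < ?s" using h(2) N by linarith
    have n: "?s + 1 \<notin> ?B" using newbad_subset[of N F h] by auto
    have s1: "1 \<le> real ?s" using s0 by linarith
    have pr: "prob (K h) {x. ?P x} \<le> real ?s powr (- 2 * \<gamma>)"
    proof -
      have "prob (K h) {x. ?P x} \<le> ((W h (F h) + 3 * m) / (c * ?s)) ^ m"
        by (rule K_all[OF h(1) F[OF h(1)]])
      also have "\<dots> \<le> (c * real ?s powr (1 - \<gamma>) / (c * ?s)) ^ m"
        using G c_gt W_nonneg[of h "F h"] by (intro power_mono divide_right_mono) auto
      also have "c * real ?s powr (1 - \<gamma>) / (c * ?s) = real ?s powr (- \<gamma>)"
        using s0 c_gt by (simp add: powr_diff powr_minus divide_simps)
      also have "(real ?s powr (- \<gamma>)) ^ m \<le> (real ?s powr (- \<gamma>)) ^ 2"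
      proof (rule power_decreasing)
        have "1 \<le> real ?s powr \<gamma>" using s1 \<gamma> by (intro ge_one_powr_ge_zero) auto
        then show "real ?s powr (- \<gamma>) \<le> 1" by (simp add: powr_minus inverse_le_1_iff)
      qed (use m2 in auto)
      also have "\<dots> = real ?s powr (- 2 * \<gamma>)" by (simp add: power2_eq_square flip: powr_add)
      finally show ?thesis .
    qed
    have p1: "real (?s + 1) powr (\<gamma>' - 1) \<le> real ?s powr (\<gamma>' - 1)"
      using \<gamma> s0 by (intro powr_mono2') auto
    have "E (K h) (\<lambda>x. \<Phi> hb (x # h))
        = E (K h) (\<lambda>x. (2 * ?S + 2 * ?R) + 2 * real (?s + 1) powr (\<gamma>' - 1) * of_bool (?P x))"
    proof (rule E_cong)
      fix x
      have "(\<Sum>v\<in>newbad N F (x # h). real v powr (\<gamma>' - 1))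
          = ?S + real (?s + 1) powr (\<gamma>' - 1) * of_bool (?P x)"
      proof (cases "?P x")
        case True
        then have "newbad N F (x # h) = insert (?s + 1) ?B" using h(2) by simp
        then show ?thesis using n True by simp
      qed simp
      then show "\<Phi> hb (x # h) = (2 * ?S + 2 * ?R) + 2 * real (?s + 1) powr (\<gamma>' - 1) * of_bool (?P x)"
        by (simp add: \<Phi>_def)
    qed
    also have "\<dots> = (2 * ?S + 2 * ?R) + 2 * (real (?s + 1) powr (\<gamma>' - 1) * prob (K h) {x. ?P x})"
      unfolding E_affine_bool[OF finite_K[OF h(1)], of _ _ ?P] by simp
    also have "\<dots> \<le> (2 * ?S + 2 * ?R) + 2 * (real ?s powr (\<gamma>' - 1) * real ?s powr (- 2 * \<gamma>))"
      using pr p1 by (intro add_left_mono mult_left_mono mult_mono) auto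
    also have "real ?s powr (\<gamma>' - 1) * real ?s powr (- 2 * \<gamma>) = real ?s powr (\<gamma>' - 1 - 2 * \<gamma>)"
      by (simp flip: powr_add)
    also have "(2 * ?S + 2 * ?R) + 2 * real ?s powr (\<gamma>' - 1 - 2 * \<gamma>) = \<Phi> hb h"
      unfolding \<Phi>_def using h(3) by (subst sum.atLeast_Suc_lessThan[of ?s]) auto
    finally show "E (K h) (\<lambda>x. \<Phi> hb (x # h)) \<le> \<Phi> hb h" .
  next
    fix h assume h: "length h = T"
      "(\<exists>s\<in>{N..T}. 1 / 2 \<le> (\<Sum>v\<in>newbad N F (suf s h). real v powr (\<gamma>' - 1))) \<and>
      (\<forall>s\<in>{N..T}. W (suf s h) (F (suf s h)) + 3 * m \<le> c * real s powr (1 - \<gamma>))"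
    then obtain s where s: "s \<in> {N..T}" "1 / 2 \<le> (\<Sum>v\<in>newbad N F (suf s h). real v powr (\<gamma>' - 1))" by blast
    have "\<forall>r\<in>{N..<s}. W (suf r h) (F (suf r h)) + 3 * m \<le> c * real (length (suf r h)) powr (1 - \<gamma>)"
      using h s(1) by auto
    then show "True \<and> (\<exists>s\<in>{N..T}. 1 / 2 \<le> (\<Sum>v\<in>newbad N F (suf s h). real v powr (\<gamma>' - 1)) \<and>
        (\<forall>r\<in>{N..<s}. W (suf r h) (F (suf r h)) + 3 * m \<le> c * real (length (suf r h)) powr (1 - \<gamma>)))"
      using s h(1) by (intro conjI TrueI bexI[of _ s]) auto
  next
    fix hb h assume h: "1 / 2 \<le> (\<Sum>v\<in>newbad N F h. real v powr (\<gamma>' - 1))"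
    have "0 \<le> (\<Sum>r\<in>{length h..<T}. real r powr (\<gamma>' - 1 - 2 * \<gamma>))" by (intro sum_nonneg) auto
    then show "1 \<le> \<Phi> hb h" using h by (simp add: \<Phi>_def)
  next
    show "0 \<le> \<Phi> hb h" for hb h by (auto simp: \<Phi>_def intro!: sum_nonneg add_nonneg_nonneg)
  next
    show "\<Phi> h h \<le> 2 * (\<Sum>r\<in>{N..<T}. real r powr (\<gamma>' - 1 - 2 * \<gamma>))" if "length h = N" for h
      using that by (simp add: \<Phi>_def newbad_start)
  qed (use N h0 in \<open>auto intro!: sum_nonneg\<close>)
qed

end

section \<open>Distances\<close>

definition near :: "mgraph \<Rightarrow> nat \<Rightarrow> nat \<Rightarrow> nat \<Rightarrow> bool" where
  "near G k u v \<longleftrightarrow> (\<exists>n\<le>k. (u, v) \<in> adj G ^^ n)"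

lemma near_refl: "near G 0 u u"
  by (auto simp: near_def)

lemma near_adj: "(u, v) \<in> adj G \<Longrightarrow> near G 1 u v"
  unfolding near_def by (intro exI[of _ 1]) auto

lemma near_trans: "near G k u v \<Longrightarrow> near G l v w \<Longrightarrow> near G (k + l) u w"
  unfolding near_def by (metis add_mono relcomp.relcompI relpow_add)

lemma near_mono: "near G k u v \<Longrightarrow> k \<le> l \<Longrightarrow> near G l u v"
  unfolding near_def by (meson order_trans)

lemma adj_sym: "sym (adj G)"
  by (auto simp: sym_def adj_def add_mset_commute)

lemma relpow_sym: "sym R \<Longrightarrow> (u, v) \<in> R ^^ n \<Longrightarrow> (v, u) \<in> R ^^ n"
proof (induction n arbitrary: v)
  case (Suc n)
  then obtain y where "(u, y) \<in> R ^^ n" "(y, v) \<in> R" by auto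
  then have "(v, y) \<in> R" "(y, u) \<in> R ^^ n" using Suc by (auto dest: symD)
  then show ?case by (rule relpow_Suc_I2)
qed simp

lemma relpow_subset: "(R :: ('a \<times> 'a) set) \<subseteq> S \<Longrightarrow> R ^^ n \<subseteq> S ^^ n"
  by (induction n) (auto intro: relcomp_mono)

lemma near_sym: "near G k u v \<Longrightarrow> near G k v u"
  unfolding near_def using relpow_sym[OF adj_sym] by blast

lemma near_adj_mono: "adj G \<subseteq> adj H \<Longrightarrow> near G k u v \<Longrightarrow> near H k u v"
  unfolding near_def using relpow_subset[of "adj G" "adj H"] by blast

text \<open>\<open>Max\<close> needs a finite nonempty set: the bound gives finiteness, and the
  distance of a vertex to itself gives an element.\<close>

lemma diam_le:
  assumes "verts G \<noteq> {}" "\<And>u v. u \<in> verts G \<Longrightarrow> v \<in> verts G \<Longrightarrow> near G b u v"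
  shows "diam G \<le> b"
proof -
  let ?D = "{d. \<exists>i\<in>verts G. \<exists>j\<in>verts G. gdist G i j = enat d}"
  have le: "gdist G i j \<le> enat b" if ij: "i \<in> verts G" "j \<in> verts G" for i j
  proof -
    obtain n where n: "n \<le> b" "(i, j) \<in> adj G ^^ n" using assms(2)[OF ij] by (auto simp: near_def)
    then have "gdist G i j \<le> enat n" unfolding gdist_def by (intro INF_lower) simp
    then show ?thesis using n(1) by (meson enat_ord_simps(1) order_trans)
  qed
  have sub: "?D \<subseteq> {..b}"
  proof
    fix d assume "d \<in> ?D"
    then obtain i j where "i \<in> verts G" "j \<in> verts G" "gdist G i j = enat d" by blast
    then show "d \<in> {..b}" using le[of i j] by simp
  qed
  obtain i where i: "i \<in> verts G" using assms(1) by blast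
  obtain d where "gdist G i i = enat d" using le[OF i i] by (cases "gdist G i i") auto
  then have "?D \<noteq> {}" using i by blast
  then show ?thesis unfolding diam_def using sub finite_subset[OF sub]
    by (intro Max.boundedI) auto
qed

section \<open>The graph encoded by a history\<close>

primrec hedges :: "nat list list \<Rightarrow> nat multiset multiset" where
  "hedges [] = {#}"
| "hedges (x # h) = hedges h + image_mset (\<lambda>u. {#length h + 1, u#}) (mset x)"

definition hgraph :: "nat list list \<Rightarrow> mgraph" where
  "hgraph h = MGraph {1..length h} (hedges h)"

lemma hedges_append: "hedges h \<subseteq># hedges (xs @ h)"
  by (induction xs) (auto intro: subset_mset.order_trans)

lemma adj_hgraph_suf: "adj (hgraph (suf s h)) \<subseteq> adj (hgraph h)"
proof -
  have "hedges (suf s h) \<subseteq># hedges h"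
    using hedges_append[of "suf s h" "take (length h - s) h"] by (simp add: suf_def)
  then show ?thesis by (auto simp: adj_def hgraph_def dest: mset_subset_eqD)
qed

lemma adj_hgraph:
  assumes "s < length h" "u \<in> set (hd (suf (s + 1) h))"
  shows "(s + 1, u) \<in> adj (hgraph h)"
proof -
  obtain x h' where x: "suf (s + 1) h = x # h'" using assms(1) by (cases "suf (s + 1) h") (auto simp: suf_def)
  then have "length h' = s" using length_suf[of "s + 1" h] assms(1) by simp
  then have "(s + 1, u) \<in> adj (hgraph (suf (s + 1) h))"
    using assms(2) unfolding x by (auto simp: adj_def hgraph_def)
  then show ?thesis using adj_hgraph_suf by blast
qed

context pa
begin

definition noncore :: "nat \<Rightarrow> real \<Rightarrow> nat list list \<Rightarrow> nat set" where
  "noncore N U h = {v\<in>{N + 1..length h}. wt h v < U}"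

text \<open>A superset of the vertices at distance more than \<open>k\<close> from the core, see
  \<open>path_to_core\<close>. Membership in \<open>newbad\<close> is decided at birth and never
  revoked, whereas a vertex may enter the core later; the intersection removes such vertices and
  keeps the weight of each remaining one below \<open>U\<close>.\<close>

primrec badc :: "nat \<Rightarrow> real \<Rightarrow> nat \<Rightarrow> nat list list \<Rightarrow> nat set" where
  "badc N U 0 = noncore N U"
| "badc N U (Suc k) = (\<lambda>h. newbad N (badc N U k) h \<inter> noncore N U h)"

lemma badc_noncore: "badc N U k h \<subseteq> noncore N U h"
  by (cases k) auto

lemma badc_subset: "badc N U k h \<subseteq> {1..length h}"
  using badc_noncore[of N U k h] by (auto simp: noncore_def)

lemma newbad_witness:
  "v \<in> {N + 1..length h} \<Longrightarrow> v \<notin> newbad N F h \<Longrightarrow>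
    \<exists>x h'. suf v h = x # h' \<and> length h' = v - 1 \<and> \<not> set x \<subseteq> F h' \<union> {v}"
proof (induction h)
  case (Cons y h)
  show ?case
  proof (cases "v = length h + 1")
    case True
    then show ?thesis using Cons.prems by (intro exI[of _ y] exI[of _ h]) (auto split: if_splits)
  next
    case False
    then have "v \<le> length h" using Cons.prems by auto
    then show ?thesis using Cons by (auto simp: suf_Cons)
  qed
qed simp

text \<open>A vertex outside the bad set and outside the core has an end point that was not bad just
  before its birth. The induction hypothesis is applied to that older history; its path survives,
  since edges persist and weights grow, so a core vertex stays in the core.\<close>

lemma path_to_core:
  assumes "length h0 \<le> N"
  shows "\<lbrakk>reach h; v \<in> {1..length h}; v \<notin> badc N U k h\<rbrakk>
    \<Longrightarrow> \<exists>u\<in>{1..length h} - noncore N U h. near (hgraph h) k v u"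
proof (induction k arbitrary: h v)
  case 0
  then show ?case using near_refl[of "hgraph h" v] by (intro bexI[of _ v]) auto
next
  case (Suc k)
  show ?case
  proof (cases "v \<in> noncore N U h")
    case False
    then show ?thesis using Suc.prems near_mono[OF near_refl[of "hgraph h" v], of "Suc k"] by blast
  next
    case True
    then have v: "v \<in> {N + 1..length h}" "v \<notin> newbad N (badc N U k) h"
      using Suc.prems by (auto simp: noncore_def)
    obtain x h' where x: "suf v h = x # h'" "length h' = v - 1" "\<not> set x \<subseteq> badc N U k h' \<union> {v}"
      using newbad_witness[OF v] by blast
    then obtain u where u: "u \<in> set x" "u \<notin> badc N U k h'" "u \<noteq> v" by blast
    have "suf (v - 1) (x # h') = h'" using x(2) by (simp add: suf_Cons)
    then have h': "h' = suf (v - 1) h" using suf_suf[of "v - 1" v h] x(1) by simp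
    have r: "reach (x # h')" "reach h'"
      using reach_suf[OF Suc.prems(1), of v] reach_suf[OF Suc.prems(1), of "v - 1"] v(1) assms h' x(1)
      by auto
    then have "x \<in> set_pmf (K h')"
      using r v(1) x(2) assms by (cases rule: reach.cases[OF r(1)]) auto
    then have "u \<in> {1..v - 1}" using reach_set_K[OF r(2)] u x(2) v(1) by force
    then obtain w where w: "w \<in> {1..length h'} - noncore N U h'" "near (hgraph h') k u w"
      using Suc.IH[OF r(2), of u] u x(2) by auto
    have "near (hgraph h) k u w" using w(2) near_adj_mono[OF adj_hgraph_suf] unfolding h' by blast
    moreover have "(v, u) \<in> adj (hgraph h)"
      using adj_hgraph[of "v - 1" h u] u(1) v(1) x(1) by auto
    ultimately have "near (hgraph h) (1 + k) v w" using near_adj near_trans by blast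
    moreover have "w \<in> {1..length h} - noncore N U h"
      using w(1) v(1) x(2) wt_suf_mono[of "v - 1" h w] by (auto simp: noncore_def h')
    ultimately show ?thesis by auto
  qed
qed

lemma joined_near:
  assumes "joined t h i A"
  shows "\<exists>x\<in>A. near (hgraph h) 2 i x"
proof -
  obtain s x where s: "s \<in> {t..<length h}" "i \<in> set (hd (suf (s + 1) h))" "x \<in> set (hd (suf (s + 1) h))" "x \<in> A"
    using assms unfolding joined_def by blast
  have "near (hgraph h) 1 i (s + 1)" "near (hgraph h) 1 (s + 1) x"
    using s adj_hgraph[of s h] near_sym[OF near_adj[of "s + 1" i]] near_adj[of "s + 1" x] by auto
  then have "near (hgraph h) (1 + 1) i x" by (rule near_trans)
  then show ?thesis using s(4) unfolding one_add_one by blast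
qed

text \<open>The deterministic part: at most \<open>Suc k\<close> edges lead to the core,
  \<open>2 * J\<close> edges climb the layers, and two edges link two top vertices. The core reached
  at the final time is carried back to time \<open>t\<close> by the contrapositive of
  \<open>iii\<close>.\<close>

lemma diam_good:
  fixes thr :: "nat \<Rightarrow> real"
  assumes h: "reach h" "length h = T" and t: "2 \<le> N" "N \<le> t" "t \<le> T"
    and i: "newbad N (badc N U k) h = {}"
    and ii: "\<And>v. v \<in> {1..N} \<Longrightarrow> thr 0 \<le> wt (suf t h) v"
    and iii: "\<And>v. v \<in> {1..T} \<Longrightarrow> wt (suf (max t v) h) v < thr 0 \<Longrightarrow> wt h v < U"
    and iv: "\<And>i j. i \<in> {1..t} \<Longrightarrow> j < J \<Longrightarrow> thr j \<le> wt (suf t h) i \<Longrightarrow>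
       joined t h i {x\<in>{1..t}. thr (Suc j) \<le> wt (suf t h) x}"
    and v: "\<And>i i'. i \<in> {1..t} \<Longrightarrow> i' \<in> {1..t} \<Longrightarrow> thr J \<le> wt (suf t h) i \<Longrightarrow> thr J \<le> wt (suf t h) i' \<Longrightarrow>
       joined t h i {i'}"
    and small: "2 * m < thr 0"
  shows "diam (hgraph h) \<le> 2 * Suc k + 4 * J + 2"
proof -
  let ?G = "hgraph h" and ?w = "wt (suf t h)"
  have A: "\<exists>u\<in>{1..t}. thr 0 \<le> ?w u \<and> near ?G (Suc k) v u" if "v \<in> {1..T}" for v
  proof -
    have "v \<notin> badc N U (Suc k) h" using i by simp
    moreover have "length h0 \<le> N" "v \<in> {1..length h}" using t h0 h that by auto
    ultimately have "\<exists>u\<in>{1..length h} - noncore N U h. near ?G (Suc k) v u"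
      using path_to_core[OF _ h(1)] by blast
    then obtain u where u: "u \<in> {1..T} - noncore N U h" "near ?G (Suc k) v u" using h(2) by blast
    consider "u \<le> N" | "N < u" "U \<le> wt h u" using u(1) h by (cases "u \<le> N") (auto simp: noncore_def not_less not_le)
    then show ?thesis
    proof cases
      case 1
      then show ?thesis using u ii[of u] t by auto
    next
      case 2
      then have *: "thr 0 \<le> wt (suf (max t u) h) u" using iii[of u] u(1) by force
      \<comment> \<open>A vertex born after \<open>t\<close> has weight at most \<open>2 * m\<close>
        at birth, below \<open>thr 0\<close>, so by \<open>iii\<close> it cannot be in the core at
        the final time.\<close>
      have "u \<le> t"
      proof (rule ccontr)
        assume "\<not> u \<le> t"
        then have m: "max t u = u" by simp
        have len: "length (suf u h) = u" using u(1) h by auto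
        have r: "reach (suf u h)" using reach_suf[OF h(1)] 2 t h0 by simp
        then show False
        proof (cases rule: reach.cases)
          case reach_h0
          then show False using len 2 t h0 by simp
        next
          case (reach_Cons h' x)
          have "u = length h' + 1" using len reach_Cons by simp
          moreover have "set (concat h') \<subseteq> {1..length h'}"
            using reach_valid[OF reach_Cons(2)] by (auto simp: valid_def)
          ultimately have "u \<notin> set (concat h')" by auto
          then have "count_list (concat h') u = 0" by (rule count_list_0_iff[THEN iffD2])
          then have "wt (suf u h) u = m * g + count_list x u" using reach_Cons(1) by (simp add: wt_Cons wt_def)
          moreover have "count_list x u \<le> m"
            using reach_set_K(1)[OF reach_Cons(2,3)] count_le_length[of x u] by simp
          moreover have "m * g \<le> m" using g01 by (simp add: mult_left_le)
          ultimately have "wt (suf u h) u \<le> 2 * m" by linarith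
          then show False using * small m by simp
        qed
      qed
      then show ?thesis using * u by (auto simp: max_def)
    qed
  qed
  have B: "\<exists>x\<in>{1..t}. thr j \<le> ?w x \<and> near ?G (2 * j) u x" if "u \<in> {1..t}" "thr 0 \<le> ?w u" "j \<le> J" for u j
    using that(3)
  proof (induction j)
    case 0
    then show ?case using that near_refl by auto
  next
    case (Suc j)
    then obtain x where x: "x \<in> {1..t}" "thr j \<le> ?w x" "near ?G (2 * j) u x" by auto
    then obtain y where "y \<in> {1..t}" "thr (Suc j) \<le> ?w y" "near ?G 2 x y"
      using joined_near[OF iv[of x j]] Suc.prems by auto
    then show ?case using near_trans[OF x(3), of 2 y] by auto
  qed
  have C: "\<exists>x\<in>{1..t}. thr J \<le> ?w x \<and> near ?G (Suc k + 2 * J) v x" if vT: "v \<in> {1..T}" for v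
  proof -
    obtain u where u: "u \<in> {1..t}" "thr 0 \<le> ?w u" "near ?G (Suc k) v u" using A[OF vT] by blast
    obtain x where x: "x \<in> {1..t}" "thr J \<le> ?w x" "near ?G (2 * J) u x" using B[OF u(1,2), of J] by blast
    then show ?thesis using near_trans[OF u(3) x(3)] by blast
  qed
  show ?thesis
  proof (rule diam_le)
    show "verts ?G \<noteq> {}" using h t by (auto simp: hgraph_def)
    fix a b assume "a \<in> verts ?G" "b \<in> verts ?G"
    then have ab: "a \<in> {1..T}" "b \<in> {1..T}" using h by (auto simp: hgraph_def)
    obtain x where x: "x \<in> {1..t}" "thr J \<le> ?w x" "near ?G (Suc k + 2 * J) a x" using C[OF ab(1)] by blast
    obtain y where y: "y \<in> {1..t}" "thr J \<le> ?w y" "near ?G (Suc k + 2 * J) b y" using C[OF ab(2)] by blast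
    have "near ?G 2 x y" using joined_near[OF v[OF x(1) y(1) x(2) y(2)]] by simp
    then have "near ?G (Suc k + 2 * J + 2 + (Suc k + 2 * J)) a b"
      using near_trans[OF near_trans[OF x(3)] near_sym[OF y(3)]] by blast
    then show "near ?G (2 * Suc k + 4 * J + 2) a b" by (rule near_mono) simp
  qed
qed

end

section \<open>Scales\<close>

lemma prob_UN_le:
  fixes b :: real
  assumes "finite I" "\<And>i. i \<in> I \<Longrightarrow> prob p {h. R i h} \<le> b"
  shows "prob p {h. \<exists>i\<in>I. R i h} \<le> card I * b"
proof -
  have "{h. \<exists>i\<in>I. R i h} = (\<Union>i\<in>I. {h. R i h})" by auto
  then have "prob p {h. \<exists>i\<in>I. R i h} \<le> (\<Sum>i\<in>I. prob p {h. R i h})"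
    using assms(1) by (simp add: measure_UNION_le)
  also have "\<dots> \<le> (\<Sum>i\<in>I. b)" using assms(2) by (intro sum_mono)
  finally show ?thesis by simp
qed

text \<open>\<open>\<mu>\<close> and \<open>a\<close> are the exponent \<open>g\<close> and the growth exponent \<open>1 / (1 + g)\<close> of the degrees, worsened a little.
  \<open>\<nu>\<close> is the exponent of the top layer, and vertices up to \<open>t powr \<eta>\<close> all belong to the core.
  The degree \<open>ln t powr s1\<close> defines the core at time \<open>t / 2\<close>, and \<open>ln t powr s2\<close> at the times when the periphery is explored.\<close>

locale pa_scaling = pa +
  fixes \<mu> a \<nu> \<eta> s1 s2 e kv :: real
  assumes mu: "g < \<mu>" "\<mu> < 1"
    and a: "1 / (1 + \<mu>) < a" "a * (1 + g) < 1"
    and nu: "1 / 2 < \<nu>" "\<nu> < a"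
    and kv: "kv = (m * g / (m * g + 1)) / c"
    and eta: "0 < \<eta>" "\<eta> < 1 - \<nu> / a" "\<eta> * (1 + kv) < kv"
    and e: "0 < e"
    and s12: "(1 + e) / (1 - \<mu>) < s1" "s1 < s2"
begin

definition N :: "nat \<Rightarrow> nat" where "N T = nat \<lceil>real T powr \<eta>\<rceil>"

definition half :: "nat \<Rightarrow> nat" where "half T = T div 2"

definition U1 :: "nat \<Rightarrow> real" where "U1 T = ln T powr s1"

definition U2 :: "nat \<Rightarrow> real" where "U2 T = ln T powr s2"

definition negligible :: "(nat \<Rightarrow> nat list list \<Rightarrow> bool) \<Rightarrow> bool" where
  "negligible R \<longleftrightarrow> (\<lambda>T. prob (law T) {h. R T h}) \<longlonglongrightarrow> 0"

lemma negligibleI: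
  assumes "\<forall>\<^sub>F T in sequentially. prob (law T) {h. R T h} \<le> b T" "b \<longlonglongrightarrow> 0"
  shows "negligible R"
  unfolding negligible_def
  by (rule tendsto_sandwich[OF _ assms(1) tendsto_const assms(2)]) simp

lemma negligible_disj:
  assumes "negligible R" "negligible S"
  shows "negligible (\<lambda>T h. R T h \<or> S T h)"
proof (rule negligibleI)
  have "prob (law T) {h. R T h \<or> S T h}
      \<le> prob (law T) {h. R T h} + prob (law T) {h. S T h}" for T
    using measure_Un_le[of "{h. R T h}" "law T" "{h. S T h}"] by (simp add: Collect_disj_eq)
  then show "\<forall>\<^sub>F T in sequentially. prob (law T) {h. R T h \<or> S T h}
      \<le> prob (law T) {h. R T h} + prob (law T) {h. S T h}" by simp
  show "(\<lambda>T. prob (law T) {h. R T h} + prob (law T) {h. S T h}) \<longlonglongrightarrow> 0"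
    using tendsto_add[OF assms[unfolded negligible_def]] by simp
qed

lemma negligible_mono:
  assumes "negligible S" "\<forall>\<^sub>F T in sequentially. \<forall>h. reach h \<longrightarrow> length h = T \<longrightarrow> R T h \<longrightarrow> S T h"
  shows "negligible R"
proof (rule negligibleI)
  show "\<forall>\<^sub>F T in sequentially. prob (law T) {h. R T h} \<le> prob (law T) {h. S T h}"
    using assms(2) eventually_ge_at_top[of 2]
  proof eventually_elim
    case (elim T)
    have "finite (set_pmf (law T))" unfolding law_def by (intro finite_hist reach_h0)
    then show ?case unfolding prob_eq_E
    proof (rule E_mono)
      fix h assume "h \<in> set_pmf (law T)"
      then show "of_bool (R T h) \<le> (of_bool (S T h) :: real)" using law_reach[of h T] elim by auto
    qed
  qed
qed (use assms(1) in \<open>simp add: negligible_def\<close>)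

lemma params: "0 < \<mu>" "0 < a" "a < 1" "1 / 2 < a" "\<eta> < 1" "1 < s1" "1 < s2" "0 < kv" "1 / a < 1 + \<mu>" "1 + e < s1"
  "0 < \<nu>" "\<nu> < 1"
proof -
  show mu0: "0 < \<mu>" using mu g01 by simp
  then have "1 / 2 < 1 / (1 + \<mu>)" using mu by (simp add: field_simps)
  then show a2: "1 / 2 < a" using a by simp
  then show a0: "0 < a" by simp
  have "a * 1 \<le> a * (1 + g)" using a0 g01 by (intro mult_left_mono) auto
  then show a1: "a < 1" using a by simp
  show nu0: "0 < \<nu>" "\<nu> < 1" using nu a1 by auto
  show "\<eta> < 1" using eta divide_pos_pos[OF nu0(1) a0] by simp
  have "(1 + e) * 1 \<le> (1 + e) / (1 - \<mu>)" using e mu mu0 by (simp add: field_simps)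
  then show "1 + e < s1" using s12 by simp
  then show "1 < s1" using e by simp
  then show "1 < s2" using s12 by simp
  show "0 < kv" using kv mg_pos c_gt by simp
  show "1 / a < 1 + \<mu>" using a(1) a0 mu0 by (simp add: field_simps)
qed

lemma N_bounds: "real T powr \<eta> \<le> N T" "N T \<le> real T powr \<eta> + 1"
  unfolding N_def by (auto intro: real_nat_ceiling_ge simp: of_nat_ceiling)

lemma ev_basic:
  "\<forall>\<^sub>F T in sequentially. n0 \<le> N T \<and> 2 \<le> N T \<and> N T \<le> half T \<and> half T \<le> T \<and> T \<le> 3 * half T \<and> 3 * (T - half T) \<ge> T"
proof -
  have "\<forall>\<^sub>F T::nat in sequentially. real n0 \<le> real T powr \<eta>" using eta params by real_asymp
  moreover have "\<forall>\<^sub>F T::nat in sequentially. 2 \<le> real T powr \<eta>" using eta params by real_asymp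
  moreover have "\<forall>\<^sub>F T::nat in sequentially. real T powr \<eta> + 1 \<le> T / 3" using eta params by real_asymp
  ultimately show ?thesis using eventually_ge_at_top[of 3]
  proof eventually_elim
    case (elim T)
    have "T \<le> 3 * half T" "half T \<le> T" "3 * (T - half T) \<ge> T" using elim(4) by (auto simp: half_def)
    moreover have "real (N T) \<le> half T"
      using elim(3) N_bounds[of T] \<open>T \<le> 3 * half T\<close> by linarith
    moreover have "real n0 \<le> N T" "2 \<le> real (N T)" using elim N_bounds[of T] by linarith+
    ultimately show ?case by linarith
  qed
qed

definition oldw :: "nat \<Rightarrow> nat list list \<Rightarrow> bool" where
  "oldw T h \<longleftrightarrow> (\<forall>n\<in>{N T..T}. \<forall>s\<in>{n..T}. c * n / 2 * (s / n) powr a \<le> W (suf s h) {1..n})"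

lemma neg_oldw: "negligible (\<lambda>T h. \<not> oldw T h)"
proof -
  \<comment> \<open>Half of the available room: \<open>a * (1 + \<theta>) * (1 + g)\<close> becomes
    the mean of \<open>a * (1 + g)\<close> and 1. Being below 1, it satisfies the hypothesis of
    \<open>old_weight\<close> for all large \<open>n\<close>.\<close>
  define \<theta> where "\<theta> = (1 / (a * (1 + g)) - 1) / 2"
  have ag: "0 < a * (1 + g)" using params g01 by simp
  have \<theta>: "0 < \<theta>" using a(2) ag by (simp add: \<theta>_def field_simps)
  have lt: "a * (1 + \<theta>) * (1 + g) < 1"
  proof -
    have "a * (1 + \<theta>) * (1 + g) = a * (1 + g) * (1 + \<theta>)" by simp
    also have "\<dots> = (a * (1 + g) + 1) / 2" using ag by (simp add: \<theta>_def field_simps)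
    finally show ?thesis using a(2) by simp
  qed
  define d where "d = a * (1 + \<theta>) * (1 + g)"
  obtain n0 :: nat where n0: "d / (1 - d) \<le> n0" using real_arch_simple by blast
  define k where "k = \<theta> * c / 2"
  have k: "0 < k" using \<theta> c_gt by (simp add: k_def)
  show ?thesis
  proof (rule negligibleI)
    show "\<forall>\<^sub>F T in sequentially. prob (law T) {h. \<not> oldw T h} \<le> (real T + 1) * exp (- (k * real T powr \<eta>))"
      using ev_basic[of n0]
    proof eventually_elim
      case (elim T)
      have "{h. \<not> oldw T h} = {h. \<exists>n\<in>{N T..T}. \<exists>s\<in>{n..T}. W (suf s h) {1..n} < c * n / 2 * (s / n) powr a}"
        by (auto simp: oldw_def not_le)
      also have "prob (law T) \<dots> \<le> card {N T..T} * exp (- (k * real T powr \<eta>))"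
      proof (rule prob_UN_le)
        fix n assume n: "n \<in> {N T..T}"
        have "d / (1 - d) \<le> n" using n0 n elim by (auto intro: order_trans)
        then have "d \<le> n * (1 - d)" using lt by (simp add: d_def divide_le_eq)
        then have d: "d * (real n + 1) \<le> n" by (simp add: algebra_simps)
        have "prob (law T) {h. \<exists>s\<in>{n..T}. W (suf s h) {1..n} < c * n / 2 * (s / n) powr a}
            \<le> exp (- (\<theta> * c * n / 2))"
          using params \<theta> d n elim by (intro old_weight) (auto simp: d_def)
        also have "\<dots> \<le> exp (- (k * real T powr \<eta>))"
        proof -
          have "real T powr \<eta> \<le> n" using N_bounds(1)[of T] n by (auto intro: order_trans)
          then have "k * real T powr \<eta> \<le> k * n" using k by (intro mult_left_mono) auto
          then show ?thesis by (simp add: k_def)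
        qed
        finally show "prob (law T) {h. \<exists>s\<in>{n..T}. W (suf s h) {1..n} < c * n / 2 * (s / n) powr a}
          \<le> exp (- (k * real T powr \<eta>))" .
      qed simp
      also have "\<dots> \<le> (real T + 1) * exp (- (k * real T powr \<eta>))"
        by (intro mult_right_mono) (auto simp: of_nat_diff)
      finally show ?case .
    qed
    show "(\<lambda>T. (real T + 1) * exp (- (k * real T powr \<eta>))) \<longlonglongrightarrow> 0"
      using k eta by real_asymp
  qed
qed

text \<open>A union over about \<open>T powr \<eta>\<close> vertices against a probability of order
  \<open>T powr ((\<eta> - 1) * kv)\<close> each, up to a power of \<open>ln T\<close>; the
  condition \<open>\<eta> * (1 + kv) < kv\<close> makes the product vanish.\<close>

lemma neg_old_vertex: "negligible (\<lambda>T h. \<exists>v\<in>{1..N T}. wt (suf (half T) h) v < U1 T)"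
proof (rule negligibleI)
  define e' where "e' = kv - \<eta> * (1 + kv)"
  have e': "0 < e'" using eta by (simp add: e'_def)
  define C where "C = 2 / (m * g) * 9 powr kv"
  show "\<forall>\<^sub>F T in sequentially. prob (law T) {h. \<exists>v\<in>{1..N T}. wt (suf (half T) h) v < U1 T}
      \<le> C * ln (real T) powr s1 * real T powr (- e')"
    using ev_basic[of 2] eventually_ge_at_top[of 3]
  proof eventually_elim
    case (elim T)
    have T: "1 \<le> real T powr \<eta>" using elim eta by (intro ge_one_powr_ge_zero) auto
    have "0 < ln (real T)" using elim by simp
    then have U: "0 < U1 T" by (simp add: U1_def)
    have "prob (law T) {h. \<exists>v\<in>{1..N T}. wt (suf (half T) h) v < U1 T}
      \<le> card {1..N T} * (U1 T / (m * g) * ((N T + 1) / (half T + 1)) powr kv)"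
      by (intro prob_UN_le old_vertex kv U) (use elim in auto)
    also have "\<dots> = real (N T) * (U1 T / (m * g) * ((N T + 1) / (half T + 1)) powr kv)" by simp
    also have "\<dots> \<le> (2 * real T powr \<eta>) * (U1 T / (m * g) * (9 * real T powr (\<eta> - 1)) powr kv)"
    proof (intro mult_mono powr_mono2)
      show "real (N T) \<le> 2 * real T powr \<eta>" using N_bounds(2)[of T] T by linarith
      have "(N T + 1) / (half T + 1) \<le> (3 * real T powr \<eta>) / (T / 3)"
        using N_bounds(2)[of T] T elim by (intro frac_le) linarith+
      also have "\<dots> = 9 * real T powr (\<eta> - 1)" using elim by (simp add: powr_diff)
      finally show "(N T + 1) / (half T + 1) \<le> 9 * real T powr (\<eta> - 1)" by simp
    qed (use U mg_pos params in auto)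
    also have "\<dots> = C * U1 T * (real T powr \<eta> * real T powr ((\<eta> - 1) * kv))"
      by (simp add: C_def powr_mult powr_powr)
    also have "real T powr \<eta> * real T powr ((\<eta> - 1) * kv) = real T powr (- e')"
      by (simp add: e'_def algebra_simps flip: powr_add)
    finally show ?case by (simp add: U1_def)
  qed
  show "(\<lambda>T. C * ln (real T) powr s1 * real T powr (- e')) \<longlonglongrightarrow> 0"
    using e' params by real_asymp
qed

text \<open>\<open>s2 > s1\<close> lets \<open>U2 T\<close> dominate \<open>U1 T\<close>, and
  \<open>s2 > 1\<close> lets it beat the union over \<open>T\<close> vertices. A vertex born after
  \<open>half T\<close> is observed from its birth, hence the maximum.\<close>

lemma neg_young_vertex:
  "negligible (\<lambda>T h. \<exists>v\<in>{1..T}. wt (suf (max (half T) v) h) v < U1 T \<and> U2 T \<le> wt h v)"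
proof (rule negligibleI)
  define k where "k = exp (- (6 * (1 + 3 / g)))"
  have k: "0 < k" by (simp add: k_def)
  show "\<forall>\<^sub>F T in sequentially. prob (law T)
      {h. \<exists>v\<in>{1..T}. wt (suf (max (half T) v) h) v < U1 T \<and> U2 T \<le> wt h v}
     \<le> real T * exp (ln (real T) powr s1 - k * ln (real T) powr s2)"
    using ev_basic[of 2]
  proof eventually_elim
    case (elim T)
    have "prob (law T) {h. \<exists>v\<in>{1..T}. wt (suf (max (half T) v) h) v < U1 T \<and> U2 T \<le> wt h v}
      \<le> card {1..T} * exp (U1 T - exp (- (6 * (1 + 3 / g))) * U2 T)"
      by (intro prob_UN_le young_vertex[of "half T"]) (use elim in auto)
    then show ?case by (simp add: U1_def U2_def k_def)
  qed
  show "(\<lambda>T. real T * exp (ln (real T) powr s1 - k * ln (real T) powr s2)) \<longlonglongrightarrow> 0"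
    using k params s12 by real_asymp
qed

text \<open>With this product of weights \<open>connector\<close> fails with probability at most
  \<open>exp (- (k * ln T powr (1 + e)))\<close>, which is smaller than every power of
  \<open>1 / T\<close> and survives the union bound.\<close>

definition w0 :: "nat \<Rightarrow> real" where "w0 T = half T * ln T powr (1 + e)"

definition missed :: "nat \<Rightarrow> nat list list \<Rightarrow> nat \<Rightarrow> nat set \<Rightarrow> bool" where
  "missed T h i A \<longleftrightarrow> A \<subseteq> {1..half T} \<and> w0 T \<le> wt (suf (half T) h) i * W (suf (half T) h) A \<and> \<not> joined (half T) h i A"

lemma neg_missed:
  assumes "\<forall>\<^sub>F T in sequentially. J T \<le> T"
  shows "negligible (\<lambda>T h. \<exists>i\<in>{1..half T}. \<exists>j\<in>{..<J T + half T}. missed T h i (F T j (suf (half T) h)))"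
proof (rule negligibleI)
  define k where "k = 1 / (9 * c\<^sup>2)"
  have k: "0 < k" using c_gt by (simp add: k_def)
  show "\<forall>\<^sub>F T in sequentially. prob (law T)
      {h. \<exists>i\<in>{1..half T}. \<exists>j\<in>{..<J T + half T}. missed T h i (F T j (suf (half T) h))}
     \<le> 2 * real T ^ 2 * exp (- (k * ln T powr (1 + e)))"
    using ev_basic[of 2] assms eventually_ge_at_top[of 3]
  proof eventually_elim
    case (elim T)
    let ?t = "half T" and ?p = "exp (- (w0 T * (T - half T) / (c * T)\<^sup>2))"
    have w0: "0 \<le> w0 T" by (simp add: w0_def)
    have "prob (law T) {h. \<exists>i\<in>{1..?t}. \<exists>j\<in>{..<J T + ?t}. missed T h i (F T j (suf ?t h))}
      \<le> card {1..?t} * (card {..<J T + ?t} * ?p)"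
      unfolding missed_def by (intro prob_UN_le connector w0) (use elim in auto)
    also have "\<dots> \<le> T * (2 * T * exp (- (k * ln T powr (1 + e))))"
    proof (intro mult_mono)
      have "k * ln T powr (1 + e) = (T / 3) * ln T powr (1 + e) * (T / 3) / (c * T)\<^sup>2"
        using elim c_gt by (simp add: k_def power2_eq_square)
      also have "\<dots> \<le> w0 T * (T - half T) / (c * T)\<^sup>2"
        unfolding w0_def using elim by (intro divide_right_mono mult_mono) (auto simp: of_nat_diff)
      finally show "?p \<le> exp (- (k * ln T powr (1 + e)))" by simp
    qed (use elim in auto)
    finally show ?case by (simp add: power2_eq_square mult_ac)
  qed
  show "(\<lambda>T::nat. 2 * real T ^ 2 * exp (- (k * ln T powr (1 + e)))) \<longlonglongrightarrow> 0"
    using k e by real_asymp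
qed

section \<open>Exploring the periphery\<close>

text \<open>At a time \<open>s\<close> with \<open>(s / n) powr a \<ge> 2 * u\<close> the oldest
  \<open>n\<close> vertices carry at least \<open>c * n * u \<ge> 2 * n * u\<close> by
  \<open>oldw\<close>, and those among them of weight below \<open>u\<close> account for at most
  \<open>n * u\<close>.\<close>

lemma good_weight:
  assumes "oldw T h" "n \<in> {N T..T}" "s \<in> {n..T}" "0 < n" "0 < u" "n * (2 * u) powr (1 / a) \<le> s"
  shows "n * u \<le> W (suf s h) {x\<in>{1..n}. u \<le> wt (suf s h) x}"
proof -
  let ?w = "wt (suf s h)" and ?W = "W (suf s h)"
  have "(2 * u) powr (1 / a) \<le> s / n" using assms(4,6) by (simp add: field_simps)
  then have "((2 * u) powr (1 / a)) powr a \<le> (s / n) powr a" using params by (intro powr_mono2) auto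
  then have 1: "2 * u \<le> (s / n) powr a" using assms(5) params by (simp add: powr_powr)
  have "2 * (n * u) \<le> c * (n * u)" using c_gt assms(5) by (intro mult_right_mono) auto
  also have "\<dots> = c * n / 2 * (2 * u)" by simp
  also have "\<dots> \<le> c * n / 2 * (s / n) powr a" using 1 c_gt by (intro mult_left_mono) auto
  also have "\<dots> \<le> ?W {1..n}" using assms by (auto simp: oldw_def)
  also have "\<dots> = ?W ({x\<in>{1..n}. u \<le> ?w x} \<union> {x\<in>{1..n}. \<not> u \<le> ?w x})"
    by (intro arg_cong[where f = ?W]) auto
  also have "\<dots> = ?W {x\<in>{1..n}. u \<le> ?w x} + ?W {x\<in>{1..n}. \<not> u \<le> ?w x}"
    by (intro W_Un) auto
  also have "?W {x\<in>{1..n}. \<not> u \<le> ?w x} \<le> card {x\<in>{1..n}. \<not> u \<le> ?w x} * u"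
    unfolding W_def by (intro sum_bounded_above) auto
  also have "\<dots> \<le> n * u"
  proof (intro mult_right_mono)
    have "card {x\<in>{1..n}. \<not> u \<le> ?w x} \<le> card {1..n}" by (intro card_mono) auto
    then show "real (card {x\<in>{1..n}. \<not> u \<le> ?w x}) \<le> n" by simp
  qed (use assms(5) in simp)
  finally show ?thesis by (simp add: mult.commute)
qed

text \<open>Both inequalities rest on \<open>1 / a < 1 + \<mu>\<close>, which lets powers of
  \<open>u\<close> absorb the constants.\<close>

lemma ev_large_u:
  "\<forall>\<^sub>F u in at_top. 1 \<le> u \<and> 4 * c * (2 * u) powr (1 / a) \<le> u powr (1 + \<mu>) \<and> 4 * (2 * u) powr (1 / a - 1) \<le> u powr \<mu>"
proof -
  define p where "p = 1 / a"
  have p: "1 < p" "p < 1 + \<mu>" using params by (auto simp: p_def)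
  have c0: "0 < c" by (rule c_gt)
  have "\<forall>\<^sub>F u in at_top. 4 * c * (2 * u) powr p \<le> u powr (1 + \<mu>)" using p c0 by real_asymp
  moreover have "\<forall>\<^sub>F u in at_top. 4 * (2 * u) powr (p - 1) \<le> u powr \<mu>" using p params by real_asymp
  ultimately show ?thesis using eventually_ge_at_top[of 1] unfolding p_def by eventually_elim auto
qed

lemma U2_at_top: "filterlim U2 at_top sequentially"
  unfolding U2_def using params by real_asymp

text \<open>The core carries a fraction of at least \<open>2 * U2 T powr (- \<mu>)\<close>, and half
  of it is spent on \<open>3 * m\<close>. For late \<open>s\<close> this is
  \<open>good_weight\<close> with \<open>n\<close> about \<open>s / R\<close>; when that
  \<open>n\<close> is below \<open>N T\<close>, the first \<open>N T\<close> vertices, which all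
  belong to the core, are heavy enough by themselves.\<close>

lemma ev_start:
  "\<forall>\<^sub>F T in sequentially. \<forall>h. reach h \<longrightarrow> length h = T \<longrightarrow> oldw T h \<longrightarrow>
    (\<forall>s\<in>{N T..T}. W (suf s h) (noncore (N T) (U2 T) (suf s h)) + 3 * m \<le> (1 - U2 T powr (- \<mu>)) * c * s)"
proof -
  have "\<forall>\<^sub>F T::nat in sequentially. 3 * m * (ln (real T) powr s2) powr \<mu> \<le> T powr \<eta>"
    using m2 params eta by real_asymp
  then show ?thesis
    using ev_basic[of 2] eventually_compose_filterlim[OF ev_large_u U2_at_top]
  proof eventually_elim
    case (elim T)
    let ?u = "U2 T" and ?N = "N T"
    define R where "R = (2 * ?u) powr (1 / a)"
    have u: "1 \<le> ?u" using elim by simp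
    have R1: "1 \<le> R" unfolding R_def using u params by (intro ge_one_powr_ge_zero) auto
    show ?case
    proof (intro allI impI ballI)
      fix h s assume h: "reach h" "length h = T" "oldw T h" and s: "s \<in> {?N..T}"
      let ?S = "suf s h" and ?C = "{1..s} - noncore ?N ?u (suf s h)"
      have ls: "length ?S = s" using s h by simp
      have s0: "0 < real s" "2 \<le> s" using s elim by auto
      have v: "valid ?S" using reach_valid[OF reach_suf[OF h(1)]] s0 h0 by auto
      have main: "2 * ?u powr (- \<mu>) * c * s \<le> W ?S ?C"
      proof (cases "nat \<lfloor>s / R\<rfloor> \<ge> ?N")
        case True
        define n where "n = nat \<lfloor>s / R\<rfloor>"
        have n2: "2 \<le> n" "?N \<le> n" using True elim by (auto simp: n_def)
        have nR: "real n \<le> s / R" "s / R - 1 < n" using s0 R1 by (auto simp: n_def)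
        then have nRs: "n * R \<le> s" using R1 by (simp add: field_simps)
        have "real n * 1 \<le> real n * R" using R1 by (intro mult_left_mono) auto
        then have ns: "n \<le> s" using nRs by linarith
        have "s / (2 * R) \<le> n" using nR n2 by simp
        have "?u * (?u powr \<mu>) = ?u powr (1 + \<mu>)" using u by (simp add: powr_add)
        then have "4 * c * R \<le> ?u * (?u powr \<mu>)" using elim by (simp add: R_def)
        then have "2 * ?u powr (- \<mu>) * c \<le> ?u / (2 * R)"
          using R1 u by (simp add: powr_minus field_simps)
        then have "2 * ?u powr (- \<mu>) * c * s \<le> ?u / (2 * R) * s" using s0 by (intro mult_right_mono) auto
        also have "\<dots> = s / (2 * R) * ?u" by simp
        also have "\<dots> \<le> n * ?u" using \<open>s / (2 * R) \<le> n\<close> u by (intro mult_right_mono) auto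
        also have "\<dots> \<le> W ?S {x\<in>{1..n}. ?u \<le> wt ?S x}"
          using n2 ns s u nRs unfolding R_def by (intro good_weight[OF h(3)]) auto
        also have "\<dots> \<le> W ?S ?C" using ns by (intro W_mono) (auto simp: noncore_def)
        finally show ?thesis .
      next
        case False
        have N0: "0 < real ?N" using elim by simp
        have "s / R < ?N"
        proof -
          have "nat \<lfloor>s / R\<rfloor> < ?N" using False by simp
          then have "\<lfloor>s / R\<rfloor> < int ?N" using N0 by linarith
          then show ?thesis by (simp add: floor_less_iff)
        qed
        then have sN: "s / ?N \<le> R" using R1 N0 by (simp add: field_simps)
        have "4 * ?u powr (- \<mu>) \<le> R powr (a - 1)"
        proof -
          have "R powr (a - 1) = (2 * ?u) powr (- (1 / a - 1))"
          proof -
            have "1 / a * (a - 1) = - (1 / a - 1)" using params by (simp add: right_diff_distrib)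
            then show ?thesis by (simp only: R_def powr_powr)
          qed
          also have "\<dots> = 1 / (2 * ?u) powr (1 / a - 1)" by (rule powr_minus_divide)
          also have "\<dots> \<ge> 4 / ?u powr \<mu>" using elim u by (simp add: field_simps)
          finally show ?thesis by (simp add: powr_minus_divide)
        qed
        also have "\<dots> \<le> (s / ?N) powr (a - 1)"
          using sN s0 N0 params by (intro powr_mono2') auto
        finally have "c * s / 2 * (4 * ?u powr (- \<mu>)) \<le> c * s / 2 * (s / ?N) powr (a - 1)"
          using c_gt by (intro mult_left_mono) auto
        also have "\<dots> = c * ?N / 2 * ((s / ?N) * (s / ?N) powr (a - 1))" using N0 by simp
        also have "(s / ?N) * (s / ?N) powr (a - 1) = (s / ?N) powr a"
          using s0 N0 by (simp add: powr_diff)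
        also have "c * ?N / 2 * (s / ?N) powr a \<le> W ?S {1..?N}"
          using h(3) s elim by (auto simp: oldw_def)
        also have "\<dots> \<le> W ?S ?C" using s by (intro W_mono) (auto simp: noncore_def)
        finally show ?thesis by (simp add: mult_ac)
      qed
      have "W ?S ({1..s} - noncore ?N ?u ?S) + W ?S (noncore ?N ?u ?S) = W ?S {1..s}"
        by (subst W_Un[symmetric]) (auto intro!: arg_cong[where f = "W ?S"] simp: noncore_def ls)
      also have "\<dots> = c * s" using W_total[OF v] ls by simp
      finally have tot: "W ?S ?C + W ?S (noncore ?N ?u ?S) = c * s" .
      have "3 * m * ?u powr \<mu> \<le> s"
        using elim(1) N_bounds(1)[of T] s by (simp add: U2_def)
      then have "3 * m \<le> ?u powr (- \<mu>) * s" using u by (simp add: powr_minus field_simps)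
      also have "\<dots> * 1 \<le> \<dots> * c" using c_gt by (intro mult_left_mono) auto
      finally have "3 * m \<le> ?u powr (- \<mu>) * s * c" by simp
      then show "W ?S (noncore ?N ?u ?S) + 3 * m \<le> (1 - ?u powr (- \<mu>)) * c * s"
        using tot main by (simp add: algebra_simps)
    qed
  qed
qed

text \<open>The exponent used in the recursion instead of \<open>m\<close>: the gap absorbs the
  additive error, turning \<open>\<beta> ^ m + 2 * \<epsilon>\<close> into at most
  \<open>\<beta> powr mm\<close>. The price is \<open>ln mm = 2 / 3 * ln m\<close>.\<close>

definition mm :: real where "mm = m powr (2 / 3)"

lemma mm: "1 < mm" "mm \<le> m - 1 / 4"
proof -
  show "1 < mm" unfolding mm_def using m2 by (intro gr_one_powr) auto
  \<comment> \<open>\<open>2 powr (- (1 / 3)) \<le> 7 / 8\<close> amounts to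
    \<open>1 / 2 \<le> (7 / 8) ^ 3\<close>; then \<open>m * (7 / 8) \<le> m - 1 / 4\<close> because
    \<open>m \<ge> 2\<close>.\<close>
  have "(1 / 2 :: real) powr (1 / 3) \<le> ((7 / 8) ^ 3) powr (1 / 3)" by (intro powr_mono2) (auto simp: power3_eq_cube)
  also have "((7 / 8 :: real) ^ 3) powr (1 / 3) = 7 / 8" by (simp add: powr_powr flip: powr_numeral)
  finally have "(2 :: real) powr (- (1 / 3)) \<le> 7 / 8" by (simp add: powr_minus powr_divide inverse_eq_divide)
  moreover have "real m powr (- (1 / 3)) \<le> 2 powr (- (1 / 3))" using m2 by (intro powr_mono2') auto
  ultimately have "real m * real m powr (- (1 / 3)) \<le> m * (7 / 8)" by (intro mult_left_mono) auto
  moreover have "mm = real m * real m powr (- (1 / 3))"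
    using m2 powr_add[of "real m" 1 "- (1 / 3)"] by (simp add: mm_def)
  moreover have "2 \<le> real m" using m2 by simp
  ultimately show "mm \<le> m - 1 / 4" by linarith
qed

text \<open>The number of extra steps, independent of \<open>T\<close>, in which the exponent
  \<open>gam\<close> grows by the factor \<open>4 / 3\<close> up to \<open>gam r0 = 2 / 3\<close>.
  The start \<open>gam 0\<close> is so small that \<open>\<rho> T ^ m\<close> still exceeds the
  concentration error \<open>N T powr (- (1 / 4))\<close>, even after multiplication by
  \<open>q T / 8\<close>.\<close>

definition r0 :: nat where "r0 = (SOME r. (2 / 3) * (3 / 4 :: real) ^ r \<le> \<eta> / (8 * m))"

definition gam :: "nat \<Rightarrow> real" where "gam j = (2 / 3) * (3 / 4) ^ (r0 - j)"

lemma gam_0: "gam 0 \<le> \<eta> / (8 * m)"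
proof -
  have "(\<lambda>r. (2 / 3) * (3 / 4 :: real) ^ r) \<longlonglongrightarrow> (2 / 3) * 0"
    by (intro tendsto_mult tendsto_const LIMSEQ_power_zero) auto
  moreover have "0 < \<eta> / (8 * m)" using eta m2 by simp
  ultimately have "\<forall>\<^sub>F r in sequentially. (2 / 3) * (3 / 4 :: real) ^ r < \<eta> / (8 * m)"
    by (intro order_tendstoD) auto
  then obtain r where "(2 / 3) * (3 / 4 :: real) ^ r \<le> \<eta> / (8 * m)"
    by (meson eventually_sequentially less_imp_le order_refl)
  then show ?thesis unfolding gam_def r0_def diff_zero by (rule someI)
qed

lemma gam_pos: "0 < gam j" by (simp add: gam_def)

definition q :: "nat \<Rightarrow> real" where "q T = U2 T powr (- \<mu>)"

definition \<rho> :: "nat \<Rightarrow> real" where "\<rho> T = T powr (- gam 0)"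

text \<open>The bound \<open>1 - q T\<close> of \<open>ev_start\<close>, raised to the power
  \<open>mm\<close> in each step and cut off at \<open>\<rho> T\<close>, so that the error of
  \<open>phase_A\<close> never dominates.\<close>

definition \<beta> :: "nat \<Rightarrow> nat \<Rightarrow> real" where "\<beta> T k = max ((1 - q T) powr (mm ^ k)) (\<rho> T)"

definition LB :: "nat \<Rightarrow> nat \<Rightarrow> nat list list \<Rightarrow> bool" where
  "LB T k h \<longleftrightarrow> (\<forall>s\<in>{N T..T}. W (suf s h) (badc (N T) (U2 T) k (suf s h)) + 3 * m \<le> \<beta> T k * c * s)"

text \<open>The first \<open>k\<close> with \<open>q T * mm ^ k \<ge> gam 0 * ln T\<close>, when
  nonnegative; then \<open>(1 - q T) powr (mm ^ k) \<le> exp (- (gam 0 * ln T)) = \<rho>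
  T\<close>.\<close>

definition kA :: "nat \<Rightarrow> nat" where "kA T = nat \<lceil>ln (gam 0 * ln T * U2 T powr \<mu>) / ln mm\<rceil>"

text \<open>For \<open>x = \<beta> T k\<close>, the gap \<open>x powr mm - x ^ m\<close> is
  \<open>x powr mm * (1 - x powr (m - mm))\<close>. The first factor is at least
  \<open>\<rho> T ^ m\<close>; the second is at least \<open>q T / 4\<close> because
  \<open>m - mm \<ge> 1 / 4\<close> and \<open>x \<le> 1 - q T\<close>.\<close>

lemma beta_step:
  assumes "0 < q T" "q T \<le> 1 / 2" "0 < \<rho> T" "\<rho> T \<le> 1 - q T" "8 * \<epsilon> \<le> \<rho> T ^ m * q T"
  shows "\<beta> T k ^ m + 2 * \<epsilon> \<le> \<beta> T (Suc k)" "0 < \<beta> T k" "\<beta> T k \<le> 1 - q T"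
proof -
  let ?x = "\<beta> T k"
  have mk: "1 \<le> mm ^ k" using mm by simp
  have "(1 - q T) powr (mm ^ k) \<le> (1 - q T) powr 1" using assms mk by (intro powr_mono') auto
  then show le: "?x \<le> 1 - q T" using assms by (simp add: \<beta>_def)
  show x0: "0 < ?x" using assms by (simp add: \<beta>_def)
  have x1: "?x \<le> 1" using le assms by simp
  have "?x powr mm \<le> \<beta> T (Suc k)"
  proof (cases "(1 - q T) powr (mm ^ k) \<le> \<rho> T")
    case True
    then have "?x powr mm = \<rho> T powr mm" by (simp add: \<beta>_def)
    also have "\<dots> \<le> \<rho> T powr 1" using assms mm by (intro powr_mono') auto
    also have "\<dots> \<le> \<beta> T (Suc k)" using assms by (simp add: \<beta>_def)
    finally show ?thesis .
  next
    case False
    then have "?x powr mm = (1 - q T) powr (mm ^ Suc k)" by (simp add: \<beta>_def powr_powr mult.commute)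
    then show ?thesis by (simp add: \<beta>_def)
  qed
  moreover have "?x ^ m + 2 * \<epsilon> \<le> ?x powr mm"
  proof -
    have "?x powr (real m - mm) \<le> ?x powr (1 / 4)" using x0 x1 mm by (intro powr_mono') auto
    also have "\<dots> \<le> (1 + - q T) powr (1 / 4)" using le x0 by (intro powr_mono2) auto
    also have "\<dots> \<le> 1 + 1 / 4 * (- q T)" using assms by (intro powr_le_affine) auto
    finally have 1: "q T / 4 \<le> 1 - ?x powr (real m - mm)" by simp
    have "\<rho> T ^ m \<le> ?x ^ m" using assms by (intro power_mono) (auto simp: \<beta>_def)
    also have "\<dots> = ?x powr m" using x0 by (simp add: powr_realpow)
    also have "\<dots> \<le> ?x powr mm" using x0 x1 mm by (intro powr_mono') auto
    finally have 2: "\<rho> T ^ m \<le> ?x powr mm" .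
    have "2 * \<epsilon> \<le> \<rho> T ^ m * (q T / 4)" using assms by simp
    also have "\<dots> \<le> ?x powr mm * (1 - ?x powr (real m - mm))"
      using 1 2 assms by (intro mult_mono) auto
    also have "\<dots> = ?x powr mm - ?x ^ m" using x0 by (simp add: right_diff_distrib powr_realpow flip: powr_add)
    finally show ?thesis by simp
  qed
  ultimately show "?x ^ m + 2 * \<epsilon> \<le> \<beta> T (Suc k)" by simp
qed

lemma ev_q:
  "\<forall>\<^sub>F T in sequentially. 0 < q T \<and> q T \<le> 1 / 2 \<and> 0 < \<rho> T \<and> \<rho> T \<le> 1 - q T \<and> 8 * N T powr (- (1 / 4)) \<le> \<rho> T ^ m * q T"
proof -
  have g0: "0 < gam 0" by (rule gam_pos)
  have "\<forall>\<^sub>F T::nat in sequentially. 0 < ((ln (real T) powr s2) powr (- \<mu>))" using params by real_asymp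
  moreover have "\<forall>\<^sub>F T::nat in sequentially. ((ln (real T) powr s2) powr (- \<mu>)) \<le> 1 / 2" using params by real_asymp
  moreover have "\<forall>\<^sub>F T::nat in sequentially. real T powr (- gam 0) \<le> 1 / 2" using g0 by real_asymp
  moreover have "\<forall>\<^sub>F T::nat in sequentially. 8 * real T powr (- (\<eta> / 4)) \<le> real T powr (- (\<eta> / 8)) * (ln (real T) powr s2) powr (- \<mu>)"
    using params eta by real_asymp
  ultimately show ?thesis using eventually_ge_at_top[of 2]
  proof eventually_elim
    case (elim T)
    have "8 * real (N T) powr (- (1 / 4)) \<le> 8 * (real T powr \<eta>) powr (- (1 / 4))"
      using N_bounds(1)[of T] elim by (intro mult_left_mono powr_mono2') auto
    also have "\<dots> = 8 * real T powr (- (\<eta> / 4))" by (simp add: powr_powr)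
    also have "\<dots> \<le> real T powr (- (\<eta> / 8)) * q T" using elim by (simp add: q_def U2_def)
    also have "\<dots> \<le> \<rho> T ^ m * q T"
    proof (intro mult_right_mono)
      have "gam 0 * m \<le> \<eta> / 8" using gam_0 m2 by (simp add: field_simps)
      then have "real T powr (- (\<eta> / 8)) \<le> real T powr (- gam 0 * m)" using elim by (intro powr_mono) auto
      also have "\<dots> = \<rho> T ^ m" using elim by (simp add: \<rho>_def powr_powr flip: powr_realpow)
      finally show "real T powr (- (\<eta> / 8)) \<le> \<rho> T ^ m" .
    qed (simp add: q_def)
    finally show ?case using elim by (auto simp: q_def U2_def \<rho>_def)
  qed
qed

lemma ev_kA: "\<forall>\<^sub>F T in sequentially. kA T \<le> T"
proof -
  define gg lm where "gg = gam 0" and "lm = ln mm"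
  have g0: "0 < gg" "0 < lm" using gam_pos mm by (auto simp: gg_def lm_def)
  have "\<forall>\<^sub>F T::nat in sequentially. ln (gg * ln (real T) * (ln (real T) powr s2) powr \<mu>) / lm \<le> real T" using g0 params by real_asymp
  then show ?thesis by eventually_elim (simp add: kA_def U2_def ceiling_le_iff gg_def lm_def)
qed

lemma neg_phase_A: "negligible (\<lambda>T h. \<exists>k\<in>{..<kA T}. LB T k h \<and> \<not> LB T (Suc k) h)"
proof (rule negligibleI)
  define kk where "kk = g / (2 * (1 + g))"
  have kk: "0 < kk" "kk \<le> 1" using g01 by (auto simp: kk_def divide_le_eq)
  define C where "C = kk / (2 * m * (c + 1))"
  have C: "0 < C" using kk m2 c_gt by (simp add: C_def)
  have "\<forall>\<^sub>F T::nat in sequentially. 3 * m \<le> kk * (real T powr \<eta>) powr (3 / 4)" using kk eta by real_asymp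
  then show "\<forall>\<^sub>F T in sequentially. prob (law T) {h. \<exists>k\<in>{..<kA T}. LB T k h \<and> \<not> LB T (Suc k) h}
     \<le> real T * exp (- (C * real T powr (\<eta> / 2)))"
    using ev_basic[of 2] ev_q ev_kA
  proof eventually_elim
    case (elim T)
    let ?N = "N T"
    \<comment> \<open>With this power \<open>\<epsilon>\<close> is polynomially small, while
      \<open>\<epsilon> * (\<epsilon> * N)\<close> in the exponent of \<open>phase_A\<close> still
      has size \<open>N powr (1 / 2)\<close>.\<close>
    define \<epsilon> where "\<epsilon> = real ?N powr (- (1 / 4))"
    have N0: "2 \<le> ?N" using elim by simp
    have \<epsilon>: "0 < \<epsilon>" "\<epsilon> \<le> 1"
      using N0 by (auto simp: \<epsilon>_def powr_minus inverse_le_1_iff intro!: ge_one_powr_ge_zero)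
    have \<epsilon>N: "\<epsilon> * ?N = real ?N powr (3 / 4)" "\<epsilon> * (\<epsilon> * ?N) = real ?N powr (1 / 2)"
      using N0 by (auto simp: \<epsilon>_def powr_mult_base mult.commute simp flip: powr_add)
    have cond: "3 * m \<le> \<epsilon> * kk * ?N"
    proof -
      have "(real T powr \<eta>) powr (3 / 4) \<le> \<epsilon> * ?N"
        unfolding \<epsilon>N using N_bounds(1)[of T] by (intro powr_mono2) auto
      then have "kk * (real T powr \<eta>) powr (3 / 4) \<le> kk * (\<epsilon> * ?N)" using kk by (intro mult_left_mono) auto
      then show ?thesis using elim(1) by (simp add: mult_ac)
    qed
    have b: "\<beta> T k ^ m + 2 * \<epsilon> \<le> \<beta> T (Suc k)" "0 < \<beta> T k" "\<beta> T k \<le> 1 - q T" for k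
      using beta_step[of T \<epsilon> k] elim by (auto simp: \<epsilon>_def)
    have "prob (law T) {h. \<exists>k\<in>{..<kA T}. LB T k h \<and> \<not> LB T (Suc k) h}
      \<le> card {..<kA T} * exp (- (C * real T powr (\<eta> / 2)))"
    proof (rule prob_UN_le)
      fix k assume "k \<in> {..<kA T}"
      let ?F = "badc ?N (U2 T) k"
      have sub: "LB T k h \<and> \<not> LB T (Suc k) h \<Longrightarrow>
        (\<exists>s\<in>{?N..T}. (c * \<beta> T k ^ m + \<epsilon>) * s < W (suf s h) (newbad ?N ?F (suf s h))) \<and>
        (\<forall>s\<in>{?N..T}. W (suf s h) (?F (suf s h)) + 3 * m \<le> \<beta> T k * c * s)" for h
      proof -
        assume *: "LB T k h \<and> \<not> LB T (Suc k) h"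
        then obtain s where s: "s \<in> {?N..T}"
          "\<beta> T (Suc k) * c * s < W (suf s h) (badc ?N (U2 T) (Suc k) (suf s h)) + 3 * m"
          by (auto simp: LB_def not_le)
        \<comment> \<open>The additive \<open>2 * \<epsilon>\<close> of \<open>beta_step\<close>
          covers both the excess \<open>\<epsilon>\<close> in \<open>phase_A\<close> and the slack
          \<open>3 * m\<close>.\<close>
        have "\<epsilon> * kk * ?N \<le> \<epsilon> * 1 * s" using s(1) \<epsilon> kk by (intro mult_mono) auto
        then have "3 * m \<le> \<epsilon> * s" using cond by simp
        moreover have "\<epsilon> * s * 2 \<le> \<epsilon> * s * c" using c_gt \<epsilon> by (intro mult_left_mono) auto
        moreover have "(\<beta> T k ^ m + 2 * \<epsilon>) * (c * s) \<le> \<beta> T (Suc k) * (c * s)"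
          using b(1) c_gt by (intro mult_right_mono) auto
        moreover have "W (suf s h) (badc ?N (U2 T) (Suc k) (suf s h)) \<le> W (suf s h) (newbad ?N ?F (suf s h))"
          by (intro W_mono) auto
        ultimately have "(c * \<beta> T k ^ m + \<epsilon>) * s < W (suf s h) (newbad ?N ?F (suf s h))"
          using s(2) by (simp add: algebra_simps)
        then show ?thesis using s(1) * by (auto simp: LB_def)
      qed
      have "prob (law T) {h. LB T k h \<and> \<not> LB T (Suc k) h} \<le> prob (law T) {h.
        (\<exists>s\<in>{?N..T}. (c * \<beta> T k ^ m + \<epsilon>) * s < W (suf s h) (newbad ?N ?F (suf s h))) \<and>
        (\<forall>s\<in>{?N..T}. W (suf s h) (?F (suf s h)) + 3 * m \<le> \<beta> T k * c * s)}"
        by (intro measure_pmf.finite_measure_mono subsetI CollectI sub) auto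
      also have "\<dots> \<le> exp (- (\<epsilon> * kk / (2 * m * (c + 1)) * (\<epsilon> * ?N)))"
        using b[of k] elim \<epsilon> cond by (intro phase_A badc_subset kk_def) auto
      also have "\<dots> = exp (- (C * real ?N powr (1 / 2)))"
        by (simp add: C_def mult_ac flip: \<epsilon>N(2))
      also have "\<dots> \<le> exp (- (C * (real T powr \<eta>) powr (1 / 2)))"
        using N_bounds(1)[of T] C by (auto intro!: mult_left_mono powr_mono2)
      finally show "prob (law T) {h. LB T k h \<and> \<not> LB T (Suc k) h} \<le> exp (- (C * real T powr (\<eta> / 2)))"
        by (simp add: powr_powr)
    qed simp
    also have "\<dots> \<le> real T * exp (- (C * real T powr (\<eta> / 2)))" using elim by (intro mult_right_mono) auto
    finally show ?case .
  qed
  show "(\<lambda>T. real T * exp (- (C * real T powr (\<eta> / 2)))) \<longlonglongrightarrow> 0"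
    using C eta by real_asymp
qed

section \<open>Polynomially small bad sets\<close>

definition CB :: "nat \<Rightarrow> real \<Rightarrow> nat \<Rightarrow> nat list list \<Rightarrow> bool" where
  "CB T \<gamma> k h \<longleftrightarrow> (\<forall>s\<in>{N T..T}. W (suf s h) (badc (N T) (U2 T) k (suf s h)) + 3 * m \<le> c * s powr (1 - \<gamma>))"

text \<open>After \<open>kA T\<close> steps \<open>\<beta>\<close> has reached its cut-off
  \<open>\<rho> T\<close>, and \<open>\<rho> T \<le> s powr (- gam 0)\<close> for all
  \<open>s \<le> T\<close> turns the linear bound \<open>LB\<close> into a power bound.\<close>

lemma neg_CB_start: "negligible (\<lambda>T h. \<not> CB T (gam 0) (kA T) h)"
proof (rule negligible_mono[OF negligible_disj[OF neg_oldw neg_phase_A]])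
  have g0: "0 < gam 0" "0 < ln mm" using gam_pos mm by auto
  show "\<forall>\<^sub>F T in sequentially. \<forall>h. reach h \<longrightarrow> length h = T \<longrightarrow> \<not> CB T (gam 0) (kA T) h \<longrightarrow>
    \<not> oldw T h \<or> (\<exists>k\<in>{..<kA T}. LB T k h \<and> \<not> LB T (Suc k) h)"
    using ev_start ev_q ev_basic[of 2] eventually_compose_filterlim[OF ev_large_u U2_at_top] eventually_ge_at_top[of 3]
  proof eventually_elim
    case (elim T)
    show ?case
    proof (intro allI impI, rule ccontr)
      fix h assume h: "reach h" "length h = T" "\<not> CB T (gam 0) (kA T) h"
        and "\<not> (\<not> oldw T h \<or> (\<exists>k\<in>{..<kA T}. LB T k h \<and> \<not> LB T (Suc k) h))"
      then have ow: "oldw T h" and st: "\<And>k. k < kA T \<Longrightarrow> LB T k h \<Longrightarrow> LB T (Suc k) h" by auto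
      have "1 - q T \<le> \<beta> T 0" using elim by (simp add: \<beta>_def)
      then have bq: "(1 - q T) * (c * s) \<le> \<beta> T 0 * (c * s)" for s :: nat using c_gt by (intro mult_right_mono) auto
      have L0: "LB T 0 h"
        unfolding LB_def
      proof
        fix s assume "s \<in> {N T..T}"
        then have "W (suf s h) (badc (N T) (U2 T) 0 (suf s h)) + 3 * m \<le> (1 - q T) * c * s"
          using elim(1) h ow by (simp add: q_def)
        also have "\<dots> \<le> \<beta> T 0 * c * s"
          using bq[of s] by (simp add: mult.assoc)
        finally show "W (suf s h) (badc (N T) (U2 T) 0 (suf s h)) + 3 * m \<le> \<beta> T 0 * c * s" .
      qed
      have "k \<le> kA T \<Longrightarrow> LB T k h" for k by (induction k) (use L0 st in auto)
      then have L: "LB T (kA T) h" by simp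
      have T0: "0 < ln T" "0 < T" using elim by auto
      have U0: "0 < U2 T" using elim by auto
      have p0: "0 < gam 0 * ln T * U2 T powr \<mu>" using T0 g0 U0 by simp
      have "ln (gam 0 * ln T * U2 T powr \<mu>) / ln mm \<le> kA T" unfolding kA_def by (rule real_nat_ceiling_ge)
      then have "ln (gam 0 * ln T * U2 T powr \<mu>) \<le> kA T * ln mm" using g0 by (simp add: field_simps)
      also have "\<dots> = ln (mm ^ kA T)" using mm by (simp add: ln_realpow)
      finally have "gam 0 * ln T * U2 T powr \<mu> \<le> mm ^ kA T" using p0 mm by (subst (asm) ln_le_cancel_iff) auto
      then have "q T * (gam 0 * ln T * U2 T powr \<mu>) \<le> q T * mm ^ kA T" using elim by (intro mult_left_mono) auto
      moreover have "q T * (gam 0 * ln T * U2 T powr \<mu>) = gam 0 * ln T"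
        using U0 by (simp add: q_def powr_minus)
      ultimately have *: "gam 0 * ln T \<le> q T * mm ^ kA T" by simp
      have "(1 - q T) powr (mm ^ kA T) \<le> exp (- q T) powr (mm ^ kA T)"
        using exp_ge_add_one_self[of "- q T"] elim mm by (intro powr_mono2) auto
      also have "\<dots> = exp (- (q T * mm ^ kA T))" by (simp add: powr_def mult.commute)
      also have "\<dots> \<le> exp (- (gam 0 * ln T))" using * by simp
      also have "\<dots> = \<rho> T" using T0 by (simp add: \<rho>_def powr_def)
      finally have "\<beta> T (kA T) = \<rho> T" by (simp add: \<beta>_def)
      have "CB T (gam 0) (kA T) h"
        unfolding CB_def
      proof
        fix s assume s: "s \<in> {N T..T}"
        have s0: "0 < real s" using s elim by auto
        have "W (suf s h) (badc (N T) (U2 T) (kA T) (suf s h)) + 3 * m \<le> \<rho> T * c * s"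
          using L s unfolding LB_def \<open>\<beta> T (kA T) = \<rho> T\<close> by auto
        also have "\<dots> \<le> s powr (- gam 0) * c * s"
          unfolding \<rho>_def using s s0 g0 c_gt by (intro mult_right_mono powr_mono2') auto
        also have "\<dots> = c * s powr (1 - gam 0)" using s0 by (simp add: powr_diff powr_minus field_simps)
        finally show "W (suf s h) (badc (N T) (U2 T) (kA T) (suf s h)) + 3 * m \<le> c * s powr (1 - gam 0)" .
      qed
      then show False using h(3) by simp
    qed
  qed
qed

abbreviation many_bad :: "nat \<Rightarrow> real \<Rightarrow> nat \<Rightarrow> nat list list \<Rightarrow> bool" where
  "many_bad T \<gamma> k h \<equiv>
    (\<exists>s\<in>{N T..T}. 1 / 2 \<le> (\<Sum>v\<in>newbad (N T) (badc (N T) (U2 T) k) (suf s h). real v powr (3 * \<gamma> / 2 - 1)))"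

text \<open>With \<open>\<gamma>' = 3 * \<gamma> / 2\<close> the exponent in \<open>phase_B\<close>
  is \<open>- 1 - \<gamma> / 2\<close>, so the sum over times is at most a negative power of
  \<open>T\<close> times a harmonic sum.\<close>

lemma neg_bad_sum:
  assumes "0 < \<gamma>" "\<gamma> \<le> 2 / 3"
  shows "negligible (\<lambda>T h.
    many_bad T \<gamma> (kk T) h \<and> CB T \<gamma> (kk T) h)"
proof (rule negligibleI)
  show "\<forall>\<^sub>F T in sequentially. prob (law T) {h.
    many_bad T \<gamma> (kk T) h \<and> CB T \<gamma> (kk T) h} \<le> 2 * ((real T powr \<eta>) powr (- (\<gamma> / 2)) * (ln T + 1))"
    using ev_basic[of 2]
  proof eventually_elim
    case (elim T)
    have 1: "prob (law T) {h.
      many_bad T \<gamma> (kk T) h \<and> CB T \<gamma> (kk T) h} \<le> 2 * (\<Sum>r\<in>{N T..<T}. real r powr (3 * \<gamma> / 2 - 1 - 2 * \<gamma>))"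
      unfolding CB_def using assms elim by (intro phase_B badc_subset) auto
    have "(\<Sum>r\<in>{N T..<T}. real r powr (3 * \<gamma> / 2 - 1 - 2 * \<gamma>))
        \<le> (\<Sum>r\<in>{N T..<T}. (real T powr \<eta>) powr (- (\<gamma> / 2)) * inverse (real r))"
    proof (rule sum_mono)
      fix r assume r: "r \<in> {N T..<T}"
      have r0: "0 < real r" using r elim by auto
      have "real r powr (3 * \<gamma> / 2 - 1 - 2 * \<gamma>) = real r powr (- (\<gamma> / 2)) * real r powr (- 1)"
      proof -
        have "3 * \<gamma> / 2 - 1 - 2 * \<gamma> = - (\<gamma> / 2) + - 1" by simp
        then show ?thesis by (simp only: powr_add)
      qed
      also have "\<dots> \<le> (real T powr \<eta>) powr (- (\<gamma> / 2)) * real r powr (- 1)"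
      proof (intro mult_right_mono powr_mono2')
        show "real T powr \<eta> \<le> real r" using N_bounds(1)[of T] r by (auto intro: order_trans)
      qed (use assms elim in auto)
      finally have *: "real r powr (3 * \<gamma> / 2 - 1 - 2 * \<gamma>) \<le> (real T powr \<eta>) powr (- (\<gamma> / 2)) * real r powr (- 1)" .
      show "real r powr (3 * \<gamma> / 2 - 1 - 2 * \<gamma>) \<le> (real T powr \<eta>) powr (- (\<gamma> / 2)) * inverse (real r)"
      proof -
        have "real r powr (- 1) = inverse (real r)" using r0 by (simp add: powr_minus)
        then show ?thesis using * by (simp only:)
      qed
    qed
    also have "\<dots> = (real T powr \<eta>) powr (- (\<gamma> / 2)) * (\<Sum>r\<in>{N T..<T}. inverse (real r))"
      by (simp add: sum_distrib_left)
    also have "\<dots> \<le> (real T powr \<eta>) powr (- (\<gamma> / 2)) * (ln T + 1)"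
    proof (rule mult_left_mono)
      have "(\<Sum>r\<in>{N T..<T}. inverse (real r)) \<le> harm T"
        unfolding harm_def using elim by (intro sum_mono2) auto
      also have "harm T \<le> ln (real T) + 1" using decseqD[OF decseq_harm_diff_ln, of 0 "T - 1"] elim by (simp add: harm_expand)
      finally show "(\<Sum>r\<in>{N T..<T}. inverse (real r)) \<le> ln T + 1" .
    qed simp
    finally show ?case using 1 by linarith
  qed
  show "(\<lambda>T. 2 * ((real T powr \<eta>) powr (- (\<gamma> / 2)) * (ln T + 1))) \<longlonglongrightarrow> 0"
    using assms eta by real_asymp
qed

text \<open>As \<open>\<gamma>' \<le> 1\<close>, one bound on the sum at the final time controls the number of bad vertices at all
  times, which saves a union bound over the times.\<close>

lemma card_bad_le:
  assumes "\<gamma>' \<le> 1" "(\<Sum>v\<in>newbad N' F h. real v powr (\<gamma>' - 1)) < 1 / 2" "h \<noteq> []"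
  shows "card (newbad N' F h) \<le> real (length h) powr (1 - \<gamma>') / 2"
proof -
  let ?B = "newbad N' F h" and ?s = "real (length h)"
  have s0: "0 < ?s" using assms(3) by simp
  have "card ?B * ?s powr (\<gamma>' - 1) = (\<Sum>v\<in>?B. ?s powr (\<gamma>' - 1))" by simp
  also have "\<dots> \<le> (\<Sum>v\<in>?B. real v powr (\<gamma>' - 1))"
    using newbad_subset1[of N' F h] assms(1) by (intro sum_mono powr_mono2') auto
  finally have "card ?B * ?s powr (\<gamma>' - 1) \<le> 1 / 2" using assms(2) by simp
  then have "card ?B * ?s powr (\<gamma>' - 1) * ?s powr (1 - \<gamma>') \<le> 1 / 2 * ?s powr (1 - \<gamma>')"
    by (intro mult_right_mono) auto
  then show ?thesis using s0 by (simp add: mult.assoc flip: powr_add)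
qed

text \<open>There are at most \<open>s powr (1 - 3 * \<gamma> / 2) / 2\<close> bad vertices, and
  those outside the core have weight below \<open>U2 T \<le> s powr (\<gamma> / 6)\<close>; the new
  exponent is \<open>3 / 2 - 1 / 6 = 4 / 3\<close> times the old one.\<close>

lemma neg_CB_step:
  assumes "0 < \<gamma>" "\<gamma> \<le> 1 / 2"
  shows "negligible (\<lambda>T h. CB T \<gamma> (kk T) h \<and> \<not> CB T (4 * \<gamma> / 3) (Suc (kk T)) h)"
proof (rule negligible_mono[OF neg_bad_sum[of \<gamma> kk]])
  have "\<forall>\<^sub>F T::nat in sequentially. ln (real T) powr s2 \<le> (real T powr \<eta>) powr (\<gamma> / 6)"
    using assms eta params by real_asymp
  moreover have "\<forall>\<^sub>F T::nat in sequentially. 3 * m \<le> (real T powr \<eta>) powr (1 - 4 * \<gamma> / 3)"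
    using assms eta params by real_asymp
  ultimately show "\<forall>\<^sub>F T in sequentially. \<forall>h. reach h \<longrightarrow> length h = T \<longrightarrow>
     CB T \<gamma> (kk T) h \<and> \<not> CB T (4 * \<gamma> / 3) (Suc (kk T)) h \<longrightarrow>
     many_bad T \<gamma> (kk T) h \<and> CB T \<gamma> (kk T) h"
    using ev_basic[of 2]
  proof eventually_elim
    case (elim T)
    let ?F = "badc (N T) (U2 T) (kk T)"
    show ?case
    proof (intro allI impI, rule ccontr)
      fix h assume h: "reach h" "length h = T" "CB T \<gamma> (kk T) h \<and> \<not> CB T (4 * \<gamma> / 3) (Suc (kk T)) h"
        and "\<not> (many_bad T \<gamma> (kk T) h \<and> CB T \<gamma> (kk T) h)"
      then have "\<not> (\<exists>s\<in>{N T..T}. 1 / 2 \<le> (\<Sum>v\<in>newbad (N T) ?F (suf s h). real v powr (3 * \<gamma> / 2 - 1)))"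
        using h(3) by blast
      then have small: "(\<Sum>v\<in>newbad (N T) ?F (suf s h). real v powr (3 * \<gamma> / 2 - 1)) < 1 / 2" if "s \<in> {N T..T}" for s
        using that by (meson not_le)
      have "CB T (4 * \<gamma> / 3) (Suc (kk T)) h"
        unfolding CB_def
      proof
        fix s assume s: "s \<in> {N T..T}"
        let ?S = "suf s h" and ?B = "newbad (N T) ?F (suf s h)"
        have ls: "length ?S = s" "?S \<noteq> []" using s h elim by (auto simp: suf_def)
        have s0: "0 < real s" using s elim by auto
        have sT: "real T powr \<eta> \<le> s" using N_bounds(1)[of T] s by (auto intro: order_trans)
        have U: "0 \<le> U2 T" by (simp add: U2_def)
        have "W ?S (badc (N T) (U2 T) (Suc (kk T)) ?S) \<le> card (?B \<inter> noncore (N T) (U2 T) ?S) * U2 T"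
          unfolding W_def badc.simps by (intro sum_bounded_above) (auto simp: noncore_def)
        also have "\<dots> \<le> card ?B * U2 T" using U by (intro mult_right_mono) (auto intro!: card_mono)
        also have "\<dots> \<le> s powr (1 - 3 * \<gamma> / 2) / 2 * s powr (\<gamma> / 6)"
        proof (intro mult_mono)
          show "card ?B \<le> s powr (1 - 3 * \<gamma> / 2) / 2"
            using card_bad_le[OF _ small[OF s] ls(2)] assms ls(1) by simp
          have "U2 T \<le> (real T powr \<eta>) powr (\<gamma> / 6)" using elim by (simp add: U2_def)
          also have "\<dots> \<le> s powr (\<gamma> / 6)" using sT assms by (intro powr_mono2) auto
          finally show "U2 T \<le> s powr (\<gamma> / 6)" .
        qed (use U in auto)
        also have "\<dots> = s powr (1 - 4 * \<gamma> / 3) / 2" by (simp add: algebra_simps flip: powr_add)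
        finally have 1: "W ?S (badc (N T) (U2 T) (Suc (kk T)) ?S) \<le> s powr (1 - 4 * \<gamma> / 3) / 2" .
        have 2: "3 * m \<le> s powr (1 - 4 * \<gamma> / 3)"
        proof -
          have "(real T powr \<eta>) powr (1 - 4 * \<gamma> / 3) \<le> s powr (1 - 4 * \<gamma> / 3)"
            using sT assms by (intro powr_mono2) auto
          then show ?thesis using elim by simp
        qed
        have "2 * s powr (1 - 4 * \<gamma> / 3) \<le> c * s powr (1 - 4 * \<gamma> / 3)"
          using c_gt by (intro mult_right_mono) auto
        then show "W ?S (badc (N T) (U2 T) (Suc (kk T)) ?S) + 3 * m \<le> c * s powr (1 - 4 * \<gamma> / 3)"
          using 1 2 by simp
      qed
      then show False using h(3) by simp
    qed
  qed
qed (use assms in auto)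

text \<open>At \<open>\<gamma> = 2 / 3\<close> the exponent \<open>3 * \<gamma> / 2 - 1\<close>
  vanishes, so the sum counts bad vertices and a value below \<open>1 / 2\<close> means that there
  are none.\<close>

lemma neg_newbad_last:
  "negligible (\<lambda>T h. CB T (2 / 3) (kk T) h \<and> newbad (N T) (badc (N T) (U2 T) (kk T)) h \<noteq> {})"
proof (rule negligible_mono[OF neg_bad_sum[of "2 / 3" kk]])
  show "\<forall>\<^sub>F T in sequentially. \<forall>h. reach h \<longrightarrow> length h = T \<longrightarrow>
     CB T (2 / 3) (kk T) h \<and> newbad (N T) (badc (N T) (U2 T) (kk T)) h \<noteq> {} \<longrightarrow>
     many_bad T (2 / 3) (kk T) h \<and> CB T (2 / 3) (kk T) h"
    using ev_basic[of 2]
  proof eventually_elim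
    case (elim T)
    let ?F = "badc (N T) (U2 T) (kk T)"
    show ?case
    proof (intro allI impI conjI)
      fix h assume h: "length h = T" "CB T (2 / 3) (kk T) h \<and> newbad (N T) ?F h \<noteq> {}"
      then have "0 < card (newbad (N T) ?F h)" by (simp add: card_gt_0_iff)
      moreover have "(\<Sum>v\<in>newbad (N T) ?F h. real v powr (3 * (2 / 3) / 2 - 1)) = (\<Sum>v\<in>newbad (N T) ?F h. 1)"
        using newbad_subset1[of "N T" ?F h] by (intro sum.cong) auto
      ultimately show "\<exists>s\<in>{N T..T}. 1 / 2 \<le> (\<Sum>v\<in>newbad (N T) ?F (suf s h). real v powr (3 * (2 / 3) / 2 - 1))"
        using elim h(1) by (intro bexI[of _ T]) auto
    qed auto
  qed
qed auto

lemma neg_bad: "negligible (\<lambda>T h. newbad (N T) (badc (N T) (U2 T) (kA T + r0)) h \<noteq> {})"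
proof -
  have "j \<le> r0 \<Longrightarrow> negligible (\<lambda>T h. \<not> CB T (gam j) (kA T + j) h)" for j
  proof (induction j)
    case 0
    then show ?case using neg_CB_start by simp
  next
    case (Suc j)
    have "r0 - j = Suc (r0 - Suc j)" using Suc.prems by simp
    then have g: "gam j = 3 / 4 * gam (Suc j)" by (simp add: gam_def)
    have "gam (Suc j) \<le> 2 / 3" unfolding gam_def by (simp add: power_le_one)
    then have "gam j \<le> 1 / 2" using g by simp
    then have "negligible (\<lambda>T h. CB T (gam j) (kA T + j) h \<and> \<not> CB T (4 * gam j / 3) (Suc (kA T + j)) h)"
      by (intro neg_CB_step gam_pos)
    moreover have "4 * gam j / 3 = gam (Suc j)" using g by simp
    ultimately have "negligible (\<lambda>T h. CB T (gam j) (kA T + j) h \<and> \<not> CB T (gam (Suc j)) (kA T + Suc j) h)"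
      by simp
    moreover have "negligible (\<lambda>T h. \<not> CB T (gam j) (kA T + j) h)" using Suc by simp
    ultimately have "negligible (\<lambda>T h. \<not> CB T (gam j) (kA T + j) h
        \<or> CB T (gam j) (kA T + j) h \<and> \<not> CB T (gam (Suc j)) (kA T + Suc j) h)"
      by (intro negligible_disj)
    then show ?case by (rule negligible_mono) auto
  qed
  from this[of r0] have "negligible (\<lambda>T h. \<not> CB T (2 / 3) (kA T + r0) h)" by (simp add: gam_def)
  from negligible_disj[OF this neg_newbad_last[of "\<lambda>T. kA T + r0"]] show ?thesis
    by (rule negligible_mono) auto
qed

section \<open>Layers of the core\<close>

definition sfix :: real where "sfix = (1 + e) / (1 - \<mu>)"

definition sj :: "nat \<Rightarrow> real" where "sj j = sfix + (s1 - sfix) / \<mu> ^ j"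

text \<open>\<open>sfix\<close> is the fixed point of the recursion \<open>sj_Suc\<close>. It is repelling because \<open>\<mu> < 1\<close>, which is
  where \<open>\<sigma> > 1 / (3 - \<tau>)\<close> enters.\<close>

definition thr :: "nat \<Rightarrow> nat \<Rightarrow> real" where "thr T j = min (ln T powr sj j) (T powr \<nu>)"

text \<open>Chosen so that \<open>(s1 - sfix) / \<mu> ^ JT T \<ge> \<nu> * ln T\<close>; then
  \<open>ln T powr sj (JT T) \<ge> T powr \<nu>\<close> once \<open>ln (ln T) \<ge> 1\<close>, and
  the last layer is the top.\<close>

definition JT :: "nat \<Rightarrow> nat" where "JT T = nat \<lceil>ln (\<nu> / (s1 - sfix) * ln T) / ln (1 / \<mu>)\<rceil>"

lemma sj_Suc: "\<mu> * sj (Suc j) + (1 + e) = sj j"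
proof -
  have "sfix * (1 - \<mu>) = 1 + e" using mu by (simp add: sfix_def)
  then have "\<mu> * sfix + (1 + e) = sfix" by (simp add: algebra_simps)
  moreover have "\<mu> * ((s1 - sfix) / \<mu> ^ Suc j) = (s1 - sfix) / \<mu> ^ j" using params by simp
  ultimately show ?thesis by (simp add: sj_def distrib_left)
qed

lemma sj_ge: "s1 \<le> sj j"
proof -
  have "(s1 - sfix) * 1 \<le> (s1 - sfix) * (1 / \<mu> ^ j)"
    using s12 mu params by (intro mult_left_mono) (auto simp: sfix_def power_le_one)
  then show ?thesis by (simp add: sj_def)
qed

lemma ev_JT: "\<forall>\<^sub>F T in sequentially. JT T \<le> T"
proof -
  define C l where "C = \<nu> / (s1 - sfix)" and "l = ln (1 / \<mu>)"
  have p: "0 < C" "0 < l" using s12 params mu by (auto simp: C_def l_def sfix_def)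
  have "\<forall>\<^sub>F T::nat in sequentially. ln (C * ln (real T)) / l \<le> real T" using p by real_asymp
  then show ?thesis by eventually_elim (simp add: JT_def C_def l_def ceiling_le_iff)
qed

lemma ev_thr:
  "\<forall>\<^sub>F T in sequentially. thr T 0 = U1 T \<and> 2 * m < thr T 0 \<and> thr T (JT T) = T powr \<nu> \<and> w0 T \<le> T powr \<nu> * T powr \<nu>"
proof -
  have 1: "\<forall>\<^sub>F T::nat in sequentially. ln (real T) powr s1 \<le> real T powr \<nu>" using params by real_asymp
  have 2: "\<forall>\<^sub>F T::nat in sequentially. 2 * m < ln (real T) powr s1" using params by real_asymp
  have 3: "\<forall>\<^sub>F T::nat in sequentially. 1 \<le> ln (ln (real T))" by real_asymp
  \<comment> \<open>Here \<open>\<nu> > 1 / 2\<close> enters: the product of two top weights exceeds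
    \<open>w0 T\<close>, so \<open>connector\<close> applies to a single top vertex as
    target.\<close>
  have 4: "\<forall>\<^sub>F T::nat in sequentially. real T * ln (real T) powr (1 + e) \<le> real T powr \<nu> * real T powr \<nu>"
    using nu e by real_asymp
  show ?thesis
    using 1 2 3 4 ev_basic[of 2] eventually_ge_at_top[of 3]
  proof eventually_elim
    case (elim T)
    have L: "0 < ln (real T)" using elim(6) by simp
    have d: "0 < s1 - sfix" using s12 by (simp add: sfix_def)
    define C where "C = \<nu> / (s1 - sfix)"
    have C: "0 < C" using d params by (simp add: C_def)
    have lmu: "0 < ln (1 / \<mu>)" using mu params by simp
    have "sj 0 = s1" by (simp add: sj_def)
    then have "thr T 0 = U1 T" using elim(1) by (simp add: thr_def U1_def)
    moreover have "w0 T \<le> T powr \<nu> * T powr \<nu>"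
    proof -
      have "w0 T \<le> T * ln (real T) powr (1 + e)" unfolding w0_def using elim(5) by (intro mult_right_mono) auto
      then show ?thesis using elim(4) by simp
    qed
    moreover have "thr T (JT T) = T powr \<nu>"
    proof -
      have "ln (C * ln T) / ln (1 / \<mu>) \<le> JT T" unfolding JT_def C_def by (rule real_nat_ceiling_ge)
      then have "ln (C * ln T) \<le> JT T * ln (1 / \<mu>)" using lmu by (simp add: divide_le_eq)
      also have "\<dots> = ln ((1 / \<mu>) ^ JT T)" using params by (subst ln_realpow) auto
      finally have "C * ln T \<le> (1 / \<mu>) ^ JT T" using C L params by (subst (asm) ln_le_cancel_iff) auto
      then have "(s1 - sfix) * (C * ln T) \<le> (s1 - sfix) * (1 / \<mu>) ^ JT T" using d by (intro mult_left_mono) auto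
      then have "\<nu> * ln T \<le> (s1 - sfix) / \<mu> ^ JT T" using d by (simp add: C_def power_one_over)
      also have "\<dots> \<le> sj (JT T)" using e mu by (simp add: sj_def sfix_def)
      finally have "\<nu> * ln T * 1 \<le> sj (JT T) * ln (ln T)"
        using elim(3) L params sj_ge[of "JT T"] by (intro mult_mono) auto
      then have "exp (\<nu> * ln T) \<le> exp (sj (JT T) * ln (ln T))" by simp
      then show ?thesis using L elim(6) by (simp add: thr_def powr_def)
    qed
    ultimately show ?case using elim(2) by (simp add: U1_def)
  qed
qed

text \<open>With \<open>u\<close> the next threshold, the vertices of weight at least
  \<open>u\<close> carry at least \<open>half T * u powr (- \<mu>)\<close>, so
  \<open>u powr \<mu> * ln T powr (1 + e) \<le> thr T j\<close> is needed. For the logarithmic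
  thresholds this is \<open>sj_Suc\<close>, and at the cap \<open>T powr \<nu>\<close> it follows
  from \<open>\<mu> < 1\<close>.\<close>

lemma ev_layer:
  "\<forall>\<^sub>F T in sequentially. \<forall>h. reach h \<longrightarrow> length h = T \<longrightarrow> oldw T h \<longrightarrow>
    (\<forall>i j. thr T j \<le> wt (suf (half T) h) i \<longrightarrow>
      w0 T \<le> wt (suf (half T) h) i * W (suf (half T) h) {x\<in>{1..half T}. thr T (Suc j) \<le> wt (suf (half T) h) x})"
proof -
  define p where "p = 1 / a"
  have p: "1 < p" "\<eta> < 1 - \<nu> * p" using params eta by (auto simp: p_def)
  have m1: "0 < 1 - \<mu>" using mu by simp
  \<comment> \<open>Here \<open>\<eta> < 1 - \<nu> / a\<close> enters: even for the highest
    threshold, \<open>n\<close> is at least \<open>N T\<close>, as \<open>oldw\<close>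
    requires.\<close>
  have 1: "\<forall>\<^sub>F T::nat in sequentially. real T powr \<eta> + 2 \<le> real T / 3 / (2 * real T powr \<nu>) powr p"
  proof -
    define r where "r = 1 - \<nu> * p"
    have r: "\<eta> < r" "0 < r" using p eta by (auto simp: r_def)
    have "\<forall>\<^sub>F T::nat in sequentially. real T powr \<eta> + 2 \<le> real T powr r / 3 / 2 powr p" using p r eta by real_asymp
    then show ?thesis using eventually_gt_at_top[of 0]
      by eventually_elim (simp add: r_def powr_mult powr_powr powr_diff field_simps)
  qed
  have 2: "\<forall>\<^sub>F T::nat in sequentially. (real T powr \<nu>) powr \<mu> * ln (real T) powr (1 + e) \<le> real T powr \<nu>"
  proof -
    define r where "r = \<nu> * \<mu>"
    have r: "0 < r" "r < \<nu>" using params mu by (auto simp: r_def)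
    have "\<forall>\<^sub>F T::nat in sequentially. real T powr r * ln (real T) powr (1 + e) \<le> real T powr \<nu>" using r e by real_asymp
    then show ?thesis by (simp add: r_def powr_powr)
  qed
  have 3: "\<forall>\<^sub>F T::nat in sequentially. 1 \<le> ln (real T)" by real_asymp
  obtain u0 where u0: "\<And>u. u0 \<le> u \<Longrightarrow> 1 \<le> u \<and> 4 * c * (2 * u) powr (1 / a) \<le> u powr (1 + \<mu>)"
    using ev_large_u by (auto simp: eventually_at_top_linorder)
  have 4: "\<forall>\<^sub>F T::nat in sequentially. u0 \<le> ln (real T) powr s1" using params by real_asymp
  have 5: "\<forall>\<^sub>F T::nat in sequentially. u0 \<le> real T powr \<nu>" using params by real_asymp
  show ?thesis
    using 1 2 3 4 5 ev_basic[of 2]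
  proof eventually_elim
    case (elim T)
    let ?t = "half T"
    show ?case
    proof (intro allI impI)
      fix h i j assume h: "reach h" "length h = T" "oldw T h" and i: "thr T j \<le> wt (suf ?t h) i"
      let ?S = "suf ?t h"
      define u where "u = thr T (Suc j)"
      define R where "R = (2 * u) powr (1 / a)"
      have "ln (real T) powr s1 \<le> ln (real T) powr sj (Suc j)" using elim(3) sj_ge by (intro powr_mono) auto
      then have "u0 \<le> u" using elim(4,5) by (simp add: u_def thr_def)
      then have u: "1 \<le> u" "4 * c * R \<le> u powr (1 + \<mu>)" using u0 by (auto simp: R_def)
      have uT: "u \<le> real T powr \<nu>" "u \<le> ln (real T) powr sj (Suc j)" by (auto simp: u_def thr_def)
      have R1: "1 \<le> R" unfolding R_def using u params by (intro ge_one_powr_ge_zero) auto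
      have t0: "0 < real ?t" using elim by auto
      define n where "n = nat \<lfloor>?t / R\<rfloor>"
      have nR: "real n \<le> ?t / R" "?t / R - 1 < n" using R1 by (auto simp: n_def)
      have "R \<le> (2 * real T powr \<nu>) powr p"
        unfolding R_def p_def using u uT params by (intro powr_mono2) auto
      then have "real T / 3 / (2 * real T powr \<nu>) powr p \<le> ?t / R"
        using R1 elim(6) by (intro frac_le) auto
      then have "real T powr \<eta> + 1 < n" using elim(1) nR by linarith
      then have nN: "N T \<le> n" using N_bounds(2)[of T] by linarith
      then have n2: "2 \<le> n" using elim(6) by simp
      have nRt: "n * R \<le> ?t" using nR(1) R1 by (simp add: le_divide_eq)
      have "real n * 1 \<le> real n * R" using R1 by (intro mult_left_mono) auto
      then have nt: "n \<le> ?t" using nRt by linarith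
      have n2R: "?t / (2 * R) \<le> n" using nR n2 by simp
      have uu: "u powr (1 + \<mu>) = u * (u powr \<mu>)" using u by (simp add: powr_add)
      have "2 * R \<le> 4 * c * R" using R1 c_gt by (intro mult_right_mono) auto
      then have "2 * R \<le> u * (u powr \<mu>)" using u(2) uu by linarith
      then have ur: "1 / (u powr \<mu>) \<le> u / (2 * R)" using R1 u by (simp add: field_simps)
      have key: "u powr \<mu> * ln (real T) powr (1 + e) \<le> thr T j"
        unfolding thr_def
      proof (rule min.boundedI)
        have "u powr \<mu> \<le> (ln (real T) powr sj (Suc j)) powr \<mu>" using u uT params by (intro powr_mono2) auto
        then have "u powr \<mu> * ln (real T) powr (1 + e) \<le> ln (real T) powr (\<mu> * sj (Suc j)) * ln (real T) powr (1 + e)"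
          by (intro mult_right_mono) (auto simp: powr_powr mult.commute)
        also have "\<dots> = ln (real T) powr sj j" by (simp add: sj_Suc flip: powr_add)
        finally show "u powr \<mu> * ln (real T) powr (1 + e) \<le> ln (real T) powr sj j" .
        have "u powr \<mu> \<le> (real T powr \<nu>) powr \<mu>" using u uT params by (intro powr_mono2) auto
        then have "u powr \<mu> * ln (real T) powr (1 + e) \<le> (real T powr \<nu>) powr \<mu> * ln (real T) powr (1 + e)"
          by (intro mult_right_mono) auto
        then show "u powr \<mu> * ln (real T) powr (1 + e) \<le> real T powr \<nu>" using elim(2) by linarith
      qed
      have "w0 T = ?t * (u powr \<mu> * ln (real T) powr (1 + e)) * (1 / (u powr \<mu>))"
        using u by (simp add: w0_def)
      also have "\<dots> \<le> ?t * thr T j * (u / (2 * R))"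
        using key ur u by (intro mult_mono) (auto simp: thr_def)
      also have "\<dots> = thr T j * (?t / (2 * R) * u)" by simp
      also have "\<dots> \<le> wt ?S i * (n * u)"
        using i n2R u R1 t0 by (intro mult_mono) (auto intro: less_imp_le[OF wt_pos])
      also have "\<dots> \<le> wt ?S i * W ?S {x\<in>{1..n}. u \<le> wt ?S x}"
        using n2 nN nt u nRt elim(6) wt_pos[of ?S i] unfolding R_def
        by (intro mult_left_mono good_weight[OF h(3)]) auto
      also have "\<dots> \<le> wt ?S i * W ?S {x\<in>{1..?t}. u \<le> wt ?S x}"
        using nt wt_pos[of ?S i] by (intro mult_left_mono W_mono) auto
      finally show "w0 T \<le> wt ?S i * W ?S {x\<in>{1..?t}. thr T (Suc j) \<le> wt ?S x}"
        by (simp add: u_def)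
    qed
  qed
qed

text \<open>One family for both uses of \<open>connector\<close>: indices below \<open>JT T\<close>
  give the next layers, and index \<open>JT T + i' - 1\<close> gives the singleton
  \<open>{i'}\<close>, so that a single union bound covers the climb and the link at the
  top.\<close>

definition fam :: "nat \<Rightarrow> nat \<Rightarrow> nat list list \<Rightarrow> nat set" where
  "fam T j h = (if j < JT T then {x\<in>{1..half T}. thr T (Suc j) \<le> wt h x} else {j - JT T + 1})"

lemma neg_diam:
  "negligible (\<lambda>T h. \<not> diam (hgraph h) \<le> 2 * Suc (kA T + r0) + 4 * JT T + 2)"
proof (rule negligible_mono)
  let ?R1 = "\<lambda>T h. \<not> oldw T h"
  let ?R2 = "\<lambda>T h. \<exists>v\<in>{1..N T}. wt (suf (half T) h) v < U1 T"
  let ?R3 = "\<lambda>T h. \<exists>v\<in>{1..T}. wt (suf (max (half T) v) h) v < U1 T \<and> U2 T \<le> wt h v"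
  let ?R4 = "\<lambda>T h. \<exists>i\<in>{1..half T}. \<exists>j\<in>{..<JT T + half T}. missed T h i (fam T j (suf (half T) h))"
  let ?R5 = "\<lambda>T h. newbad (N T) (badc (N T) (U2 T) (kA T + r0)) h \<noteq> {}"
  show "negligible (\<lambda>T h. ?R1 T h \<or> ?R2 T h \<or> ?R3 T h \<or> ?R4 T h \<or> ?R5 T h)"
    by (intro negligible_disj neg_oldw neg_old_vertex neg_young_vertex neg_missed ev_JT neg_bad)
  show "\<forall>\<^sub>F T in sequentially. \<forall>h. reach h \<longrightarrow> length h = T \<longrightarrow>
    \<not> diam (hgraph h) \<le> 2 * Suc (kA T + r0) + 4 * JT T + 2 \<longrightarrow>
    ?R1 T h \<or> ?R2 T h \<or> ?R3 T h \<or> ?R4 T h \<or> ?R5 T h"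
    using ev_thr ev_layer ev_basic[of 2]
  proof eventually_elim
    case (elim T)
    show ?case
    proof (intro allI impI, rule ccontr)
      fix h assume h: "reach h" "length h = T"
        and nd: "\<not> diam (hgraph h) \<le> 2 * Suc (kA T + r0) + 4 * JT T + 2"
        and "\<not> (?R1 T h \<or> ?R2 T h \<or> ?R3 T h \<or> ?R4 T h \<or> ?R5 T h)"
      then have R: "oldw T h" "\<not> ?R2 T h" "\<not> ?R3 T h" "\<not> ?R4 T h" "\<not> ?R5 T h" by blast+
      let ?t = "half T" and ?w = "wt (suf (half T) h)"
      have j: "joined ?t h i (fam T j (suf ?t h))"
        if "i \<in> {1..?t}" "j < JT T + ?t" "fam T j (suf ?t h) \<subseteq> {1..?t}"
          "w0 T \<le> ?w i * W (suf ?t h) (fam T j (suf ?t h))" for i j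
        using R(4) that unfolding missed_def by blast
      have "diam (hgraph h) \<le> 2 * Suc (kA T + r0) + 4 * JT T + 2"
      proof (rule diam_good[where T = T and t = ?t and N = "N T" and U = "U2 T" and thr = "thr T"])
        show "newbad (N T) (badc (N T) (U2 T) (kA T + r0)) h = {}" using R(5) by simp
        show "thr T 0 \<le> ?w v" if "v \<in> {1..N T}" for v
          using R(2) that elim(1) by (auto simp: not_less)
        show "wt h v < U2 T" if "v \<in> {1..T}" "wt (suf (max ?t v) h) v < thr T 0" for v
          using R(3) that elim(1) by (auto simp: not_le)
        show "joined ?t h i {x\<in>{1..?t}. thr T (Suc j) \<le> ?w x}"
          if "i \<in> {1..?t}" "j < JT T" "thr T j \<le> ?w i" for i j
        proof -
          have f: "fam T j (suf ?t h) = {x\<in>{1..?t}. thr T (Suc j) \<le> ?w x}" using that by (simp add: fam_def)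
          have "w0 T \<le> ?w i * W (suf ?t h) (fam T j (suf ?t h))"
            unfolding f using elim(2) h R(1) that(3) by blast
          then have "joined ?t h i (fam T j (suf ?t h))" using that f by (intro j) auto
          then show ?thesis unfolding f .
        qed
        show "joined ?t h i {i'}"
          if i: "i \<in> {1..?t}" "i' \<in> {1..?t}" "thr T (JT T) \<le> ?w i" "thr T (JT T) \<le> ?w i'" for i i'
        proof -
          have f: "fam T (JT T + i' - 1) (suf ?t h) = {i'}" using i by (auto simp: fam_def)
          have "w0 T \<le> T powr \<nu> * T powr \<nu>" using elim(1) by simp
          also have "\<dots> \<le> ?w i * ?w i'" using i elim(1) wt_pos[of "suf ?t h" i] by (intro mult_mono) auto
          finally have "w0 T \<le> ?w i * W (suf ?t h) {i'}" by (simp add: W_def)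
          moreover have "JT T + i' - 1 < JT T + ?t" using i by auto
          ultimately show ?thesis using j[of i "JT T + i' - 1"] f i by auto
        qed
      qed (use h elim in auto)
      then show False using nd by simp
    qed
  qed
qed

theorem diam_law:
  assumes "2 * (1 + s2 * \<mu>) / ln mm + 4 / ln (1 / \<mu>) < C"
  shows "(\<lambda>T. prob (law T) {h. real (diam (hgraph h)) \<le> C * ln (ln T)}) \<longlonglongrightarrow> 1"
proof -
  define lm l d gg where "lm = ln mm" and "l = ln (1 / \<mu>)" and "d = \<nu> / (s1 - sfix)" and "gg = gam 0"
  have p: "0 < lm" "0 < l" "0 < d" "0 < gg"
    using mm mu params s12 gam_pos by (auto simp: lm_def l_def d_def gg_def sfix_def)
  define k1 where "k1 = 1 + s2 * \<mu>"
  define A where "A = 2 * k1 / lm + 4 / l"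
  have k1: "0 < k1" using params by (simp add: k1_def add_pos_pos)
  have A: "A < C" using assms by (simp add: A_def k1_def lm_def l_def)
  \<comment> \<open>The bounded part: rounding in both ceilings, the \<open>r0\<close> extra steps
    and the constants inside the logarithms. The strict inequality \<open>A < C\<close> absorbs
    it.\<close>
  define B where "B = 2 * ln gg / lm + 4 * ln d / l + 10 + 2 * real r0"
  have "\<forall>\<^sub>F T::nat in sequentially. 0 \<le> (ln gg + k1 * ln (ln (real T))) / lm" using p k1 by real_asymp
  moreover have "\<forall>\<^sub>F T::nat in sequentially. 0 \<le> (ln d + ln (ln (real T))) / l" using p by real_asymp
  moreover have "\<forall>\<^sub>F T::nat in sequentially. B + A * ln (ln (real T)) \<le> C * ln (ln (real T))"
    using A by real_asymp
  ultimately have ev: "\<forall>\<^sub>F T in sequentially. 2 * Suc (kA T + r0) + 4 * JT T + 2 \<le> C * ln (ln T)"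
    using eventually_ge_at_top[of 3]
  proof eventually_elim
    case (elim T)
    have L: "0 < ln (real T)" using elim(4) by simp
    have "ln (gam 0 * ln T * U2 T powr \<mu>) = ln gg + k1 * ln (ln (real T))"
      using L p by (simp add: gg_def U2_def powr_powr k1_def ln_mult ln_powr algebra_simps)
    then have "kA T = nat \<lceil>(ln gg + k1 * ln (ln (real T))) / lm\<rceil>" by (simp add: kA_def lm_def)
    then have k: "kA T \<le> (ln gg + k1 * ln (ln (real T))) / lm + 1" using elim(1) by linarith
    have "ln (\<nu> / (s1 - sfix) * ln T) = ln d + ln (ln (real T))"
      unfolding d_def[symmetric] using L p(3) by (simp add: ln_mult)
    then have "JT T = nat \<lceil>(ln d + ln (ln (real T))) / l\<rceil>" by (simp add: JT_def l_def)
    then have j: "JT T \<le> (ln d + ln (ln (real T))) / l + 1" using elim(2) by linarith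
    have "real (2 * Suc (kA T + r0) + 4 * JT T + 2) = 2 * real (kA T) + 4 * real (JT T) + (4 + 2 * real r0)"
      by simp
    also have "\<dots> \<le>
       2 * ((ln gg + k1 * ln (ln (real T))) / lm + 1) + 4 * ((ln d + ln (ln (real T))) / l + 1) + (4 + 2 * real r0)"
      by (intro add_mono mult_left_mono k j order_refl) auto
    also have "\<dots> = B + A * ln (ln (real T))"
      by (simp add: A_def B_def add_divide_distrib algebra_simps)
    finally show ?case using elim(3) by simp
  qed
  have neg: "negligible (\<lambda>T h. \<not> real (diam (hgraph h)) \<le> C * ln (ln T))"
  proof (rule negligible_mono[OF neg_diam])
    show "\<forall>\<^sub>F T in sequentially. \<forall>h. reach h \<longrightarrow> length h = T \<longrightarrow> \<not> real (diam (hgraph h)) \<le> C * ln (ln T) \<longrightarrow>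
      \<not> diam (hgraph h) \<le> 2 * Suc (kA T + r0) + 4 * JT T + 2"
      using ev by eventually_elim (auto dest: order_trans[OF of_nat_mono])
  qed
  have "prob (law T) {h. real (diam (hgraph h)) \<le> C * ln (ln T)}
      = 1 - prob (law T) {h. \<not> real (diam (hgraph h)) \<le> C * ln (ln T)}" for T
  proof -
    have "UNIV - {h. \<not> real (diam (hgraph h)) \<le> C * ln (ln T)} = {h. real (diam (hgraph h)) \<le> C * ln (ln T)}" by auto
    then show ?thesis
      using measure_pmf.prob_compl[of "{h. \<not> real (diam (hgraph h)) \<le> C * ln (ln T)}" "law T"] by simp
  qed
  then show ?thesis using tendsto_diff[OF tendsto_const neg[unfolded negligible_def], of 1] by simp
qed

end

section \<open>The three models\<close>

text \<open>\<open>seqp\<close> draws the head last and \<open>replicate_pmf\<close> draws it first;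
  independent draws commute.\<close>

lemma seqp_const: "seqp (\<lambda>_. p) n = replicate_pmf n p"
proof (induction n)
  case (Suc n)
  have "seqp (\<lambda>_. p) (Suc n) = bind_pmf (replicate_pmf n p) (\<lambda>xs. bind_pmf p (\<lambda>x. return_pmf (x # xs)))"
    by (simp add: Suc map_pmf_def)
  also have "\<dots> = bind_pmf p (\<lambda>x. bind_pmf (replicate_pmf n p) (\<lambda>xs. return_pmf (x # xs)))"
    by (rule bind_commute_pmf)
  finally show ?case by simp
qed simp

lemma hgraph_Cons: "hgraph (x # h) = add_vertex (length h + 1) (mset x) (hgraph h)"
  by (auto simp: hgraph_def add_vertex_def)

lemma hedges_elem:
  "ed \<in># hedges h \<Longrightarrow> \<exists>v\<in>{1..length h}. \<exists>u\<in>set (concat h). ed = {#v, u#}"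
  by (induction h) (auto, force+)

context pa_weights
begin

abbreviation \<delta> :: real where "\<delta> \<equiv> real m * (g - 1)"

lemma deg_hgraph:
  "\<forall>x\<in>set h. length x = m \<Longrightarrow>
    deg (hgraph h) i = (if i \<in> {1..length h} then m else 0) + count_list (concat h) i"
proof (induction h)
  case Nil
  then show ?case by (simp add: hgraph_def deg_def)
next
  case (Cons x h)
  then show ?case by (simp add: hgraph_Cons deg_add_vertex count_mset count_list_append del: One_nat_def)
qed

lemma deg_wt:
  assumes "valid h" "i \<in> {1..length h}"
  shows "real (deg (hgraph h) i) + \<delta> = wt h i"
  using assms deg_hgraph[of h i] by (simp add: valid_def wt_def algebra_simps)

lemma pa_inv_hgraph:
  assumes "valid h"
  shows "pa_inv m (length h) (hgraph h)"
  unfolding pa_inv_def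
proof (intro conjI ballI)
  have len: "\<forall>x\<in>set h. length x = m" using assms by (simp add: valid_def)
  show "verts (hgraph h) = {1..length h}" by (simp add: hgraph_def)
  show "size (edges (hgraph h)) = m * length h"
    using len by (induction h) (auto simp: hgraph_def)
  show "size ed = 2" "set_mset ed \<subseteq> {1..length h}" if "ed \<in># edges (hgraph h)" for ed
    using hedges_elem[of ed h] that assms by (fastforce simp: hgraph_def valid_def)+
  show "m \<le> deg (hgraph h) i" if "i \<in> {1..length h}" for i
    using deg_hgraph[OF len, of i] that by simp
qed

section \<open>Model (c)\<close>

definition kap_c :: "nat list list \<Rightarrow> nat list \<Rightarrow> nat pmf" where
  "kap_c h p = attach_c m \<delta> (length h) (hgraph h)"

text \<open>The last entry belongs to vertex 1 and the head to vertex 2: each of them owns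
  \<open>m\<close> of the \<open>2 * m\<close> initial edges.\<close>

definition start_c :: "nat list list" where
  "start_c = [replicate m 1, replicate m 2]"

lemma delta_ge: "- real m \<le> \<delta>"
  using g01 mg_pos by (simp add: algebra_simps)

lemma c_delta: "2 * real m + \<delta> = c"
  by (simp add: c_def algebra_simps)

lemma pmf_kap_c:
  assumes "valid h" "h \<noteq> []"
  shows "pmf (kap_c h p) i = (if i \<in> {1..length h} then wt h i / (c * length h) else 0)"
proof -
  have "1 \<le> length h" using assms(2) by (cases h) auto
  then show ?thesis
    using pmf_attach_c[OF pa_inv_hgraph[OF assms(1)] _ delta_ge, of i] m2 deg_wt[OF assms(1), of i]
    unfolding kap_c_def c_delta by (simp add: mult.commute)
qed

lemma prob_eq_sum:
  assumes "finite A"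
  shows "prob M A = (\<Sum>i\<in>A. pmf M i)"
  using assms by (rule measure_measure_pmf_finite)

lemma pa_model_c: "pa m g kap_c start_c"
proof
  show "start_c \<noteq> []" "length start_c \<le> 2" by (auto simp: start_c_def)
  show "valid start_c" using m2 by (auto simp: valid_def start_c_def)
next
  fix h :: "nat list list" and p assume h: "valid h" "h \<noteq> []"
  show "set_pmf (kap_c h p) \<subseteq> {1..length h + 1}"
    using pmf_kap_c[OF h, of p] by (auto simp: set_pmf_iff split: if_splits)
  show "wt h i / (c * (length h + 1)) \<le> pmf (kap_c h p) i" if "i \<in> {1..length h}" for i
    using that h c_gt less_imp_le[OF wt_pos] unfolding pmf_kap_c[OF h]
    by (auto intro!: divide_left_mono mult_left_mono simp: add_pos_pos)
  fix A assume A: "A \<subseteq> {1..length h}"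
  have fA: "finite A" using A finite_subset by blast
  have "prob (kap_c h p) (A \<union> {length h + 1}) = (\<Sum>i\<in>A \<union> {length h + 1}. pmf (kap_c h p) i)"
    using fA by (intro prob_eq_sum) auto
  also have "\<dots> = (\<Sum>i\<in>A. pmf (kap_c h p) i)"
    using fA by (intro sum.mono_neutral_right) (auto simp: pmf_kap_c[OF h])
  also have "\<dots> = (\<Sum>i\<in>A. wt h i / (c * length h))"
    using A by (intro sum.cong) (auto simp: pmf_kap_c[OF h])
  also have "\<dots> = W h A / (c * length h)" by (simp add: W_def sum_divide_distrib)
  also have "\<dots> \<le> (W h A + 3 * m) / (c * length h)" using c_gt by (intro divide_right_mono) auto
  finally show "prob (kap_c h p) (A \<union> {length h + 1}) \<le> (W h A + 3 * m) / (c * length h)" .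
qed

interpretation C: pa m g kap_c start_c by (rule pa_model_c)

lemma pa_c_eq: "2 \<le> t \<Longrightarrow> pa_c m \<delta> t = map_pmf hgraph (C.law t)"
proof -
  let ?G = "MGraph {1, 2} (replicate_mset (2 * m) {#1, 2#})"
  have G: "hgraph start_c = ?G"
  proof -
    have "hedges start_c = replicate_mset m {#1, 2#} + replicate_mset m {#2, 1#}"
      by (simp add: start_c_def numeral_2_eq_2)
    also have "{#2, 1#} = {#1, 2 :: nat#}" by simp
    also have "replicate_mset m {#1, 2 :: nat#} + replicate_mset m {#1, 2#} = replicate_mset (2 * m) {#1, 2#}"
      by (rule multiset_eqI) simp
    finally show ?thesis by (auto simp: hgraph_def start_c_def)
  qed
  have "evolve (step_c m \<delta>) 2 ?G k = map_pmf hgraph (C.hist start_c k)" for k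
  proof (induction k)
    case 0
    then show ?case using G by simp
  next
    case (Suc k)
    have "step_c m \<delta> (2 + k) (hgraph h) = map_pmf (\<lambda>x. hgraph (x # h)) (C.K h)"
      if "h \<in> set_pmf (C.hist start_c k)" for h
    proof -
      have "length h = 2 + k" using C.set_hist[OF C.reach_h0 that] by (simp add: start_c_def)
      moreover from this have "kap_c h = (\<lambda>_. attach_c m \<delta> (2 + k) (hgraph h))"
        by (intro ext) (simp add: kap_c_def)
      ultimately show ?thesis
        by (simp add: step_c_def C.K_def seqp_const hgraph_Cons)
    qed
    then show ?case
      unfolding C.hist_Suc_end evolve.simps Suc
      by (auto simp: map_bind_pmf bind_map_pmf map_pmf_comp intro: bind_pmf_cong)
  qed
  moreover have "length start_c = 2" by (simp add: start_c_def)
  ultimately show "pa_c m \<delta> t = map_pmf hgraph (C.law t)"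
    by (simp only: pa_c_def C.law_def)
qed

section \<open>Models (a) and (b) after merging\<close>

definition pgraph :: "nat list list \<Rightarrow> nat list \<Rightarrow> mgraph" where
  "pgraph h p = MGraph ({1..length h} \<union> (if p = [] then {} else {length h + 1}))
     (hedges h + image_mset (\<lambda>u. {#length h + 1, u#}) (mset p))"

text \<open>Models (a) and (b) are treated together with \<open>\<epsilon> = 1\<close> and \<open>\<epsilon> = 0\<close>. \<open>kap_hat \<epsilon> s l G\<close> is the law of
  the block of the other end point of edge number \<open>m * s + l + 1\<close>, which only depends on the
  merged graph \<open>G\<close>; the block \<open>s + 1\<close> consists of \<open>l\<close> vertices at that time.\<close>

definition kap_hat :: "real \<Rightarrow> nat \<Rightarrow> nat \<Rightarrow> mgraph \<Rightarrow> nat pmf" where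
  "kap_hat \<epsilon> s l G = embed_pmf (\<lambda>i. if i \<in> {1..s + 1} then
     (real (deg G i) + (g - 1) * real (if i \<le> s then m else l) + (if i = s + 1 then \<epsilon> * g else 0))
       / (real (m * s + l) * (1 + g) + \<epsilon> * g) else 0)"

definition kap_ab :: "real \<Rightarrow> nat list list \<Rightarrow> nat list \<Rightarrow> nat pmf" where
  "kap_ab \<epsilon> h p = kap_hat \<epsilon> (length h) (length p) (pgraph h p)"

text \<open>Time is counted in blocks, so the merged chain starts after the first \<open>m\<close>
  unmerged vertices, as one vertex with \<open>m\<close> loops.\<close>

definition start_ab :: "nat list list" where
  "start_ab = [replicate m 1]"

lemma deg_pgraph:
  assumes "\<forall>x\<in>set h. length x = m"
  shows "deg (pgraph h p) i = (if i \<in> {1..length h} then m else 0) + count_list (concat h) i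
    + (if i = length h + 1 then length p else 0) + count_list p i"
proof -
  have "edges (pgraph h p) = edges (add_vertex (length h + 1) (mset p) (hgraph h))"
    by (simp add: pgraph_def add_vertex_def hgraph_def)
  then have "deg (pgraph h p) i = deg (add_vertex (length h + 1) (mset p) (hgraph h)) i"
    by (simp add: deg_def)
  then show ?thesis using deg_hgraph[OF assms, of i] by (simp add: deg_add_vertex count_mset del: One_nat_def)
qed

text \<open>Each small vertex of the growing block adds 1 to the degree by its own edge end and
  \<open>g - 1\<close> by the shift \<open>\<delta> / m\<close>, hence the term
  \<open>length p * g\<close>. The weights sum to \<open>den\<close> because every end point in
  \<open>p\<close> lies in one of the first \<open>length h + 1\<close> blocks.\<close>

lemma pmf_kap_ab:
  assumes "valid h" "h \<noteq> []" "set p \<subseteq> {1..length h + 1}" "0 \<le> \<epsilon>"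
  defines "den \<equiv> real (m * length h + length p) * (1 + g) + \<epsilon> * g"
  shows "pmf (kap_ab \<epsilon> h p) i = (if i \<in> {1..length h} then (wt h i + count_list p i) / den
    else if i = length h + 1 then (length p * g + count_list p i + \<epsilon> * g) / den else 0)"
    (is "_ = ?f i") and "c * length h \<le> den" "0 < den"
proof -
  let ?s = "length h"
  have len: "\<forall>x\<in>set h. length x = m" using assms(1) by (simp add: valid_def)
  have "set (concat h) \<subseteq> {1..?s}" using assms(1) by (auto simp: valid_def)
  then have "?s + 1 \<notin> set (concat h)" by auto
  then have z: "count_list (concat h) (?s + 1) = 0" by (rule count_list_0_iff[THEN iffD2])
  have s0: "0 < ?s" using assms(2) by simp
  have "real (m * ?s) * (1 + g) \<le> real (m * ?s + length p) * (1 + g)" using g01 by (intro mult_right_mono) auto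
  then show le: "c * ?s \<le> den" using assms(4) g01 by (simp add: den_def c_def mult_ac add_increasing2)
  have "0 < c * ?s" using c_gt s0 by simp
  then show den: "0 < den" using le by linarith
  have eq: "kap_ab \<epsilon> h p = embed_pmf ?f"
    unfolding kap_ab_def kap_hat_def
  proof (intro arg_cong[where f = embed_pmf] ext)
    fix i
    show "(if i \<in> {1..?s + 1} then
     (real (deg (pgraph h p) i) + (g - 1) * real (if i \<le> ?s then m else length p) + (if i = ?s + 1 then \<epsilon> * g else 0))
       / (real (m * ?s + length p) * (1 + g) + \<epsilon> * g) else 0) = ?f i"
    proof (cases "i = ?s + 1")
      case True
      then show ?thesis using z by (simp add: deg_pgraph[OF len] den_def algebra_simps)
    next
      case False
      then show ?thesis by (auto simp: deg_pgraph[OF len] den_def wt_def algebra_simps)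
    qed
  qed
  have "(\<Sum>i\<in>{1..?s + 1}. count_list p i) = cnt {1..?s + 1} p" by (rule sum_count_list) simp
  also have "filter (\<lambda>x. x \<in> {1..?s + 1}) p = p" using assms(3) by (intro filter_True) auto
  finally have cp: "(\<Sum>i\<in>{1..?s}. real (count_list p i)) + count_list p (?s + 1) = length p"
    by (simp flip: of_nat_sum of_nat_add)
  have "sum ?f {1..?s + 1} = sum ?f {1..?s} + ?f (?s + 1)" by simp
  also have "sum ?f {1..?s} = (\<Sum>i\<in>{1..?s}. (wt h i + count_list p i) / den)" by (intro sum.cong) auto
  also have "\<dots> = (W h {1..?s} + (\<Sum>i\<in>{1..?s}. real (count_list p i))) / den"
    by (simp add: W_def sum.distrib flip: sum_divide_distrib)
  also have "W h {1..?s} = c * ?s" using W_total[OF assms(1)] .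
  also have "?f (?s + 1) = (length p * g + count_list p (?s + 1) + \<epsilon> * g) / den" by simp
  also have "(c * ?s + (\<Sum>i\<in>{1..?s}. real (count_list p i))) / den + \<dots>
      = (c * ?s + (length p + length p * g + \<epsilon> * g)) / den"
    unfolding cp[symmetric] by (simp add: add_divide_distrib)
  also have "c * ?s + (length p + length p * g + \<epsilon> * g) = den"
    by (simp add: den_def c_def algebra_simps)
  also have "den / den = 1" using den by simp
  finally have "sum ?f {1..?s + 1} = 1" .
  then show "pmf (kap_ab \<epsilon> h p) i = ?f i"
    unfolding eq using den assms(4) g01 less_imp_le[OF wt_pos]
    by (intro pmf_embed_finite[where A = "{1..?s + 1}"]) (auto intro!: divide_nonneg_pos add_nonneg_nonneg)
qed

text \<open>Origin of the slack: the earlier hits on \<open>A\<close>, the initial weight of the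
  growing block and its loops are each at most \<open>length p\<close>, and the extra loop weight is
  at most 1, together at most \<open>3 * m\<close>. For the lower bound,
  \<open>length p + 1 \<le> m\<close> gives a denominator of at most
  \<open>c * (length h + 1)\<close>.\<close>

lemma pa_model_ab:
  assumes \<epsilon>: "0 \<le> \<epsilon>" "\<epsilon> \<le> 1"
  shows "pa m g (kap_ab \<epsilon>) start_ab"
proof
  show "start_ab \<noteq> []" "length start_ab \<le> 2" by (auto simp: start_ab_def)
  show "valid start_ab" using m2 by (auto simp: valid_def start_ab_def)
next
  fix h :: "nat list list" and p assume h: "valid h" "h \<noteq> []" and p: "set p \<subseteq> {1..length h + 1}" "length p < m"
  let ?s = "length h" and ?l = "length p"
  define den where "den = real (m * ?s + ?l) * (1 + g) + \<epsilon> * g"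
  note pmf = pmf_kap_ab[OF h p(1) \<epsilon>(1), folded den_def]
  show "set_pmf (kap_ab \<epsilon> h p) \<subseteq> {1..?s + 1}"
    using pmf(1) by (auto simp: set_pmf_iff split: if_splits)
  show "wt h i / (c * (?s + 1)) \<le> pmf (kap_ab \<epsilon> h p) i" if i: "i \<in> {1..?s}" for i
  proof -
    have "real (m * ?s + ?l) + 1 \<le> real (m * ?s + m)" using p(2) by simp
    then have "(real (m * ?s + ?l) + 1) * (1 + g) \<le> real (m * ?s + m) * (1 + g)" using g01 by (intro mult_right_mono) auto
    moreover have "\<epsilon> * g \<le> 1 * g" using \<epsilon> g01 by (intro mult_right_mono) auto
    ultimately have "den \<le> c * (?s + 1)" by (simp add: den_def c_def algebra_simps)
    then have "wt h i / (c * (?s + 1)) \<le> (wt h i + count_list p i) / den"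
      using pmf(3) less_imp_le[OF wt_pos] by (intro frac_le) auto
    then show ?thesis using i by (simp add: pmf(1))
  qed
  fix A assume A: "A \<subseteq> {1..?s}"
  have fA: "finite A" "?s + 1 \<notin> A" using A finite_subset by auto
  have "prob (kap_ab \<epsilon> h p) (A \<union> {?s + 1}) = (\<Sum>i\<in>A \<union> {?s + 1}. pmf (kap_ab \<epsilon> h p) i)"
    using fA by (intro prob_eq_sum) auto
  also have "\<dots> = (\<Sum>i\<in>A. pmf (kap_ab \<epsilon> h p) i) + pmf (kap_ab \<epsilon> h p) (?s + 1)"
    using fA by (simp add: add.commute)
  also have "(\<Sum>i\<in>A. pmf (kap_ab \<epsilon> h p) i) = (\<Sum>i\<in>A. (wt h i + count_list p i) / den)"
    using A by (intro sum.cong) (auto simp: pmf(1))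
  also have "\<dots> = (W h A + cnt A p) / den"
    using fA by (simp add: W_def sum.distrib sum_count_list flip: sum_divide_distrib of_nat_sum)
  also have "pmf (kap_ab \<epsilon> h p) (?s + 1) = (?l * g + count_list p (?s + 1) + \<epsilon> * g) / den"
    by (simp add: pmf(1))
  also have "(W h A + cnt A p) / den + \<dots> = (W h A + cnt A p + (?l * g + count_list p (?s + 1) + \<epsilon> * g)) / den"
    by (simp add: add_divide_distrib)
  also have "\<dots> \<le> (W h A + 3 * m) / (c * ?s)"
  proof (intro frac_le)
    have "cnt A p \<le> ?l" by (rule length_filter_le)
    then have "real (cnt A p) \<le> ?l" by simp
    moreover have "real (count_list p (?s + 1)) \<le> ?l" using count_le_length[of p] by simp
    moreover have "?l * g \<le> ?l" using g01 by (simp add: mult_left_le)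
    moreover have "\<epsilon> * g \<le> 1" using \<epsilon> g01 by (intro mult_le_one) auto
    moreover have "real ?l + 1 \<le> m" using p(2) by simp
    ultimately show "W h A + cnt A p + (?l * g + count_list p (?s + 1) + \<epsilon> * g) \<le> W h A + 3 * m"
      by linarith
    show "0 \<le> W h A + 3 * m" using W_nonneg[of h A] by simp
    show "0 < c * ?s" using c_gt h by simp
  qed (rule pmf(2))
  finally show "prob (kap_ab \<epsilon> h p) (A \<union> {?s + 1}) \<le> (W h A + 3 * m) / (c * ?s)" .
qed

lemma deg_merge:
  assumes "pa_inv 1 n H"
  shows "deg (merge m H) i = (\<Sum>u\<in>{u\<in>{1..n}. block m u = i}. deg H u)"
proof -
  have im: "\<Sum>\<^sub># (image_mset (image_mset f) E) = image_mset f (\<Sum>\<^sub># E)" for f :: "nat \<Rightarrow> nat" and E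
    by (induction E) auto
  have sub: "set_mset (\<Sum>\<^sub># (edges H)) \<subseteq> {1..n}" using assms by (auto simp: pa_inv_def)
  have "deg (merge m H) i = (\<Sum>u\<in>block m -` {i} \<inter> set_mset (\<Sum>\<^sub># (edges H)). count (\<Sum>\<^sub># (edges H)) u)"
    by (simp add: deg_def merge_def im count_image_mset)
  also have "\<dots> = (\<Sum>u\<in>{u\<in>{1..n}. block m u = i}. count (\<Sum>\<^sub># (edges H)) u)"
    using sub by (intro sum.mono_neutral_left) (auto simp: count_eq_zero_iff)
  finally show ?thesis by (simp add: deg_def)
qed

lemma card_block:
  assumes "l < m"
  shows "card {u\<in>{1..m * s + l}. block m u = i} = (if i \<in> {1..s} then m else if i = s + 1 then l else 0)"
proof -
  have m0: "0 < m" using m2 by simp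
  have eq: "{u\<in>{1..m * s + l}. block m u = i} = {(i - 1) * m + 1..min (i * m) (m * s + l)}" if "0 < i"
  proof -
    have "{u\<in>{1..m * s + l}. block m u = i} = {u\<in>{1..m * s + l}. u \<in> {(i - 1) * m + 1..i * m}}"
      using block_eq_iff[OF m0 _ that] by (intro Collect_cong conj_cong refl) simp
    also have "\<dots> = {(i - 1) * m + 1..min (i * m) (m * s + l)}" by auto
    finally show ?thesis .
  qed
  consider "i = 0" | "i \<in> {1..s}" | "i = s + 1" | "s + 1 < i" by fastforce
  then show ?thesis
  proof cases
    case 1
    then show ?thesis by (simp add: block_def)
  next
    case 2
    then have "i * m \<le> s * m" by (intro mult_right_mono) auto
    then have "i * m \<le> m * s" by (simp only: mult.commute)
    then have "min (i * m) (m * s + l) = i * m" by (intro min_absorb1 trans_le_add1)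
    moreover have "i * m - (i - 1) * m = m" using 2 by (simp add: diff_mult_distrib)
    ultimately show ?thesis using 2 eq by simp
  next
    case 3
    then have "min (i * m) (m * s + l) = m * s + l" using assms by (simp add: mult.commute)
    then show ?thesis using 3 eq by (simp add: mult.commute)
  next
    case 4
    then have "(s + 1) * m \<le> (i - 1) * m" by (intro mult_right_mono) auto
    then have "m * s + l < (i - 1) * m + 1" using assms by (simp add: mult.commute)
    then have "{(i - 1) * m + 1..min (i * m) (m * s + l)} = {}" by auto
    then show ?thesis using 4 eq by simp
  qed
qed

lemma block_new: "l < m \<Longrightarrow> block m (m * s + l + 1) = s + 1"
  by (simp add: block_def)

text \<open>Lumpability: summing the attachment probabilities over a block leaves only its total
  degree and its number of small vertices, so the block of the next end point depends on
  \<open>H\<close> only through \<open>merge m H\<close>.\<close>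

lemma lump:
  assumes H: "pa_inv 1 (m * s + l) H" and l: "l < m"
    and pmf: "\<And>u. pmf P u = (if u = m * s + l + 1 then \<epsilon> * g / (real (m * s + l) * (1 + g) + \<epsilon> * g)
      else if u \<in> {1..m * s + l} then (real (deg H u) + (g - 1)) / (real (m * s + l) * (1 + g) + \<epsilon> * g) else 0)"
  shows "map_pmf (block m) P = kap_hat \<epsilon> s l (merge m H)"
proof -
  let ?n = "m * s + l" and ?B = "\<lambda>i. {u\<in>{1..m * s + l}. block m u = i}"
  define den where "den = real ?n * (1 + g) + \<epsilon> * g"
  have "pmf (map_pmf (block m) P) i = (if i \<in> {1..s + 1} then
     (real (deg (merge m H) i) + (g - 1) * real (if i \<le> s then m else l) + (if i = s + 1 then \<epsilon> * g else 0))
       / den else 0)" for i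
  proof -
    have sup: "set_pmf P \<subseteq> {1..?n + 1}" using pmf by (auto simp: set_pmf_iff split: if_splits)
    have "pmf (map_pmf (block m) P) i = prob P (block m -` {i})" by (simp add: pmf_map)
    also have "\<dots> = prob P {u\<in>{1..?n + 1}. block m u = i}"
      using sup by (intro measure_pmf.finite_measure_eq_AE) (auto simp: AE_measure_pmf_iff)
    also have "\<dots> = (\<Sum>u\<in>{u\<in>{1..?n + 1}. block m u = i}. pmf P u)" by (intro prob_eq_sum) auto
    also have "{u\<in>{1..?n + 1}. block m u = i} = ?B i \<union> (if i = s + 1 then {?n + 1} else {})"
      using block_new[OF l, of s] by (auto simp: le_Suc_eq)
    also have "(\<Sum>u\<in>\<dots>. pmf P u) = (\<Sum>u\<in>?B i. pmf P u) + (if i = s + 1 then pmf P (?n + 1) else 0)"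
      by (subst sum.union_disjoint) auto
    also have "(\<Sum>u\<in>?B i. pmf P u) = (\<Sum>u\<in>?B i. (real (deg H u) + (g - 1)) / den)"
      by (intro sum.cong) (auto simp: pmf den_def)
    also have "\<dots> = (real (deg (merge m H) i) + (g - 1) * card (?B i)) / den"
      by (simp add: deg_merge[OF H] sum.distrib mult.commute flip: sum_divide_distrib)
    also have "pmf P (?n + 1) = \<epsilon> * g / den" by (simp add: pmf den_def)
    finally have *: "pmf (map_pmf (block m) P) i = (real (deg (merge m H) i) + (g - 1) * card (?B i)) / den
      + (if i = s + 1 then \<epsilon> * g / den else 0)" .
    show ?thesis
    proof (cases "i \<in> {1..s + 1}")
      case True
      then have "card (?B i) = (if i \<le> s then m else l)" unfolding card_block[OF l] by auto
      then show ?thesis using True unfolding * by (auto simp: add_divide_distrib)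
    next
      case False
      then have c0: "card (?B i) = 0" unfolding card_block[OF l] by auto
      then have "?B i = {}" by (subst (asm) card_0_eq) auto
      then have "deg (merge m H) i = 0" by (simp only: deg_merge[OF H] sum.empty)
      then show ?thesis using False c0 unfolding * by auto
    qed
  qed
  then have "pmf (map_pmf (block m) P) = (\<lambda>i. if i \<in> {1..s + 1} then
     (real (deg (merge m H) i) + (g - 1) * real (if i \<le> s then m else l) + (if i = s + 1 then \<epsilon> * g else 0))
       / den else 0)" by (rule ext)
  then have "kap_hat \<epsilon> s l (merge m H) = embed_pmf (pmf (map_pmf (block m) P))"
    by (simp only: kap_hat_def den_def)
  then show ?thesis by (simp only: type_definition.Rep_inverse[OF td_pmf_embed_pmf])
qed

lemma merge_add_vertex:
  "merge m (add_vertex v {#u#} H) = MGraph (insert (block m v) (verts (merge m H)))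
     (add_mset {#block m v, block m u#} (edges (merge m H)))"
  by (simp add: merge_def add_vertex_def)

lemma pgraph_Nil: "pgraph h [] = hgraph h"
  by (simp add: pgraph_def hgraph_def)

lemma pgraph_Cons:
  "pgraph h (i # p) = MGraph (insert (length h + 1) (verts (pgraph h p)))
     (add_mset {#length h + 1, i#} (edges (pgraph h p)))"
  by (auto simp: pgraph_def)

lemma pgraph_full: "x \<noteq> [] \<Longrightarrow> pgraph h x = hgraph (x # h)"
  by (auto simp: pgraph_def hgraph_def)

text \<open>At time \<open>m\<close> all vertices lie in block 1, so merging forgets the randomness;
  both models get the same deterministic start.\<close>

lemma merge_start:
  assumes "pa_inv 1 m H"
  shows "merge m H = hgraph start_ab"
proof -
  have m0: "0 < m" using m2 by simp
  have b: "block m v = 1" if "v \<in> {1..m}" for v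
    using block_eq_iff[OF m0, of v 1] that by auto
  have H: "verts H = {1..m}" "size (edges H) = m" "\<forall>ed\<in>#edges H. size ed = 2 \<and> set_mset ed \<subseteq> {1..m}"
    using assms by (auto simp: pa_inv_def)
  have "image_mset (block m) ed = {#1, 1#}" if "ed \<in># edges H" for ed
  proof -
    have "image_mset (block m) ed = image_mset (\<lambda>_. 1) ed"
    proof (rule image_mset_cong)
      fix u assume "u \<in># ed"
      then have "u \<in> {1..m}" using H(3) that by blast
      then show "block m u = 1" by (rule b)
    qed
    also have "\<dots> = replicate_mset (size ed) 1" by (simp add: image_mset_const_eq)
    also have "size ed = 2" using H(3) that by simp
    finally show ?thesis by (simp add: numeral_2_eq_2)
  qed
  then have "image_mset (image_mset (block m)) (edges H) = image_mset (\<lambda>_. {#1, 1#}) (edges H)"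
    by (intro image_mset_cong) auto
  also have "\<dots> = replicate_mset m {#1, 1#}" by (simp add: image_mset_const_eq H(2))
  finally have "edges (merge m H) = replicate_mset m {#1, 1#}" by (simp add: merge_def)
  moreover have "block m ` {1..m} = {1}" using b m0 by force
  moreover have "hgraph start_ab = MGraph {1} (replicate_mset m {#1, 1#})"
    by (simp add: hgraph_def start_ab_def)
  ultimately show ?thesis by (simp add: merge_def H(1))
qed

text \<open>Two nested inductions: over the blocks, and within a block over its \<open>m\<close>
  edges, with \<open>pgraph h p\<close> as the intermediate merged graph. The hypotheses concern
  times from \<open>m\<close> on only, so model (b), which starts at time 2, fits because
  \<open>m \<ge> 2\<close>.\<close>

lemma merged_chain:
  fixes Ul :: "nat \<Rightarrow> mgraph pmf" and At :: "nat \<Rightarrow> mgraph \<Rightarrow> nat pmf"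
  assumes \<epsilon>: "0 \<le> \<epsilon>" "\<epsilon> \<le> 1"
    and inv: "\<And>n H. m \<le> n \<Longrightarrow> H \<in> set_pmf (Ul n) \<Longrightarrow> pa_inv 1 n H"
    and step: "\<And>n. m \<le> n \<Longrightarrow> Ul (n + 1) = bind_pmf (Ul n) (\<lambda>H. map_pmf (\<lambda>i. add_vertex (n + 1) {#i#} H) (At n H))"
    and At: "\<And>n H u. m \<le> n \<Longrightarrow> pa_inv 1 n H \<Longrightarrow> pmf (At n H) u =
      (if u = n + 1 then \<epsilon> * g / (real n * (1 + g) + \<epsilon> * g)
       else if u \<in> {1..n} then (real (deg H u) + (g - 1)) / (real n * (1 + g) + \<epsilon> * g) else 0)"
    and t: "1 \<le> t"
  shows "map_pmf (merge m) (Ul (m * t)) = map_pmf hgraph (pa.law m (kap_ab \<epsilon>) start_ab t)"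
proof -
  interpret AB: pa m g "kap_ab \<epsilon>" start_ab by (rule pa_model_ab[OF \<epsilon>])
  have m0: "0 < m" using m2 by simp
  have inner: "map_pmf (merge m) (Ul (m * s + l)) =
      bind_pmf (AB.hist start_ab (s - 1)) (\<lambda>h. map_pmf (pgraph h) (seqp (kap_ab \<epsilon> h) l))"
    if s: "1 \<le> s" and base: "map_pmf (merge m) (Ul (m * s)) = map_pmf hgraph (AB.hist start_ab (s - 1))"
      and "l \<le> m" for s l
    using that(3)
  proof (induction l)
    case 0
    have "(\<lambda>h. map_pmf (pgraph h) (seqp (kap_ab \<epsilon> h) 0)) = (\<lambda>h. return_pmf (hgraph h))"
      by (simp add: pgraph_Nil)
    then show ?case using base by (simp only: map_pmf_def[of hgraph] add_0_right)
  next
    case (Suc l)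
    let ?n = "m * s + l"
    have n: "m \<le> ?n" using s by (simp add: trans_le_add1)
    define Kf where "Kf G = map_pmf (\<lambda>i. MGraph (insert (s + 1) (verts G)) (add_mset {#s + 1, i#} (edges G)))
      (kap_hat \<epsilon> s l G)" for G
    have l: "l < m" using Suc.prems by simp
    have K: "map_pmf (merge m) (map_pmf (\<lambda>i. add_vertex (?n + 1) {#i#} H) (At ?n H)) = Kf (merge m H)"
      if "H \<in> set_pmf (Ul ?n)" for H
    proof -
      have "map_pmf (block m) (At ?n H) = kap_hat \<epsilon> s l (merge m H)"
        by (rule lump[OF inv[OF n that] l At[OF n inv[OF n that]]])
      then show ?thesis
        unfolding Kf_def by (simp add: map_pmf_comp merge_add_vertex block_new[OF l, simplified] flip: \<open>map_pmf (block m) (At ?n H) = _\<close>)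
    qed
    have "map_pmf (merge m) (Ul (?n + 1)) = bind_pmf (Ul ?n) (\<lambda>H. Kf (merge m H))"
      unfolding step[OF n] map_bind_pmf using K by (intro bind_pmf_cong) auto
    also have "\<dots> = bind_pmf (map_pmf (merge m) (Ul ?n)) Kf" by (simp add: bind_map_pmf)
    also have "\<dots> = bind_pmf (AB.hist start_ab (s - 1)) (\<lambda>h. bind_pmf (seqp (kap_ab \<epsilon> h) l) (\<lambda>p. Kf (pgraph h p)))"
      using Suc by (simp add: bind_assoc_pmf bind_map_pmf)
    also have "\<dots> = bind_pmf (AB.hist start_ab (s - 1)) (\<lambda>h. map_pmf (pgraph h) (seqp (kap_ab \<epsilon> h) (Suc l)))"
    proof (intro bind_pmf_cong refl)
      fix h assume "h \<in> set_pmf (AB.hist start_ab (s - 1))"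
      then have h: "AB.reach h" "length h = s"
        using AB.set_hist[OF AB.reach_h0] s by (auto simp: start_ab_def)
      have v: "valid h" "h \<noteq> []" using AB.reach_valid[OF h(1)] by auto
      have "Kf (pgraph h p) = map_pmf (\<lambda>i. pgraph h (i # p)) (kap_ab \<epsilon> h p)"
        if "p \<in> set_pmf (seqp (kap_ab \<epsilon> h) l)" for p
      proof -
        have "length p = l"
          using set_seqp[OF that, of "{1..length h + 1}"] AB.kap_set[OF v] l by auto
        then show ?thesis by (simp add: Kf_def kap_ab_def h pgraph_Cons)
      qed
      then show "bind_pmf (seqp (kap_ab \<epsilon> h) l) (\<lambda>p. Kf (pgraph h p)) = map_pmf (pgraph h) (seqp (kap_ab \<epsilon> h) (Suc l))"
        by (auto simp: map_bind_pmf map_pmf_comp intro: bind_pmf_cong)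
    qed
    finally show ?case by simp
  qed
  have "1 \<le> s \<Longrightarrow> map_pmf (merge m) (Ul (m * s)) = map_pmf hgraph (AB.hist start_ab (s - 1))" for s
  proof (induction s rule: nat_induct_at_least)
    case base
    have "map_pmf (merge m) (Ul m) = map_pmf (\<lambda>_. hgraph start_ab) (Ul m)"
      using inv by (intro map_pmf_cong refl merge_start) auto
    then show ?case by simp
  next
    case (Suc s)
    have "map_pmf (merge m) (Ul (m * Suc s)) =
        bind_pmf (AB.hist start_ab (s - 1)) (\<lambda>h. map_pmf (pgraph h) (AB.K h))"
      using inner[OF Suc(1,2), of m] by (simp add: AB.K_def add.commute)
    also have "\<dots> = bind_pmf (AB.hist start_ab (s - 1)) (\<lambda>h. map_pmf (\<lambda>x. hgraph (x # h)) (AB.K h))"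
    proof (intro bind_pmf_cong refl map_pmf_cong)
      fix h x assume "h \<in> set_pmf (AB.hist start_ab (s - 1))" "x \<in> set_pmf (AB.K h)"
      then have "length x = m" using AB.set_hist[OF AB.reach_h0] AB.reach_set_K(1) by blast
      then show "pgraph h x = hgraph (x # h)" using m0 by (intro pgraph_full) auto
    qed
    also have "\<dots> = map_pmf hgraph (AB.hist start_ab (Suc (s - 1)))"
      unfolding AB.hist_Suc_end by (simp add: map_bind_pmf map_pmf_comp)
    also have "Suc (s - 1) = Suc s - 1" using Suc(1) by simp
    finally show ?case .
  qed
  moreover have "length start_ab = 1" by (simp add: start_ab_def)
  ultimately show ?thesis using t by (simp only: AB.law_def)
qed

lemma delta_m: "\<delta> / real m = g - 1"
  using m2 by simp

lemma pa_a_eq: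
  assumes "1 \<le> t"
  shows "pa_a m \<delta> t = map_pmf hgraph (pa.law m (kap_ab 1) start_ab t)"
  unfolding pa_a_def delta_m
proof (rule merged_chain[where At = "attach_a (g - 1)"])
  show "pa_inv 1 n H" if "m \<le> n" "H \<in> set_pmf (pa1_a (g - 1) n)" for n H
    using pa1_a_inv[of "g - 1" n H] that g01 m2 by auto
  show "pa1_a (g - 1) (n + 1) = bind_pmf (pa1_a (g - 1) n)
      (\<lambda>H. map_pmf (\<lambda>i. add_vertex (n + 1) {#i#} H) (attach_a (g - 1) n H))" if "m \<le> n" for n
  proof -
    have "n + 1 - 1 = Suc (n - 1)" "1 + (n - 1) = n" using that m2 by auto
    moreover have "step_a (g - 1) n = (\<lambda>H. map_pmf (\<lambda>i. add_vertex (n + 1) {#i#} H) (attach_a (g - 1) n H))"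
      by (rule ext) (simp only: step_a_def)
    ultimately show ?thesis by (simp only: pa1_a_def evolve.simps)
  qed
  show "pmf (attach_a (g - 1) n H) u = (if u = n + 1 then 1 * g / (real n * (1 + g) + 1 * g)
       else if u \<in> {1..n} then (real (deg H u) + (g - 1)) / (real n * (1 + g) + 1 * g) else 0)"
    if "m \<le> n" "pa_inv 1 n H" for n H u
    using pmf_attach_a[OF that(2), of "g - 1" u] that(1) g01 m2 by (simp add: algebra_simps)
qed (use assms in auto)

lemma pa_b_eq:
  assumes "1 \<le> t"
  shows "pa_b m \<delta> t = map_pmf hgraph (pa.law m (kap_ab 0) start_ab t)"
  unfolding pa_b_def delta_m
proof (rule merged_chain[where At = "attach_b (g - 1)"])
  show "pa_inv 1 n H" if "m \<le> n" "H \<in> set_pmf (pa1_b (g - 1) n)" for n H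
    using pa1_b_inv[of "g - 1" n H] that g01 m2 by auto
  show "pa1_b (g - 1) (n + 1) = bind_pmf (pa1_b (g - 1) n)
      (\<lambda>H. map_pmf (\<lambda>i. add_vertex (n + 1) {#i#} H) (attach_b (g - 1) n H))" if "m \<le> n" for n
  proof -
    have "n + 1 - 2 = Suc (n - 2)" "2 + (n - 2) = n" using that m2 by auto
    moreover have "step_b (g - 1) n = (\<lambda>H. map_pmf (\<lambda>i. add_vertex (n + 1) {#i#} H) (attach_b (g - 1) n H))"
      by (rule ext) (simp only: step_b_def)
    ultimately show ?thesis by (simp only: pa1_b_def evolve.simps)
  qed
  show "pmf (attach_b (g - 1) n H) u = (if u = n + 1 then 0 * g / (real n * (1 + g) + 0 * g)
       else if u \<in> {1..n} then (real (deg H u) + (g - 1)) / (real n * (1 + g) + 0 * g) else 0)"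
    if "m \<le> n" "pa_inv 1 n H" for n H u
    using pmf_attach_b[OF that(2), of "g - 1" u] that(1) g01 m2 by (simp add: algebra_simps)
qed (use assms in auto)

lemma whp_of_law:
  assumes "(\<lambda>T. prob (L T) {h. real (diam (hgraph h)) \<le> C * ln (ln (real T))}) \<longlonglongrightarrow> 1"
    and "\<And>T. 2 \<le> T \<Longrightarrow> P T = map_pmf hgraph (L T)"
  shows "whp P (\<lambda>T G. real (diam G) \<le> C * ln (ln (real T)))"
  unfolding whp_def
proof (rule Lim_transform_eventually[OF assms(1)])
  show "\<forall>\<^sub>F T in sequentially. prob (L T) {h. real (diam (hgraph h)) \<le> C * ln (ln (real T))}
      = prob (P T) {G. real (diam G) \<le> C * ln (ln (real T))}"
    using eventually_ge_at_top[of 2] by eventually_elim (simp add: assms(2) vimage_def)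
qed

end

section \<open>Choice of the parameters\<close>

context pa
begin

lemma diam_loglog:
  assumes \<sigma>: "1 / (1 - g) < \<sigma>"
  shows "(\<lambda>T. prob (law T) {h. real (diam (hgraph h)) \<le>
      (4 / \<bar>ln g\<bar> + 4 * \<sigma> / ln (real m)) * ln (ln (real T))}) \<longlonglongrightarrow> 1"
proof -
  have lm: "0 < ln (real m)" using m2 by simp
  have "0 < 1 / (1 - g)" using g01 by simp
  then have \<sigma>0: "0 < \<sigma>" using \<sigma> by linarith
  have lg: "ln g < 0" using g01 by simp
  have ev1: "\<forall>\<^sub>F x in at_right g. 1 / (1 - x) < \<sigma>"
  proof (rule order_tendstoD(2)[OF _ \<sigma>])
    show "((\<lambda>x. 1 / (1 - x)) \<longlongrightarrow> 1 / (1 - g)) (at_right g)"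
      using g01 by (intro tendsto_intros) auto
  qed
  \<comment> \<open>The room \<open>\<sigma> / (2 * ln m)\<close> is taken from the part of
    \<open>4 * \<sigma> / ln m\<close> that the periphery does not use.\<close>
  have ev2: "\<forall>\<^sub>F x in at_right g. 4 / \<bar>ln x\<bar> < 4 / \<bar>ln g\<bar> + \<sigma> / (2 * ln m)"
  proof (rule order_tendstoD(2))
    show "((\<lambda>x. 4 / \<bar>ln x\<bar>) \<longlongrightarrow> 4 / \<bar>ln g\<bar>) (at_right g)"
      using g01 lg by (intro tendsto_intros) auto
    show "4 / \<bar>ln g\<bar> < 4 / \<bar>ln g\<bar> + \<sigma> / (2 * ln m)" using \<sigma>0 lm by simp
  qed
  have ev3: "\<forall>\<^sub>F x in at_right g. g < x \<and> x < 1"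
    using eventually_at_right_less[of g] eventually_at_right_real[OF g01(2)] by eventually_elim auto
  obtain \<mu> where \<mu>: "1 / (1 - \<mu>) < \<sigma>" "4 / \<bar>ln \<mu>\<bar> < 4 / \<bar>ln g\<bar> + \<sigma> / (2 * ln m)" "g < \<mu>" "\<mu> < 1"
    using eventually_happens[OF eventually_conj[OF ev1 eventually_conj[OF ev2 ev3]]] by auto
  have \<mu>0: "0 < \<mu>" using \<mu> g01 by linarith
  obtain s1 where s1: "1 / (1 - \<mu>) < s1" "s1 < \<sigma>" using dense[OF \<mu>(1)] by blast
  obtain s2 where s2: "s1 < s2" "s2 < \<sigma>" using dense[OF s1(2)] by blast
  have s1': "1 < s1 * (1 - \<mu>)" using s1(1) \<mu>(4) by (simp add: divide_less_eq)
  \<comment> \<open>Half of the excess of \<open>s1 * (1 - \<mu>)\<close> over 1, so that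
    \<open>1 + e\<close> stays below that product.\<close>
  define e where "e = (s1 * (1 - \<mu>) - 1) / 2"
  have "1 + (y - 1) / 2 < y" if "1 < y" for y :: real using that by (simp add: field_simps)
  from this[OF s1'] have "1 + e < s1 * (1 - \<mu>)" by (simp only: e_def)
  then have e: "0 < e" "(1 + e) / (1 - \<mu>) < s1" using s1' \<mu>(4) by (auto simp: e_def divide_less_eq)
  have "1 / (1 + \<mu>) < 1 / (1 + g)" using \<mu> g01 by (intro divide_strict_left_mono) auto
  then obtain a where a: "1 / (1 + \<mu>) < a" "a < 1 / (1 + g)" using dense by blast
  have ag: "a * (1 + g) < 1" using a(2) g01 by (simp add: less_divide_eq)
  have "1 / 2 < 1 / (1 + \<mu>)" using \<mu>(4) \<mu>0 by (intro divide_strict_left_mono) auto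
  then have "1 / 2 < a" using a(1) by linarith
  then obtain \<nu> where \<nu>: "1 / 2 < \<nu>" "\<nu> < a" using dense by blast
  define kv where "kv = (m * g / (m * g + 1)) / c"
  have kv: "0 < kv" using mg_pos c_gt by (simp add: kv_def)
  \<comment> \<open>\<open>kv / (1 + kv)\<close> is the condition
    \<open>\<eta> * (1 + kv) < kv\<close> solved for \<open>\<eta>\<close>; halving makes both
    bounds strict.\<close>
  define \<eta> where "\<eta> = min (1 - \<nu> / a) (kv / (1 + kv)) / 2"
  have p: "0 < 1 - \<nu> / a" "0 < kv / (1 + kv)" using \<nu> kv by auto
  have "0 < min x y / 2" "min x y / 2 < x" "min x y / 2 < y" if "0 < x" "0 < y" for x y :: real
    using that by (auto simp: min_def field_simps)
  from this[OF p] have \<eta>: "0 < \<eta>" "\<eta> < 1 - \<nu> / a" "\<eta> < kv / (1 + kv)" unfolding \<eta>_def .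
  then have "\<eta> * (1 + kv) < kv" using kv by (simp add: less_divide_eq)
  then interpret S: pa_scaling m g \<kappa> h0 \<mu> a \<nu> \<eta> s1 s2 e kv
    by unfold_locales (use \<mu> a ag \<nu> kv_def \<eta> e s2 in auto)
  have lmm: "ln S.mm = 2 / 3 * ln m" using m2 by (simp add: S.mm_def ln_powr)
  have "s1 * (1 - \<mu>) \<le> s2 * (1 - \<mu>)" using s2 \<mu>(4) by (intro mult_right_mono) auto
  \<comment> \<open>From \<open>s2 * (1 - \<mu>) > 1\<close> one gets
    \<open>1 + s2 * \<mu> < s2 < \<sigma>\<close>; this is how the fixed-point condition on the core
    threshold becomes the \<open>\<sigma>\<close> of the periphery.\<close>
  then have "1 + s2 * \<mu> < \<sigma>" using s1' s2 by (simp add: algebra_simps)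
  then have "2 * (1 + s2 * \<mu>) / ln S.mm \<le> 2 * \<sigma> / ln S.mm"
    using lm lmm by (intro divide_right_mono) auto
  also have "\<dots> = 3 * (\<sigma> / ln m)" by (simp add: lmm)
  finally have 1: "2 * (1 + s2 * \<mu>) / ln S.mm \<le> 3 * (\<sigma> / ln m)" .
  have "4 / ln (1 / \<mu>) = 4 / \<bar>ln \<mu>\<bar>" using \<mu>0 \<mu>(4) by (simp add: ln_div)
  then have 2: "4 / ln (1 / \<mu>) < 4 / \<bar>ln g\<bar> + \<sigma> / ln m / 2" using \<mu>(2) by simp
  have "0 < \<sigma> / ln m" using \<sigma>0 lm by simp
  then have "\<sigma> / ln m / 2 < \<sigma> / ln m" by simp
  then have "4 / ln (1 / \<mu>) < 4 / \<bar>ln g\<bar> + \<sigma> / ln m" using 2 by (meson add_strict_left_mono less_trans)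
  from add_le_less_mono[OF 1 this]
  have "2 * (1 + s2 * \<mu>) / ln S.mm + 4 / ln (1 / \<mu>) < 3 * (\<sigma> / ln m) + (4 / \<bar>ln g\<bar> + \<sigma> / ln m)" .
  also have "\<dots> = 4 / \<bar>ln g\<bar> + 4 * \<sigma> / ln m" by simp
  finally have "2 * (1 + s2 * \<mu>) / ln S.mm + 4 / ln (1 / \<mu>) < 4 / \<bar>ln g\<bar> + 4 * \<sigma> / ln m" .
  then show ?thesis by (rule S.diam_law)
qed

end

theorem theorem1p6:
  fixes m :: nat and \<delta> \<tau> \<sigma> C\<^sub>G :: real
  assumes "m \<ge> 2"
    and "- real m < \<delta>" and "\<delta> < 0"
    and "\<tau> = 3 + \<delta> / real m"
    and "\<sigma> > 1 / (3 - \<tau>)"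
    and "C\<^sub>G = 4 / \<bar>ln (\<tau> - 2)\<bar> + 4 * \<sigma> / ln (real m)"
  shows "whp (pa_a m \<delta>) (\<lambda>t G. real (diam G) \<le> C\<^sub>G * ln (ln (real t)))
    \<and> whp (pa_b m \<delta>) (\<lambda>t G. real (diam G) \<le> C\<^sub>G * ln (ln (real t)))
    \<and> whp (pa_c m \<delta>) (\<lambda>t G. real (diam G) \<le> C\<^sub>G * ln (ln (real t)))"
proof -
  define g where "g = \<tau> - 2"
  have m0: "0 < real m" using assms(1) by simp
  have g: "g = 1 + \<delta> / real m" using assms(4) by (simp add: g_def)
  have "0 < g" "g < 1" using assms(2,3) m0 by (auto simp: g field_simps)
  then interpret pa_weights m g by unfold_locales (use assms(1) in auto)
  have d: "\<delta> = real m * (g - 1)" using m0 by (simp add: g)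
  have \<sigma>: "1 / (1 - g) < \<sigma>" using assms(5) by (simp add: g_def)
  have C: "C\<^sub>G = 4 / \<bar>ln g\<bar> + 4 * \<sigma> / ln (real m)" using assms(6) by (simp add: g_def)
  show ?thesis
    unfolding d C
  proof (intro conjI)
    show "whp (pa_a m (real m * (g - 1)))
        (\<lambda>t G. real (diam G) \<le> (4 / \<bar>ln g\<bar> + 4 * \<sigma> / ln (real m)) * ln (ln (real t)))"
      by (rule whp_of_law[OF pa.diam_loglog[OF pa_model_ab[of 1] \<sigma>] pa_a_eq]) auto
    show "whp (pa_b m (real m * (g - 1)))
        (\<lambda>t G. real (diam G) \<le> (4 / \<bar>ln g\<bar> + 4 * \<sigma> / ln (real m)) * ln (ln (real t)))"
      by (rule whp_of_law[OF pa.diam_loglog[OF pa_model_ab[of 0] \<sigma>] pa_b_eq]) auto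
    show "whp (pa_c m (real m * (g - 1)))
        (\<lambda>t G. real (diam G) \<le> (4 / \<bar>ln g\<bar> + 4 * \<sigma> / ln (real m)) * ln (ln (real t)))"
      by (rule whp_of_law[OF pa.diam_loglog[OF pa_model_c \<sigma>] pa_c_eq])
  qed
qed

end
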